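(* There exists a $\sigma$-complete Boolean algebra that satisfies the countable chain condition and the general distributive law, but is not a measure algebra.
   Context: For a Boolean algebra $\mathcal{B}$, $0$ and $1$ denote its smallest and largest elements, and $\cap,\cup,\subset$ its operations and order. $\mathcal{B}$ is $\sigma$-complete if every countable subset has a least upper bound (and hence a greatest lower bound). A subset $\mathcal{C}\subset\mathcal{B}$ is disjoint if $A\cap B=0$ whenever $A,B\in\mathcal{C}$, $A\ne B$. A disjoint set $\mathcal{C}$ is a partition if its least upper bound $\cup\,\mathcal{C}$ equals $1$. $\mathcal{B}$ satisfies the countable chain condition if every disjoint subset of $\mathcal{B}$ is countable. Given a partition $\Pi$, an element $A\in\mathcal{B}$ is finitely covered by $\Pi$ if there is a finite subset $\{A_1,\dots,A_n\}$ of $\Pi$ with $A\subset\bigcup_{i\le n}A_i$. $\mathcal{B}$ satisfies the general distributive law if for every sequence $(\Pi_n)$ of partitions of $\mathcal{B}$ there is a single partition $\Pi$ of $\mathcal{B}$ such that every element of $\Pi$ is finitely covered by each $\Pi_n$. A (finitely additive) measure on $\mathcal{B}$ is a map $\mu:\mathcal{B}\to[0,\infty)$ with $\mu(0)=0$ and $\mu(A\cup B)=\mu(A)+\mu(B)$ whenever $A\cap B=0$; it is positive if $\mu(A)=0\Rightarrow A=0$, and continuous if $\lim_n\mu(A_n)=0$ for every decreasing sequence $(A_n)$ with $\bigcap_nA_n=0$. A measure algebra is a $\sigma$-complete Boolean algebra on which there is a positive continuous measure. *)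

theory Defs
  imports Complex_Main "HOL-Library.Countable_Set" "HOL-Algebra.Lattice"
begin

text \<open>
  Boolean algebras are carrier-based ordered structures in the style of HOL-Algebra:
  bounded distributive complemented lattices, with \<open>x \<sqinter> y\<close>, \<open>x \<squnion> y\<close>, \<open>x \<sqsubseteq> y\<close>, \<open>\<bottom>\<close>, \<open>\<top>\<close>
  for \<open>x \<inter> y\<close>, \<open>x \<union> y\<close>, \<open>x \<subset> y\<close> (not necessarily strict), \<open>0\<close>, \<open>1\<close>.
  The one-element algebra is not excluded.
\<close>

locale boolean_lattice = bounded_lattice B for B (structure) +
  assumes meet_join_distrib:
    "\<lbrakk>x \<in> carrier B; y \<in> carrier B; z \<in> carrier B\<rbrakk>
      \<Longrightarrow> x \<sqinter> (y \<squnion> z) = (x \<sqinter> y) \<squnion> (x \<sqinter> z)"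
  and complement_exists:
    "x \<in> carrier B \<Longrightarrow> \<exists>y\<in>carrier B. x \<sqinter> y = \<bottom> \<and> x \<squnion> y = \<top>"

locale sigma_complete_boolean_lattice = boolean_lattice B for B (structure) +
  assumes countable_lub_exists:
    "\<lbrakk>S \<subseteq> carrier B; countable S\<rbrakk> \<Longrightarrow> \<exists>s. is_lub B s S"

definition disjoint_subset :: "('a, 'b) gorder_scheme \<Rightarrow> 'a set \<Rightarrow> bool" where
  "disjoint_subset B C \<longleftrightarrow>
     C \<subseteq> carrier B \<and> (\<forall>x\<in>C. \<forall>y\<in>C. x \<noteq> y \<longrightarrow> x \<sqinter>\<^bsub>B\<^esub> y = \<bottom>\<^bsub>B\<^esub>)"

definition partition_of_unity :: "('a, 'b) gorder_scheme \<Rightarrow> 'a set \<Rightarrow> bool" where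
  "partition_of_unity B C \<longleftrightarrow> disjoint_subset B C \<and> is_lub B \<top>\<^bsub>B\<^esub> C"

definition countable_chain_condition :: "('a, 'b) gorder_scheme \<Rightarrow> bool" where
  "countable_chain_condition B \<longleftrightarrow> (\<forall>C. disjoint_subset B C \<longrightarrow> countable C)"

definition finitely_covered :: "('a, 'b) gorder_scheme \<Rightarrow> 'a set \<Rightarrow> 'a \<Rightarrow> bool" where
  "finitely_covered B P a \<longleftrightarrow> (\<exists>F. finite F \<and> F \<subseteq> P \<and> a \<sqsubseteq>\<^bsub>B\<^esub> \<Squnion>\<^bsub>B\<^esub> F)"

definition general_distributive_law :: "('a, 'b) gorder_scheme \<Rightarrow> bool" where
  "general_distributive_law B \<longleftrightarrow>
     (\<forall>P :: nat \<Rightarrow> 'a set. (\<forall>n. partition_of_unity B (P n)) \<longrightarrow>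
       (\<exists>Q. partition_of_unity B Q \<and> (\<forall>a\<in>Q. \<forall>n. finitely_covered B (P n) a)))"

text \<open>Values of \<open>\<mu>\<close> outside the carrier are irrelevant.\<close>

definition fin_additive_measure :: "('a, 'b) gorder_scheme \<Rightarrow> ('a \<Rightarrow> real) \<Rightarrow> bool" where
  "fin_additive_measure B \<mu> \<longleftrightarrow>
     (\<forall>x\<in>carrier B. 0 \<le> \<mu> x) \<and> \<mu> \<bottom>\<^bsub>B\<^esub> = 0 \<and>
     (\<forall>x\<in>carrier B. \<forall>y\<in>carrier B.
        x \<sqinter>\<^bsub>B\<^esub> y = \<bottom>\<^bsub>B\<^esub> \<longrightarrow> \<mu> (x \<squnion>\<^bsub>B\<^esub> y) = \<mu> x + \<mu> y)"

definition positive_on_algebra :: "('a, 'b) gorder_scheme \<Rightarrow> ('a \<Rightarrow> real) \<Rightarrow> bool" where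
  "positive_on_algebra B \<mu> \<longleftrightarrow> (\<forall>x\<in>carrier B. \<mu> x = 0 \<longrightarrow> x = \<bottom>\<^bsub>B\<^esub>)"

definition continuous_on_algebra :: "('a, 'b) gorder_scheme \<Rightarrow> ('a \<Rightarrow> real) \<Rightarrow> bool" where
  "continuous_on_algebra B \<mu> \<longleftrightarrow>
     (\<forall>A :: nat \<Rightarrow> 'a. (\<forall>n. A n \<in> carrier B) \<and> (\<forall>n. A (Suc n) \<sqsubseteq>\<^bsub>B\<^esub> A n) \<and>
        is_glb B \<bottom>\<^bsub>B\<^esub> (range A) \<longrightarrow> (\<lambda>n. \<mu> (A n)) \<longlonglongrightarrow> 0)"

definition is_measure_algebra :: "('a, 'b) gorder_scheme \<Rightarrow> bool" where
  "is_measure_algebra B \<longleftrightarrow>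
     sigma_complete_boolean_lattice B \<and>
     (\<exists>\<mu>. fin_additive_measure B \<mu> \<and> positive_on_algebra B \<mu> \<and> continuous_on_algebra B \<mu>)"

text \<open>
  HOL cannot quantify existentially over types, so the elements of an algebra whose existence
  is asserted have to be taken from a fixed type. This one houses every quotient of an algebra of
  subsets of a product of countably many countable discrete spaces: points are sequences, and
  elements of a quotient are equivalence classes of sets of points. The algebra itself may have
  any subset of this type as its carrier.
\<close>

type_synonym algebra_element = "(nat \<Rightarrow> nat) set set"

end

theory Submission
  imports Defs
begin

text \<open>
  The algebra is the completion of the clopen algebra of \<open>\<Prod>\<^sub>i {0..<2 ^ i}\<close> under an exhaustive
  submeasure \<open>\<nu>\<close> that is pathological in the sense that \<open>\<nu> {z. \<forall>n\<in>I. z n \<noteq> t n} \<le> 2\<^sup>-\<^sup>k\<close>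
  whenever \<open>card I\<close> is large in terms of \<open>k\<close>. Exhaustivity makes the outer submeasure continuous on
  the completion, whence the countable chain condition and the distributive law. A positive
  continuous measure \<open>\<mu>\<close> cannot exist: choosing \<open>t n\<close> with \<open>\<mu> {z. z n = t n}\<close> at most
  \<open>2\<^sup>-\<^sup>n\<close> of the total mass gives such sets with half of the mass of \<open>\<mu>\<close> and arbitrarily small \<open>\<nu>\<close>.

  The submeasure is Talagrand's: \<open>\<nu> E\<close> is the infimum of the weights of finite covers of \<open>E\<close> by
  weighted sets, organised in levels \<open>k\<close>. A set of level \<open>k\<close> leaves room between any two of its
  marked coordinates for a set that is large for the submeasure built from the levels above \<open>k\<close>;
  its weight is about \<open>2\<^sup>-\<^sup>k\<close> if it has the maximal number of marked coordinates and increases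
  slowly as the number decreases. Each level refers to the next one without end, so the
  construction is carried out with finitely many levels and an ultrafilter limit is taken.
  Members of a disjoint sequence are, up to a small error, eventually of level \<open>k\<close> with maximal
  index set, hence \<open>\<nu>\<close> tends to \<open>0\<close> along the sequence.
\<close>

section \<open>Weighted sets\<close>

text \<open>Exhaustivity asks for many light sets, while light families must not cover the space;
  thinness reconciles the two. A light family contains few sets of level \<open>k\<close>, because
  each weighs at least \<open>1 / 2 ^ k\<close>, and these have so many marked coordinates that all
  of them can be dodged in turn. The intervals used for this must not make the sets of higher levels
  expensive. Hence the weight is a small negative power of the number of marked coordinates: a set
  with a fixed fraction of them in an interval can be replaced there by a set of almost the same
  weight. Conversely, a disjoint sequence allows marked coordinates to be added one by one until the
  weight is least, as long as the room between them is measured by the levels above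
  \<open>k\<close>; measuring it by level \<open>k\<close> itself would be circular. The value
  \<open>16\<close> for the whole space is no optimum: it leaves room for the factors of
  \<open>2\<close> lost whenever a cover is localised to a range of coordinates.\<close>

text \<open>Coordinate \<open>i\<close> of a point matters only modulo \<open>2 ^ i\<close>. All functions thus represent points of
  the compact space \<open>\<Prod>\<^sub>i {0..<2 ^ i}\<close>, and no membership side conditions arise.\<close>

definition agree :: "nat set \<Rightarrow> (nat \<Rightarrow> nat) \<Rightarrow> (nat \<Rightarrow> nat) \<Rightarrow> bool" where
  "agree S x y \<longleftrightarrow> (\<forall>i\<in>S. x i mod 2 ^ i = y i mod 2 ^ i)"

definition depends :: "nat set \<Rightarrow> (nat \<Rightarrow> nat) set \<Rightarrow> bool" where
  "depends S E \<longleftrightarrow> (\<forall>x y. agree S x y \<longrightarrow> x \<in> E \<longrightarrow> y \<in> E)"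

definition splice :: "nat \<Rightarrow> (nat \<Rightarrow> nat) \<Rightarrow> (nat \<Rightarrow> nat) \<Rightarrow> nat \<Rightarrow> nat" where
  "splice m x y = (\<lambda>i. if i < m then x i else y i)"

lemma agree_refl [simp]: "agree S x x"
  by (simp add: agree_def)

lemma agree_sym: "agree S x y \<Longrightarrow> agree S y x"
  by (simp add: agree_def)

lemma agree_trans: "agree S x y \<Longrightarrow> agree S y z \<Longrightarrow> agree S x z"
  by (simp add: agree_def)

lemma agree_mono: "agree S x y \<Longrightarrow> R \<subseteq> S \<Longrightarrow> agree R x y"
  by (auto simp: agree_def)

lemma dependsD: "depends S E \<Longrightarrow> agree S x y \<Longrightarrow> x \<in> E \<longleftrightarrow> y \<in> E"
  unfolding depends_def using agree_sym by blast

lemma depends_mono: "depends R E \<Longrightarrow> R \<subseteq> S \<Longrightarrow> depends S E"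
  unfolding depends_def using agree_mono by blast

lemma depends_empty [simp]: "depends S {}" and depends_UNIV [simp]: "depends S UNIV"
  by (simp_all add: depends_def)

lemma depends_Un: "depends S A \<Longrightarrow> depends S B \<Longrightarrow> depends S (A \<union> B)"
  unfolding depends_def by blast

lemma depends_Compl: "depends S A \<Longrightarrow> depends S (- A)"
  unfolding depends_def using agree_sym by blast

lemma depends_UN: "(\<And>i. i \<in> J \<Longrightarrow> depends S (A i)) \<Longrightarrow> depends S (\<Union>i\<in>J. A i)"
  unfolding depends_def by blast

lemma depends_INT: "(\<And>i. i \<in> J \<Longrightarrow> depends S (A i)) \<Longrightarrow> depends S (\<Inter>i\<in>J. A i)"
  unfolding depends_def by blast

lemma splice_less: "i < m \<Longrightarrow> splice m x y i = x i"
  by (simp add: splice_def)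

lemma agree_splice_left: "agree {..<m} (splice m x y) x"
  by (auto simp: splice_def agree_def)

lemma agree_splice_right: "agree {m..} (splice m x y) y"
  by (auto simp: splice_def agree_def)

lemma agree_splice_cong: "agree S y z \<Longrightarrow> agree S (splice m x y) (splice m x z)"
  by (auto simp: splice_def agree_def)

lemma agree_splice_self: "agree {..<m} z x \<Longrightarrow> agree UNIV (splice m x z) z"
  by (auto simp: splice_def agree_def)

text \<open>The exponents are small enough that restricting an index set to a fraction \<open>2\<^sup>-\<^sup>(\<^sup>j\<^sup>+\<^sup>7\<^sup>)\<close> of its
  elements costs at most a factor \<open>2 powr 2\<^sup>-\<^sup>(\<^sup>j\<^sup>+\<^sup>1\<^sup>)\<close> at all levels above \<open>j\<close>; the product of these
  factors is \<open>2\<close>. The maximal cardinalities are then large enough for a set of weight below \<open>32\<close>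
  to have at least \<open>2 ^ (2 * k + 20)\<close> indices.\<close>

definition max_card :: "nat \<Rightarrow> nat" where
  "max_card k = 2 ^ (2 * k + 20) * 2 ^ ((k + 5) * ((k + 6) * 2 ^ k))"

definition wt_expo :: "nat \<Rightarrow> real" where
  "wt_expo k = 1 / real ((k + 6) * 2 ^ k)"

definition wt :: "nat \<Rightarrow> nat \<Rightarrow> real" where
  "wt k i = (real (max_card k) / real i) powr wt_expo k / 2 ^ k"

lemma max_card_pos: "max_card k > 0"
  by (simp add: max_card_def)

lemma wt_expo_pos: "wt_expo k > 0"
  by (simp add: wt_expo_def)

lemma wt_nonneg: "wt k i \<ge> 0"
  by (simp add: wt_def)

lemma wt_max_card: "wt k (max_card k) = 1 / 2 ^ k"
  using max_card_pos[of k] by (simp add: wt_def)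

text \<open>Bounds the number of sets of level \<open>k\<close> in a family: total weight below
  \<open>32\<close> allows fewer than \<open>2 ^ (k + 5)\<close> of them.\<close>

lemma wt_ge:
  assumes "1 \<le> i" "i \<le> max_card k"
  shows "1 / 2 ^ k \<le> wt k i"
proof -
  have "1 \<le> real (max_card k) / real i"
    using assms by simp
  then have "1 \<le> (real (max_card k) / real i) powr wt_expo k"
    using wt_expo_pos[of k] by (simp add: ge_one_powr_ge_zero)
  then show ?thesis
    unfolding wt_def by (simp add: divide_right_mono)
qed

text \<open>Fewer indices would make the ratio \<open>max_card k / i\<close> at least the second
  factor of \<open>max_card k\<close>, whose power with exponent \<open>wt_expo k\<close> is
  \<open>2 ^ (k + 5)\<close>; divided by \<open>2 ^ k\<close> this is \<open>32\<close>.\<close>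

lemma wt_large_index:
  assumes "1 \<le> i" "wt k i < 32"
  shows "2 ^ (2 * k + 20) \<le> i"
proof (rule ccontr)
  let ?e = "(k + 6) * 2 ^ k"
  assume "\<not> 2 ^ (2 * k + 20) \<le> i"
  then have "real i \<le> real (2 ^ (2 * k + 20))"
    by (simp only: of_nat_le_iff)
  then have "real i * 2 ^ ((k + 5) * ?e) \<le> real (max_card k)"
    unfolding max_card_def of_nat_mult by (simp add: mult_right_mono)
  then have "2 ^ ((k + 5) * ?e) \<le> real (max_card k) / real i"
    using assms(1) by (simp add: field_simps)
  then have "(2 ^ ((k + 5) * ?e)) powr wt_expo k \<le> (real (max_card k) / real i) powr wt_expo k"
    using wt_expo_pos[of k] by (intro powr_mono2) auto
  moreover have "(2 ^ ((k + 5) * ?e) :: real) powr wt_expo k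
    = 2 powr (real ((k + 5) * ?e) * wt_expo k)"
    by (simp only: powr_realpow[symmetric] powr_powr zero_less_numeral)
  moreover have "real ((k + 5) * ?e) * wt_expo k = real (k + 5)"
    unfolding wt_expo_def of_nat_mult by simp
  ultimately have "2 powr real (k + 5) \<le> (real (max_card k) / real i) powr wt_expo k"
    by metis
  then have "2 ^ (k + 5) / 2 ^ k \<le> wt k i"
    unfolding wt_def by (subst (asm) powr_realpow) (auto intro: divide_right_mono)
  then show False
    using assms(2) by (simp add: power_add)
qed

lemma wt_restrict:
  assumes "1 \<le> i'" "1 \<le> i" "i \<le> Q * i'"
  shows "wt k i' \<le> real Q powr wt_expo k * wt k i"
proof -
  have "real i \<le> real Q * real i'"
    using assms(3) by (simp only: of_nat_le_iff of_nat_mult[symmetric])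
  then have "real (max_card k) * real i \<le> real (max_card k) * (real Q * real i')"
    by (rule mult_left_mono) simp
  then have "real (max_card k) / real i' \<le> real Q * (real (max_card k) / real i)"
    using assms(1,2) by (simp add: field_simps)
  then have "(real (max_card k) / real i') powr wt_expo k
    \<le> (real Q * (real (max_card k) / real i)) powr wt_expo k"
    using wt_expo_pos[of k] by (intro powr_mono2) auto
  also have "\<dots> = real Q powr wt_expo k * (real (max_card k) / real i) powr wt_expo k"
    by (rule powr_mult)
  finally show ?thesis
    unfolding wt_def by (simp add: divide_right_mono)
qed

definition wt_factor :: "nat \<Rightarrow> real" where
  "wt_factor k = 2 powr (1 / 2 ^ (k + 1))"

lemma wt_restrict_wt_factor:
  assumes "1 \<le> i'" "1 \<le> i" "i \<le> 2 ^ (j + 7) * i'" "j < k"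
  shows "wt k i' \<le> wt_factor j * wt k i"
proof -
  have "real (2 ^ (j + 7)) powr wt_expo k = (2 powr real (j + 7)) powr wt_expo k"
    by (subst powr_realpow) auto
  also have "\<dots> = 2 powr (real (j + 7) * wt_expo k)"
    by (simp add: powr_powr)
  also have "\<dots> \<le> wt_factor j"
    unfolding wt_factor_def
  proof (rule powr_mono)
    \<comment> \<open>Equality holds for \<open>k = j + 1\<close>; this inequality dictates the form
      of \<open>wt_expo\<close>.\<close>
    have "(j + 7) * 2 ^ (j + 1) \<le> (k + 6) * (2 ^ k :: nat)"
      using assms(4) by (intro mult_mono power_increasing) auto
    then have "real ((j + 7) * 2 ^ (j + 1)) \<le> real ((k + 6) * 2 ^ k)"
      by (simp only: of_nat_le_iff)
    then show "real (j + 7) * wt_expo k \<le> 1 / 2 ^ (j + 1)"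
      unfolding wt_expo_def by (simp add: divide_simps)
  qed simp
  finally have "real (2 ^ (j + 7)) powr wt_expo k * wt k i \<le> wt_factor j * wt k i"
    by (rule mult_right_mono) (rule wt_nonneg)
  with wt_restrict[OF assms(1-3), of k] show ?thesis by simp
qed

text \<open>Cruder than \<open>wt_restrict_wt_factor\<close> but valid at every level. Exhaustivity
  loses this factor only a bounded number of times and can afford it.\<close>

lemma wt_restrict_half:
  assumes "1 \<le> i'" "1 \<le> i" "i \<le> 2 * i'"
  shows "wt k i' \<le> 2 * wt k i"
proof -
  have "1 \<le> (k + 6) * 2 ^ k"
    by (simp add: Suc_le_eq)
  then have "real ((k + 6) * 2 ^ k) \<ge> real 1"
    by (rule of_nat_mono)
  then have "wt_expo k \<le> 1"
    unfolding wt_expo_def by simp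
  then have "2 powr wt_expo k \<le> 2 powr 1"
    by (intro powr_mono) auto
  then have "2 powr wt_expo k * wt k i \<le> 2 * wt k i"
    using wt_nonneg[of k i] by (intro mult_right_mono) auto
  with wt_restrict[OF assms, of k] show ?thesis by simp
qed

lemma wt_factor_ge_1: "1 \<le> wt_factor k"
  unfolding wt_factor_def by (rule ge_one_powr_ge_zero) auto

lemma wt_factor_le_2: "wt_factor k \<le> 2"
proof -
  have "wt_factor k \<le> 2 powr 1"
    unfolding wt_factor_def by (rule powr_mono) (auto simp del: power_Suc)
  then show ?thesis by simp
qed

text \<open>\<open>bound k\<close> increases from \<open>16\<close> to \<open>32\<close>; covers by levels \<open>\<ge> k\<close> of the whole space have
  weight at least \<open>bound k\<close>.\<close>

definition bound :: "nat \<Rightarrow> real" where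
  "bound k = 2 powr (5 - 1 / 2 ^ k)"

text \<open>\<open>tower_not_covered\<close> passes from \<open>Suc k\<close> to \<open>k\<close>: a
  family lighter than \<open>bound k\<close>, restricted at the cost of a factor
  \<open>wt_factor k\<close>, stays lighter than \<open>bound (Suc k)\<close>.\<close>

lemma bound_Suc: "bound (Suc k) = wt_factor k * bound k"
  unfolding bound_def wt_factor_def powr_add[symmetric] by simp

lemma bound_less: "bound k < 32"
proof -
  have "bound k < 2 powr 5"
    unfolding bound_def by (rule powr_less_mono) auto
  then show ?thesis by simp
qed

lemma bound_0: "bound 0 = 16"
  by (simp add: bound_def)

lemma bound_pos: "0 < bound k"
  by (simp add: bound_def)

lemma bound_ge: "16 \<le> bound k"
proof (induction k)
  case (Suc k)
  have "1 * bound k \<le> bound (Suc k)"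
    unfolding bound_Suc using wt_factor_ge_1 bound_pos[of k] by (intro mult_right_mono) auto
  with Suc show ?case by simp
qed (simp add: bound_0)

text \<open>The weight is recorded because the same set and index set may occur at several levels
  with different weights.\<close>

type_synonym wset = "(nat \<Rightarrow> nat) set \<times> nat set \<times> real"

abbreviation wset_set :: "wset \<Rightarrow> (nat \<Rightarrow> nat) set" where "wset_set e \<equiv> fst e"
abbreviation wset_idx :: "wset \<Rightarrow> nat set" where "wset_idx e \<equiv> fst (snd e)"
abbreviation wset_wt :: "wset \<Rightarrow> real" where "wset_wt e \<equiv> snd (snd e)"

definition covered :: "wset set \<Rightarrow> real \<Rightarrow> (nat \<Rightarrow> nat) set \<Rightarrow> bool" where
  "covered \<C> r E \<longleftrightarrow> (\<exists>F. finite F \<and> F \<subseteq> \<C> \<and> sum wset_wt F < r \<and> E \<subseteq> (\<Union>e\<in>F. wset_set e))"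

text \<open>Talagrand lets \<open>C\<close> be a subset of the cylinder of \<open>x\<close> and measures its preimage under the
  projection onto that cylinder. Letting \<open>C\<close> depend on the coordinates in \<open>{m..<n}\<close> only amounts
  to the same and needs no projections.\<close>

definition thin :: "((nat \<Rightarrow> nat) set \<Rightarrow> bool) \<Rightarrow> nat set \<Rightarrow> (nat \<Rightarrow> nat) set \<Rightarrow> bool" where
  "thin P I E \<longleftrightarrow> (\<forall>m\<in>I. \<forall>n\<in>I. m < n \<longrightarrow>
     (\<forall>x. \<exists>C. depends {m..<n} C \<and> P C \<and> (\<forall>z\<in>C. agree {..<m} z x \<longrightarrow> z \<notin> E)))"

text \<open>This kind provides the pathological sets: \<open>C\<close> need not be large, but it depends on a single
  coordinate, where no set of a higher level has a sizeable fraction of its indices.\<close>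

definition dthin :: "nat set \<Rightarrow> (nat \<Rightarrow> nat) set \<Rightarrow> bool" where
  "dthin I E \<longleftrightarrow> (\<forall>m\<in>I. \<exists>C. depends {m} C \<and> C \<noteq> {} \<and> C \<inter> E = {})"

definition level :: "nat \<Rightarrow> ((nat \<Rightarrow> nat) set \<Rightarrow> bool) \<Rightarrow> wset set" where
  "level k P = {(E, I, w) | E I w. finite I \<and> I \<noteq> {} \<and> card I \<le> max_card k \<and> w = wt k (card I) \<and>
     (thin P I E \<or> dthin I E)}"

text \<open>\<open>tower d k\<close> consists of the \<open>d\<close> levels from \<open>k\<close> onwards. Level \<open>k\<close> refers to the levels above
  it, and the recursion ends with the empty class, which covers only the empty set.\<close>

fun tower :: "nat \<Rightarrow> nat \<Rightarrow> wset set" where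
  "tower 0 k = {}"
| "tower (Suc d) k = level k (\<lambda>C. \<not> covered (tower d (Suc k)) 1 C) \<union> tower d (Suc k)"

text \<open>The whole level is included, not just the given element, because restriction stays
  within a level but changes set, index set and weight.\<close>

lemma tower_level:
  "e \<in> tower d k \<Longrightarrow> \<exists>k'\<ge>k. \<exists>P. e \<in> level k' P \<and> level k' P \<subseteq> tower d k"
proof (induction d arbitrary: k)
  case (Suc d)
  show ?case
  proof (cases "e \<in> level k (\<lambda>C. \<not> covered (tower d (Suc k)) 1 C)")
    case True
    then show ?thesis by (intro exI[of _ k]) auto
  next
    case False
    with Suc.prems have "e \<in> tower d (Suc k)" by simp
    from Suc.IH[OF this] obtain k' P where "k' \<ge> Suc k" "e \<in> level k' P"
      "level k' P \<subseteq> tower d (Suc k)"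
      by blast
    then show ?thesis by (intro exI[of _ k']) auto
  qed
qed simp

lemma tower_idx: "e \<in> tower d k \<Longrightarrow> finite (wset_idx e) \<and> wset_idx e \<noteq> {} \<and> wset_wt e \<ge> 0"
  using tower_level[of e d k] by (auto simp: level_def wt_nonneg)

lemma tower_large_index:
  assumes "e \<in> tower d k" "wset_wt e < 32"
  shows "2 ^ (2 * k + 20) \<le> card (wset_idx e)"
proof -
  from tower_level[OF assms(1)] obtain k' P where k': "k' \<ge> k" "e \<in> level k' P" by blast
  then have "2 ^ (2 * k' + 20) \<le> card (wset_idx e)"
    using assms(2) by (intro wt_large_index) (auto simp: level_def Suc_le_eq card_gt_0_iff)
  moreover have "2 ^ (2 * k + 20) \<le> (2 ^ (2 * k' + 20) :: nat)"
    using k' by (intro power_increasing) auto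
  ultimately show ?thesis by linarith
qed

text \<open>The witnesses avoided by \<open>E\<close> that belong to marked coordinates inside
  \<open>{m..<n}\<close> are kept, and \<open>E'\<close> consists of the points that avoid them once
  the coordinates below \<open>m\<close> are taken from \<open>x\<close>. So \<open>E'\<close> is
  thin in the same way, contains the part of \<open>E\<close> in the cylinder of \<open>x\<close>,
  and sees no coordinates outside \<open>{m..<n}\<close>. In the discrete case a witness lives on
  one coordinate and needs no cylinder.\<close>

lemma level_restrict:
  assumes "(E, I, w) \<in> level k P" "I \<inter> {m..<n} \<noteq> {}"
  shows "\<exists>E'. (E', I \<inter> {m..<n}, wt k (card (I \<inter> {m..<n}))) \<in> level k P \<and> depends {m..<n} E' \<and>
           (\<forall>z\<in>E. agree {..<m} z x \<longrightarrow> z \<in> E')"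
proof -
  let ?I = "I \<inter> {m..<n}"
  have fin: "finite I" and card: "card I \<le> max_card k" and th: "thin P I E \<or> dthin I E"
    using assms(1) by (auto simp: level_def)
  have card': "card ?I \<le> max_card k"
    using card card_mono[OF fin, of ?I] by auto
  have "\<exists>E'. (thin P ?I E' \<or> dthin ?I E') \<and> depends {m..<n} E' \<and> (\<forall>z\<in>E. agree {..<m} z x \<longrightarrow> z \<in> E')"
    using th
  proof
    assume "thin P I E"
    then have "\<forall>a b y. \<exists>C. a \<in> I \<longrightarrow> b \<in> I \<longrightarrow> a < b \<longrightarrow>
        depends {a..<b} C \<and> P C \<and> (\<forall>z\<in>C. agree {..<a} z y \<longrightarrow> z \<notin> E)"
      unfolding thin_def by blast
    then obtain Cf where "\<forall>a b y. a \<in> I \<longrightarrow> b \<in> I \<longrightarrow> a < b \<longrightarrow>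
        depends {a..<b} (Cf a b y) \<and> P (Cf a b y) \<and> (\<forall>z\<in>Cf a b y. agree {..<a} z y \<longrightarrow> z \<notin> E)"
      by (simp only: choice_iff) blast
    then have Cf: "\<And>a b y. a \<in> I \<Longrightarrow> b \<in> I \<Longrightarrow> a < b \<Longrightarrow> depends {a..<b} (Cf a b y)"
        "\<And>a b y. a \<in> I \<Longrightarrow> b \<in> I \<Longrightarrow> a < b \<Longrightarrow> P (Cf a b y)"
        "\<And>a b y z. a \<in> I \<Longrightarrow> b \<in> I \<Longrightarrow> a < b \<Longrightarrow> z \<in> Cf a b y \<Longrightarrow> agree {..<a} z y \<Longrightarrow> z \<notin> E"
      by blast+
    \<comment> \<open>The witness for a cylinder was chosen separately for each point
      \<open>y\<close> in it. Excluding the witnesses of all these \<open>y\<close> makes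
      \<open>E'\<close> independent of the choice of the point.\<close>
    define E' where "E' = {z. \<forall>a\<in>?I. \<forall>b\<in>?I. a < b \<longrightarrow>
      (\<forall>y. agree {..<a} y (splice m x z) \<longrightarrow> z \<notin> Cf a b y)}"
    have "thin P ?I E'"
      unfolding thin_def
    proof (intro ballI allI impI)
      fix a b y assume ab: "a \<in> ?I" "b \<in> ?I" "a < b"
      show "\<exists>C. depends {a..<b} C \<and> P C \<and> (\<forall>z\<in>C. agree {..<a} z y \<longrightarrow> z \<notin> E')"
      proof (intro exI[of _ "Cf a b (splice m x y)"] conjI ballI impI)
        fix z assume z: "z \<in> Cf a b (splice m x y)" "agree {..<a} z y"
        have "agree {..<a} (splice m x y) (splice m x z)"
          by (rule agree_splice_cong, rule agree_sym, fact z(2))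
        with z(1) ab show "z \<notin> E'" unfolding E'_def by blast
      qed (use ab Cf in auto)
    qed
    moreover have "depends {m..<n} E'"
      unfolding depends_def
    proof (intro allI impI)
      fix z z' assume zz: "agree {m..<n} z z'" "z \<in> E'"
      show "z' \<in> E'"
        unfolding E'_def
      proof (intro CollectI ballI allI impI)
        fix a b y assume ab: "a \<in> ?I" "b \<in> ?I" "a < b" and y: "agree {..<a} y (splice m x z')"
        have "agree {..<a} (splice m x z') (splice m x z)"
          using zz(1) ab by (auto simp: agree_def splice_def)
        with y have "agree {..<a} y (splice m x z)" by (rule agree_trans)
        with zz(2) ab have "z \<notin> Cf a b y" unfolding E'_def by blast
        moreover have "depends {m..<n} (Cf a b y)"
          by (rule depends_mono[OF Cf(1)]) (use ab in auto)
        ultimately show "z' \<notin> Cf a b y" using dependsD zz(1) by blast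
      qed
    qed
    moreover have "z \<in> E'" if "z \<in> E" "agree {..<m} z x" for z
      unfolding E'_def
    proof (intro CollectI ballI allI impI)
      fix a b y assume ab: "a \<in> ?I" "b \<in> ?I" "a < b" and y: "agree {..<a} y (splice m x z)"
      have "agree {..<a} (splice m x z) z"
        using agree_splice_self[OF that(2)] by (rule agree_mono) simp
      with y have "agree {..<a} z y" using agree_trans agree_sym by blast
      with Cf(3) ab that(1) show "z \<notin> Cf a b y" by blast
    qed
    ultimately show ?thesis by blast
  next
    assume "dthin I E"
    then obtain Cf where Cf: "\<And>a. a \<in> I \<Longrightarrow> depends {a} (Cf a)" "\<And>a. a \<in> I \<Longrightarrow> Cf a \<noteq> {}"
        "\<And>a. a \<in> I \<Longrightarrow> Cf a \<inter> E = {}"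
      unfolding dthin_def by metis
    define E' where "E' = (\<Inter>a\<in>?I. - Cf a)"
    have "dthin ?I E'"
      unfolding dthin_def
    proof
      fix a assume a: "a \<in> ?I"
      then have "Cf a \<inter> E' = {}" unfolding E'_def by auto
      with a Cf(1,2) show "\<exists>C. depends {a} C \<and> C \<noteq> {} \<and> C \<inter> E' = {}" by blast
    qed
    moreover have "depends {m..<n} E'"
      unfolding E'_def
    proof (rule depends_INT)
      fix a assume "a \<in> ?I"
      then show "depends {m..<n} (- Cf a)"
        using depends_mono[OF depends_Compl[OF Cf(1)], of a "{m..<n}"] by auto
    qed
    moreover have "E \<subseteq> E'"
      unfolding E'_def using Cf(3) by auto
    ultimately show ?thesis by blast
  qed
  then obtain E' where "thin P ?I E' \<or> dthin ?I E'" "depends {m..<n} E'"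
      "\<forall>z\<in>E. agree {..<m} z x \<longrightarrow> z \<in> E'"
    by blast
  then show ?thesis
    using fin card' assms(2) by (intro exI[of _ E']) (auto simp: level_def)
qed

text \<open>\<open>Q\<close> bounds the inverse of the fraction of indices retained by the interval,
  \<open>f\<close> the resulting increase in weight. The new set replaces the old one within the
  cylinder of \<open>x\<close> only.\<close>

definition restrictable :: "wset set \<Rightarrow> nat \<Rightarrow> real \<Rightarrow> bool" where
  "restrictable \<C> Q f \<longleftrightarrow> (\<forall>e\<in>\<C>. \<forall>x m n. card (wset_idx e) \<le> Q * card (wset_idx e \<inter> {m..<n}) \<longrightarrow>
     (\<exists>e'\<in>\<C>. wset_wt e' \<le> f * wset_wt e \<and> wset_idx e' = wset_idx e \<inter> {m..<n} \<and>
        depends {m..<n} (wset_set e') \<and> (\<forall>z\<in>wset_set e. agree {..<m} z x \<longrightarrow> z \<in> wset_set e')))"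

lemma restrictable_clI:
  assumes "\<And>k' i i'. k \<le> k' \<Longrightarrow> 1 \<le> i' \<Longrightarrow> 1 \<le> i \<Longrightarrow> i \<le> Q * i' \<Longrightarrow> wt k' i' \<le> f * wt k' i"
  shows "restrictable (tower d k) Q f"
  unfolding restrictable_def
proof (intro ballI allI impI)
  fix e x m n
  assume e: "e \<in> tower d k" and Q: "card (wset_idx e) \<le> Q * card (wset_idx e \<inter> {m..<n})"
  from tower_level[OF e] obtain k' P where k': "k' \<ge> k" "e \<in> level k' P" "level k' P \<subseteq> tower d k"
    by blast
  obtain E I w where ee: "e = (E, I, w)" by (cases e)
  have I: "finite I" "I \<noteq> {}" "w = wt k' (card I)" using k'(2) ee by (auto simp: level_def)
  then have "card I \<ge> 1" by (simp add: Suc_le_eq card_gt_0_iff)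
  with Q ee have ne: "I \<inter> {m..<n} \<noteq> {}" by (intro notI) auto
  then have "card (I \<inter> {m..<n}) \<ge> 1" using I by (simp add: Suc_le_eq card_gt_0_iff)
  with assms[OF k'(1) this \<open>card I \<ge> 1\<close>] Q ee
  have w: "wt k' (card (I \<inter> {m..<n})) \<le> f * w" using I by simp
  from level_restrict[of E I w k' P m n x] k'(2) ee ne obtain E' where
    "(E', I \<inter> {m..<n}, wt k' (card (I \<inter> {m..<n}))) \<in> level k' P" "depends {m..<n} E'"
    "\<forall>z\<in>E. agree {..<m} z x \<longrightarrow> z \<in> E'" by blast
  with w k'(3) ee show "\<exists>e'\<in>tower d k. wset_wt e' \<le> f * wset_wt e \<and>
    wset_idx e' = wset_idx e \<inter> {m..<n} \<and>
        depends {m..<n} (wset_set e') \<and> (\<forall>z\<in>wset_set e. agree {..<m} z x \<longrightarrow> z \<in> wset_set e')"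
    by (intro bexI[of _ "(E', I \<inter> {m..<n}, wt k' (card (I \<inter> {m..<n})))"]) auto
qed

lemma restrictable_tower_wt_factor: "restrictable (tower d (Suc k)) (2 ^ (k + 7)) (wt_factor k)"
proof (rule restrictable_clI)
  fix k' i i' :: nat
  assume "Suc k \<le> k'" "1 \<le> i'" "1 \<le> i" "i \<le> 2 ^ (k + 7) * i'"
  then show "wt k' i' \<le> wt_factor k * wt k' i"
    using wt_restrict_wt_factor Suc_le_lessD by blast
qed

lemma restrictable_tower_half: "restrictable (tower d k) 2 2"
proof (rule restrictable_clI)
  fix k' i i' :: nat
  assume "1 \<le> i'" "1 \<le> i" "i \<le> 2 * i'"
  then show "wt k' i' \<le> 2 * wt k' i"
    by (rule wt_restrict_half)
qed

lemma restrict_family: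
  assumes "restrictable \<C> Q f" "finite G" "G \<subseteq> \<C>" "\<And>e. e \<in> \<C> \<Longrightarrow> wset_wt e \<ge> 0"
    and "\<And>e. e \<in> G \<Longrightarrow> card (wset_idx e) \<le> Q * card (wset_idx e \<inter> {m..<n})"
  obtains G' where "finite G'" "G' \<subseteq> \<C>" "sum wset_wt G' \<le> f * sum wset_wt G"
    "\<And>e. e \<in> G' \<Longrightarrow> depends {m..<n} (wset_set e)"
    "\<And>z e. e \<in> G \<Longrightarrow> z \<in> wset_set e \<Longrightarrow> agree {..<m} z x \<Longrightarrow> z \<in> (\<Union>e\<in>G'. wset_set e)"
proof -
  have "\<forall>e\<in>G. \<exists>e'. e' \<in> \<C> \<and> wset_wt e' \<le> f * wset_wt e \<and> wset_idx e' = wset_idx e \<inter> {m..<n} \<and>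
        depends {m..<n} (wset_set e') \<and> (\<forall>z\<in>wset_set e. agree {..<m} z x \<longrightarrow> z \<in> wset_set e')"
  proof
    fix e assume e: "e \<in> G"
    with assms(3) have "e \<in> \<C>" by blast
    from assms(1)[unfolded restrictable_def, rule_format, OF this assms(5)[OF e], of x]
    show "\<exists>e'. e' \<in> \<C> \<and> wset_wt e' \<le> f * wset_wt e \<and> wset_idx e' = wset_idx e \<inter> {m..<n} \<and>
        depends {m..<n} (wset_set e') \<and> (\<forall>z\<in>wset_set e. agree {..<m} z x \<longrightarrow> z \<in> wset_set e')"
      by (auto simp only: Bex_def)
  qed
  then obtain g where g: "\<And>e. e \<in> G \<Longrightarrow> g e \<in> \<C> \<and> wset_wt (g e) \<le> f * wset_wt e \<and>
        depends {m..<n} (wset_set (g e)) \<and> (\<forall>z\<in>wset_set e. agree {..<m} z x \<longrightarrow> z \<in> wset_set (g e))"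
    by metis
  \<comment> \<open>Distinct sets may have the same restriction; as weights are nonnegative, this
    only lowers the sum.\<close>
  have "sum wset_wt (g ` G) \<le> (\<Sum>e\<in>G. wset_wt (g e))"
    using sum_image_le[of G wset_wt g] assms(2,4) g by (auto simp: o_def)
  also have "\<dots> \<le> (\<Sum>e\<in>G. f * wset_wt e)"
    using g by (intro sum_mono) auto
  finally have "sum wset_wt (g ` G) \<le> f * sum wset_wt G"
    by (simp add: sum_distrib_left)
  moreover have "z \<in> (\<Union>e\<in>g ` G. wset_set e)" if "e \<in> G" "z \<in> wset_set e" "agree {..<m} z x" for z e
    using g[OF that(1)] that by blast
  moreover have "depends {m..<n} (wset_set e)" if "e \<in> g ` G" for e
    using g that by blast
  moreover have "finite (g ` G)" "g ` G \<subseteq> \<C>"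
    using g assms(2) by blast+
  ultimately show ?thesis
    using that[of "g ` G"] by blast
qed

section \<open>Small weight does not cover the space\<close>

lemma sum_between_ge:
  fixes g :: "nat \<Rightarrow> real"
  assumes "finite S" "S \<noteq> {}"
    and "\<And>a b. a \<in> S \<Longrightarrow> b \<in> S \<Longrightarrow> a < b \<Longrightarrow> \<epsilon> \<le> sum g {a..<b}"
  shows "(real (card S) - 1) * \<epsilon> \<le> sum g {Min S..<Max S}"
  using assms
proof (induction S rule: finite_linorder_max_induct)
  case (insert b A)
  show ?case
  proof (cases "A = {}")
    case False
    have lt: "Max A < b" using insert.hyps False by simp
    have "Min A \<le> Max A" using insert.hyps False by simp
    have "b \<notin> A" using insert.hyps by blast
    have "(real (card A) - 1) * \<epsilon> \<le> sum g {Min A..<Max A}"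
      using False insert.prems by (intro insert.IH) auto
    moreover have "\<epsilon> \<le> sum g {Max A..<b}"
      using insert.prems(2)[of "Max A" b] insert.hyps(1) False lt by simp
    moreover have "sum g {Min A..<Max A} + sum g {Max A..<b} = sum g {Min A..<b}"
      using \<open>Min A \<le> Max A\<close> lt by (intro sum.atLeastLessThan_concat) auto
    moreover have "Min (insert b A) = Min A" "Max (insert b A) = b"
      using False insert.hyps(1) lt \<open>Min A \<le> Max A\<close> by (simp_all add: min_absorb2 max_absorb1)
    ultimately show ?thesis
      using \<open>b \<notin> A\<close> insert.hyps(1) by (simp add: algebra_simps)
  qed simp
qed simp

text \<open>Consecutive points of \<open>S\<close> bound disjoint intervals, so one of them is light.\<close>

lemma exists_light_gap:
  fixes g :: "nat \<Rightarrow> real"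
  assumes "finite S" "S \<noteq> {}" "\<And>A. finite A \<Longrightarrow> sum g A \<le> t" "t < (real (card S) - 1) * \<epsilon>"
  obtains a b where "a \<in> S" "b \<in> S" "a < b" "sum g {a..<b} < \<epsilon>"
  using sum_between_ge[OF assms(1,2), of \<epsilon> g] assms(3)[of "{Min S..<Max S}"] assms(4)
  by (meson finite_atLeastLessThan linorder_not_le order_less_le_trans order_trans)

text \<open>In the cylinder of \<open>x\<close> the sets in \<open>G\<close> lie in restricted sets
  too light to cover \<open>K\<close>. A point of \<open>K\<close> outside these may take over the
  coordinates of \<open>x\<close> below \<open>m\<close>, since neither \<open>K\<close> nor the
  restricted sets see them. The coordinates from \<open>n\<close> on remain free, so that the point
  can be extended further.\<close>

lemma extend_point:
  assumes "restrictable \<C> Q f" "\<And>e. e \<in> \<C> \<Longrightarrow> wset_wt e \<ge> 0" "finite G" "G \<subseteq> \<C>" "m \<le> n"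
    and "\<And>e. e \<in> G \<Longrightarrow> card (wset_idx e) \<le> Q * card (wset_idx e \<inter> {m..<n})"
    and "depends {m..} K" "\<not> covered \<C> r K" "f * sum wset_wt G < r"
  shows "\<exists>y\<in>K. (\<forall>i<m. y i = x i) \<and> (\<forall>e\<in>G. \<forall>z. agree {..<n} y z \<longrightarrow> z \<notin> wset_set e)"
proof -
  obtain G' where G': "finite G'" "G' \<subseteq> \<C>" "sum wset_wt G' \<le> f * sum wset_wt G"
    "\<And>e. e \<in> G' \<Longrightarrow> depends {m..<n} (wset_set e)"
    "\<And>z e. e \<in> G \<Longrightarrow> z \<in> wset_set e \<Longrightarrow> agree {..<m} z x \<Longrightarrow> z \<in> (\<Union>e\<in>G'. wset_set e)"
    using restrict_family[OF assms(1,3,4,2,6), where x = x] by blast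
  have "\<not> K \<subseteq> (\<Union>e\<in>G'. wset_set e)"
    using assms(8,9) G'(1-3) unfolding covered_def by force
  then obtain z0 where z0: "z0 \<in> K" "z0 \<notin> (\<Union>e\<in>G'. wset_set e)" by blast
  let ?y = "splice m x z0"
  have right: "agree {m..} ?y z0" by (rule agree_splice_right)
  have "?y \<in> K" using dependsD[OF assms(7) right] z0 by simp
  moreover have "z \<notin> wset_set e" if "e \<in> G" "agree {..<n} ?y z" for e z
  proof
    assume "z \<in> wset_set e"
    have "agree {..<m} ?y z" using that(2) by (rule agree_mono) (use assms(5) in auto)
    then have "agree {..<m} z x" using agree_splice_left agree_trans agree_sym by blast
    with G'(5) \<open>z \<in> wset_set e\<close> that obtain e' where e': "e' \<in> G'" "z \<in> wset_set e'" by blast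
    have "agree {m..<n} ?y z" using that(2) by (rule agree_mono) auto
    moreover have "agree {m..<n} ?y z0" using right by (rule agree_mono) auto
    ultimately have "agree {m..<n} z z0" using agree_trans agree_sym by blast
    then have "z0 \<in> wset_set e'" using dependsD[OF G'(4)[OF e'(1)]] e'(2) by blast
    with z0(2) e'(1) show False by blast
  qed
  ultimately show ?thesis
    by (intro bexI[of _ ?y]) (simp_all add: splice_less)
qed

lemma restricted_weight_le:
  fixes F :: "wset set"
  assumes "finite F" "\<And>e. e \<in> F \<Longrightarrow> finite (wset_idx e) \<and> wset_idx e \<noteq> {} \<and> wset_wt e \<ge> 0"
  shows "sum wset_wt {e \<in> F. card (wset_idx e) \<le> Q * card (wset_idx e \<inter> A)}
      \<le> (\<Sum>e\<in>F. wset_wt e * Q * card (wset_idx e \<inter> A) / card (wset_idx e))"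
proof -
  let ?h = "\<lambda>e. wset_wt e * Q * card (wset_idx e \<inter> A) / card (wset_idx e)"
  let ?G = "{e \<in> F. card (wset_idx e) \<le> Q * card (wset_idx e \<inter> A)}"
  have "sum wset_wt ?G \<le> sum ?h ?G"
  proof (rule sum_mono)
    fix e assume e: "e \<in> ?G"
    with assms(2) have "card (wset_idx e) > 0" by (simp add: card_gt_0_iff)
    moreover have "real (card (wset_idx e)) \<le> real (Q * card (wset_idx e \<inter> A))"
      using e by (simp only: of_nat_le_iff mem_Collect_eq)
    then have "wset_wt e * real (card (wset_idx e)) \<le> wset_wt e * real (Q * card (wset_idx e \<inter> A))"
      using e assms(2) by (intro mult_left_mono) auto
    ultimately show "wset_wt e \<le> ?h e" by (simp add: field_simps)
  qed
  also have "\<dots> \<le> sum ?h F"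
    using assms by (intro sum_mono2) auto
  finally show ?thesis .
qed

text \<open>Spread \<open>Q\<close> times the weight of each set evenly over its indices. Some
  interval between points of \<open>S\<close> then carries less than \<open>\<epsilon>\<close>, and
  by Markov's inequality this bounds the weight of the sets with a fraction \<open>1 / Q\<close> of
  their indices there.\<close>

lemma exists_light_interval:
  fixes F :: "wset set" and T Q :: nat
  assumes "finite F" "\<And>e. e \<in> F \<Longrightarrow> finite (wset_idx e) \<and> wset_idx e \<noteq> {} \<and> wset_wt e \<ge> 0"
    and "finite S" "S \<noteq> {}" "Q * sum wset_wt F < (real (card S) - 1) * \<epsilon>"
  obtains a b where "a \<in> S" "b \<in> S" "a < b"
    "sum wset_wt {e \<in> F. card (wset_idx e) \<le> Q * card (wset_idx e \<inter> {a..<b})} < \<epsilon>"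
proof -
  define g where "g i = (\<Sum>e\<in>F. wset_wt e * Q * of_bool (i \<in> wset_idx e) / card (wset_idx e))" for i
  have sum_g: "sum g A = (\<Sum>e\<in>F. wset_wt e * Q * card (wset_idx e \<inter> A) / card (wset_idx e))"
    if "finite A" for A
  proof -
    have "sum g A = (\<Sum>e\<in>F. \<Sum>i\<in>A. wset_wt e * Q * of_bool (i \<in> wset_idx e) / card (wset_idx e))"
      unfolding g_def by (rule sum.swap)
    also have "\<dots> = (\<Sum>e\<in>F. wset_wt e * Q * (\<Sum>i\<in>A. of_bool (i \<in> wset_idx e)) / card (wset_idx e))"
      by (simp add: sum_divide_distrib sum_distrib_left)
    also have "(\<lambda>e. \<Sum>i\<in>A. of_bool (i \<in> wset_idx e)) = (\<lambda>e. real (card (wset_idx e \<inter> A)))"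
      using that by (simp add: sum_of_bool_eq Int_commute Int_def conj_commute)
    finally show ?thesis by (simp add: fun_eq_iff)
  qed
  have "sum g A \<le> Q * sum wset_wt F" if "finite A" for A
    unfolding sum_g[OF that] sum_distrib_left
  proof (rule sum_mono)
    fix e assume e: "e \<in> F"
    then have "card (wset_idx e \<inter> A) \<le> card (wset_idx e)" "card (wset_idx e) > 0"
      using assms(2)[OF e] by (auto intro!: card_mono simp: card_gt_0_iff)
    then have "wset_wt e * Q * (real (card (wset_idx e \<inter> A)) / card (wset_idx e))
      \<le> wset_wt e * Q * 1"
      using assms(2)[OF e] by (intro mult_left_mono) auto
    then show "wset_wt e * Q * card (wset_idx e \<inter> A) / card (wset_idx e) \<le> Q * wset_wt e"
      by (simp add: mult.commute)
  qed
  then obtain a b where ab: "a \<in> S" "b \<in> S" "a < b" "sum g {a..<b} < \<epsilon>"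
    using exists_light_gap[OF assms(3,4) _ assms(5)] by blast
  then show ?thesis
    using restricted_weight_le[OF assms(1,2), of Q "{a..<b}"] sum_g[of "{a..<b}"]
    by (intro that[of a b]) auto
qed

text \<open>Thin case: between suitable marked coordinates of \<open>e0\<close> the sets of
  \<open>F\<close> concentrated there are light, whereas the witness is not covered with weight
  \<open>1\<close> and so has a point outside them. Discrete case: one coordinate suffices to leave
  \<open>e0\<close>, and no set of \<open>F\<close> has a sizeable fraction of its indices
  there.\<close>

lemma local_extension:
  assumes F: "finite F" "F \<subseteq> tower d (Suc k)" "sum wset_wt F < bound k"
    and e0: "e0 \<in> level k (\<lambda>C. \<not> covered (tower d (Suc k)) 1 C)"
    and card: "2 ^ (k + 15) \<le> card (wset_idx e0 \<inter> {m..<M})"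
  obtains a b where "m \<le> a" "a < b" "b \<le> M"
    "\<And>x. \<exists>y. (\<forall>i<a. y i = x i) \<and> (\<forall>z. agree {..<b} y z \<longrightarrow> z \<notin> wset_set e0 \<and>
        (\<forall>e\<in>F. card (wset_idx e) \<le> 2 ^ (k + 7) * card (wset_idx e \<inter> {a..<b}) \<longrightarrow> z \<notin> wset_set e))"
proof -
  let ?\<C> = "tower d (Suc k)" and ?S = "wset_idx e0 \<inter> {m..<M}"
  let ?G = "\<lambda>a b. {e \<in> F. card (wset_idx e) \<le> 2 ^ (k + 7) * card (wset_idx e \<inter> {a..<b})}"
  have idx: "finite (wset_idx e) \<and> wset_idx e \<noteq> {} \<and> wset_wt e \<ge> 0" if "e \<in> F" for e
    using that F(2) tower_idx by blast
  have S: "finite ?S" "?S \<noteq> {}" using card by (auto intro: ccontr)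
  from e0 have "thin (\<lambda>C. \<not> covered ?\<C> 1 C) (wset_idx e0) (wset_set e0) \<or>
    dthin (wset_idx e0) (wset_set e0)"
    by (auto simp: level_def)
  then show ?thesis
  proof
    assume thin: "thin (\<lambda>C. \<not> covered ?\<C> 1 C) (wset_idx e0) (wset_set e0)"
    \<comment> \<open>\<open>2 ^ (k + 7) * 32\<close> is \<open>2 ^ (k + 12)\<close>, less than a
      quarter of the number of gaps between \<open>2 ^ (k + 15)\<close> indices. The threshold
      \<open>1 / 4\<close> stays below \<open>1\<close> after multiplication by
      \<open>wt_factor k\<close>, which is at most \<open>2\<close>.\<close>
    have "real (2 ^ (k + 7)) * sum wset_wt F < 2 ^ (k + 7) * 32"
      using F(3) bound_less[of k] by simp
    also have "\<dots> = 2 ^ k * 4096" by (simp add: power_add)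
    also have "\<dots> < (2 ^ (k + 15) - 1) * (1 / 4)"
    proof -
      have "(1 :: real) \<le> 2 ^ k" by simp
      then have "(1 :: real) < 16384 * 2 ^ k" by linarith
      then show ?thesis by (simp add: power_add)
    qed
    also have "\<dots> \<le> (real (card ?S) - 1) * (1 / 4)"
    proof -
      have "real (2 ^ (k + 15)) \<le> real (card ?S)" using card by (simp only: of_nat_le_iff)
      then show ?thesis by simp
    qed
    finally obtain a b where ab: "a \<in> ?S" "b \<in> ?S" "a < b" "sum wset_wt (?G a b) < 1 / 4"
      using exists_light_interval[OF F(1) idx S, of "2 ^ (k + 7)" "1 / 4"] by auto
    have "wt_factor k * sum wset_wt (?G a b) \<le> 2 * sum wset_wt (?G a b)"
      using wt_factor_le_2 idx by (intro mult_right_mono sum_nonneg) auto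
    with ab(4) have lt: "wt_factor k * sum wset_wt (?G a b) < 1" by simp
    show ?thesis
    proof (rule that)
      show "m \<le> a" "a < b" "b \<le> M" using ab by auto
      fix x
      have "a \<in> wset_idx e0" "b \<in> wset_idx e0" using ab by auto
      from thin[unfolded thin_def, rule_format, OF this ab(3), of x]
      obtain K where K: "depends {a..<b} K" "\<not> covered ?\<C> 1 K"
          "\<And>z. z \<in> K \<Longrightarrow> agree {..<a} z x \<Longrightarrow> z \<notin> wset_set e0"
        by (elim exE conjE) blast
      have "depends {a..} K" using K(1) by (rule depends_mono) auto
      have nonneg: "wset_wt e \<ge> 0" if "e \<in> ?\<C>" for e using that tower_idx by blast
      have G: "finite (?G a b)" "?G a b \<subseteq> ?\<C>" using F by auto
      have sig: "card (wset_idx e) \<le> 2 ^ (k + 7) * card (wset_idx e \<inter> {a..<b})" if "e \<in> ?G a b"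
        for e
        using that by simp
      obtain y where y: "y \<in> K" "\<And>i. i < a \<Longrightarrow> y i = x i"
          "\<And>e z. e \<in> ?G a b \<Longrightarrow> agree {..<b} y z \<Longrightarrow> z \<notin> wset_set e"
        using extend_point[OF restrictable_tower_wt_factor nonneg G less_imp_le[OF ab(3)] sig
          \<open>depends {a..} K\<close> K(2) lt, of x]
        by blast
      have "z \<notin> wset_set e0" if "agree {..<b} y z" for z
      proof -
        have "agree {a..<b} y z" using that by (rule agree_mono) auto
        then have "z \<in> K" using dependsD[OF K(1)] y(1) by blast
        moreover have "agree {..<a} y z" using that by (rule agree_mono) (use ab(3) in auto)
        then have "agree {..<a} z x" using y(2) by (simp add: agree_def)
        ultimately show ?thesis by (rule K(3))
      qed
      with y show "\<exists>y. (\<forall>i<a. y i = x i) \<and> (\<forall>z. agree {..<b} y z \<longrightarrow> z \<notin> wset_set e0 \<and>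
        (\<forall>e\<in>F. card (wset_idx e) \<le> 2 ^ (k + 7) * card (wset_idx e \<inter> {a..<b}) \<longrightarrow> z \<notin> wset_set e))"
        by (intro exI[of _ y]) blast
    qed
  next
    assume dthin: "dthin (wset_idx e0) (wset_set e0)"
    obtain a where a: "a \<in> ?S" using S by blast
    with dthin obtain K where K: "depends {a} K" "K \<noteq> {}" "K \<inter> wset_set e0 = {}"
      unfolding dthin_def by blast
    then obtain z0 where z0: "z0 \<in> K" by blast
    show ?thesis
    proof (rule that)
      show "m \<le> a" "a < Suc a" "Suc a \<le> M" using a by auto
      have insig: "\<not> card (wset_idx e) \<le> 2 ^ (k + 7) * card (wset_idx e \<inter> {a..<Suc a})" if "e \<in> F"
        for e
      proof -
        have "wset_wt e \<le> sum wset_wt F" using that F(1) idx by (intro member_le_sum) auto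
        then have "wset_wt e < 32" using F(3) bound_less[of k] by simp
        then have "2 ^ (2 * Suc k + 20) \<le> card (wset_idx e)"
          using that F(2) by (intro tower_large_index) auto
        moreover have "2 ^ (k + 7) < (2 ^ (2 * Suc k + 20) :: nat)"
          by (intro power_strict_increasing) auto
        moreover have "card (wset_idx e \<inter> {a..<Suc a}) \<le> 1"
          using card_mono[of "{a..<Suc a}" "wset_idx e \<inter> {a..<Suc a}"] by simp
        then have "2 ^ (k + 7) * card (wset_idx e \<inter> {a..<Suc a}) \<le> 2 ^ (k + 7) * 1"
          by (rule mult_left_mono) simp
        ultimately show ?thesis by linarith
      qed
      fix x
      have "z \<notin> wset_set e0" if "agree {..<Suc a} (splice a x z0) z" for z
      proof -
        have "agree {a} (splice a x z0) z" using that by (rule agree_mono) auto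
        then have "agree {a} z0 z" by (simp add: agree_def splice_def)
        then have "z \<in> K" using dependsD[OF K(1)] z0 by blast
        with K(3) show ?thesis by blast
      qed
      with insig show "\<exists>y. (\<forall>i<a. y i = x i) \<and> (\<forall>z. agree {..<Suc a} y z \<longrightarrow> z \<notin> wset_set e0 \<and>
        (\<forall>e\<in>F. card (wset_idx e) \<le> 2 ^ (k + 7) * card (wset_idx e \<inter> {a..<Suc a}) \<longrightarrow> z \<notin> wset_set e))"
        by (intro exI[of _ "splice a x z0"]) (auto simp: splice_less)
    qed
  qed
qed

lemma finite_idx_bound:
  assumes "finite F" "\<And>e. e \<in> F \<Longrightarrow> finite (wset_idx e)"
  obtains n :: nat where "m \<le> n" "\<And>e. e \<in> F \<Longrightarrow> wset_idx e \<inter> {a..} = wset_idx e \<inter> {a..<n}"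
proof -
  have "finite (\<Union>e\<in>F. wset_idx e)" using assms by blast
  then obtain n0 where n0: "(\<Union>e\<in>F. wset_idx e) \<subseteq> {..<n0}"
    using finite_nat_iff_bounded by blast
  show ?thesis
  proof (rule that[of "max m n0"])
    fix e assume "e \<in> F"
    with n0 have "wset_idx e \<subseteq> {..<n0}" by blast
    then show "wset_idx e \<inter> {a..} = wset_idx e \<inter> {a..<max m n0}" by auto
  qed simp
qed

text \<open>The sets in \<open>R\<close> are avoided one after the other, from left to right, each within an interval
  chosen between two of its own indices. The sets in \<open>F\<close> are avoided in every interval, chosen or
  lying between chosen ones, that contains a fraction \<open>2\<^sup>-\<^sup>(\<^sup>k\<^sup>+\<^sup>7\<^sup>)\<close> of their indices. There are
  \<open>3 * card R + 1\<close> intervals, so every set in \<open>F\<close> has such a fraction in one of them.\<close>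

lemma avoid_all:
  assumes unc: "\<not> covered (tower d (Suc k)) (bound (Suc k)) UNIV"
    and F: "finite F" "F \<subseteq> tower d (Suc k)" "sum wset_wt F < bound k"
    and "finite R" "R \<subseteq> level k (\<lambda>C. \<not> covered (tower d (Suc k)) 1 C)"
    and "\<And>e. e \<in> R \<Longrightarrow> card R * 2 ^ (k + 15) \<le> card (wset_idx e \<inter> {m..})"
  shows "\<exists>y. (\<forall>i<m. y i = x i) \<and> (\<forall>e\<in>R. y \<notin> wset_set e) \<and>
    (\<forall>e\<in>F. (3 * card R + 1) * card (wset_idx e) \<le> 2 ^ (k + 7) * card (wset_idx e \<inter> {m..}) \<longrightarrow> y \<notin>
      wset_set e)"
  using assms(5-7)
proof (induction "card R" arbitrary: R m x)
  \<comment> \<open>Between chosen intervals there is no witness to hit: it suffices that the sets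
    of \<open>F\<close>, restricted at the cost of \<open>wt_factor k\<close>, do not cover the
    space.\<close>
  have gap: "\<exists>y. (\<forall>i<m. y i = x i) \<and>
    (\<forall>e\<in>F. card (wset_idx e) \<le> 2 ^ (k + 7) * card (wset_idx e \<inter> {m..<n}) \<longrightarrow>
      (\<forall>z. agree {..<n} y z \<longrightarrow> z \<notin> wset_set e))" if "m \<le> n" for m n x
  proof -
    let ?G = "{e \<in> F. card (wset_idx e) \<le> 2 ^ (k + 7) * card (wset_idx e \<inter> {m..<n})}"
    have "sum wset_wt ?G \<le> sum wset_wt F"
      using F tower_idx by (intro sum_mono2) auto
    then have "wt_factor k * sum wset_wt ?G < wt_factor k * bound k"
      using F(3) wt_factor_ge_1[of k] by (intro mult_strict_left_mono) auto
    then have lt: "wt_factor k * sum wset_wt ?G < bound (Suc k)" by (simp add: bound_Suc)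
    have nonneg: "wset_wt e \<ge> 0" if "e \<in> tower d (Suc k)" for e using that tower_idx by blast
    have G: "finite ?G" "?G \<subseteq> tower d (Suc k)" using F by auto
    have sig: "card (wset_idx e) \<le> 2 ^ (k + 7) * card (wset_idx e \<inter> {m..<n})" if "e \<in> ?G" for e
      using that by simp
    show ?thesis
      using extend_point[OF restrictable_tower_wt_factor nonneg G \<open>m \<le> n\<close> sig depends_UNIV unc lt,
        of x]
      by (simp only: bex_UNIV ball_simps mem_Collect_eq) blast
  qed
  {
    case 0
    then have "R = {}" by simp
    have "finite (wset_idx e)" if "e \<in> F" for e using that F(2) tower_idx by blast
    then obtain n where n: "m \<le> n" "\<And>e. e \<in> F \<Longrightarrow> wset_idx e \<inter> {m..} = wset_idx e \<inter> {m..<n}"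
      using finite_idx_bound[OF F(1)] by metis
    from gap[OF n(1), of x] obtain y where "\<forall>i<m. y i = x i"
      "\<forall>e\<in>F. card (wset_idx e) \<le> 2 ^ (k + 7) * card (wset_idx e \<inter> {m..<n}) \<longrightarrow>
      (\<forall>z. agree {..<n} y z \<longrightarrow> z \<notin> wset_set e)" by blast
    with n(2) \<open>R = {}\<close> show ?case by (intro exI[of _ y]) auto
  next
    case (Suc r)
    let ?T = "2 ^ (k + 15) :: nat"
    have idxR: "finite (wset_idx e)" if "e \<in> R" for e using that Suc.prems by (auto simp: level_def)
    have "R \<noteq> {}" using Suc.hyps by auto
    obtain n where n: "m \<le> n" "\<And>e. e \<in> R \<Longrightarrow> wset_idx e \<inter> {m..} = wset_idx e \<inter> {m..<n}"
      using finite_idx_bound[OF Suc.prems(1) idxR] by metis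
    \<comment> \<open>The set that first accumulates \<open>2 ^ (k + 15)\<close> indices is treated
      first. As \<open>M\<close> is least, every other set has used up at most that many indices
      before \<open>M\<close> and keeps enough for the remaining steps.\<close>
    define M where "M = (LEAST M. \<exists>e\<in>R. ?T \<le> card (wset_idx e \<inter> {m..<M}))"
    have "\<exists>e\<in>R. ?T \<le> card (wset_idx e \<inter> {m..<n})"
    proof -
      obtain e where e: "e \<in> R" using \<open>R \<noteq> {}\<close> by blast
      have "?T \<le> card R * ?T" using \<open>R \<noteq> {}\<close> Suc.prems(1) by (simp add: card_gt_0_iff Suc_le_eq)
      also have "\<dots> \<le> card (wset_idx e \<inter> {m..<n})" using Suc.prems(3)[OF e] n(2)[OF e] by simp
      finally show ?thesis using e by blast
    qed
    then have "\<exists>e\<in>R. ?T \<le> card (wset_idx e \<inter> {m..<M})"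
      unfolding M_def by (rule LeastI)
    then obtain e0 where e0: "e0 \<in> R" "?T \<le> card (wset_idx e0 \<inter> {m..<M})" by blast
    have le_T: "card (wset_idx e \<inter> {m..<M}) \<le> ?T" if "e \<in> R" for e
    proof -
      have "M \<noteq> 0" using e0(2) by (intro notI) simp
      then have "M - 1 < M" by simp
      then have "\<not> ?T \<le> card (wset_idx e \<inter> {m..<M - 1})"
        using not_less_Least[of "M - 1" "\<lambda>M. \<exists>e\<in>R. ?T \<le> card (wset_idx e \<inter> {m..<M})"] that
        unfolding M_def by blast
      moreover have "wset_idx e \<inter> {m..<M} \<subseteq> insert (M - 1) (wset_idx e \<inter> {m..<M - 1})"
        by auto
      then have "card (wset_idx e \<inter> {m..<M}) \<le> card (insert (M - 1) (wset_idx e \<inter> {m..<M - 1}))"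
        by (intro card_mono) auto
      then have "card (wset_idx e \<inter> {m..<M}) \<le> Suc (card (wset_idx e \<inter> {m..<M - 1}))"
        by (rule order_trans) (rule card_insert_le_m1, auto)
      ultimately show ?thesis by linarith
    qed
    have split: "card (wset_idx e \<inter> {u..}) = card (wset_idx e \<inter> {u..<v}) + card (wset_idx e \<inter>
      {v..})"
      if "u \<le> v" "finite (wset_idx e)" for e u v
    proof -
      have "wset_idx e \<inter> {u..} = (wset_idx e \<inter> {u..<v}) \<union> (wset_idx e \<inter> {v..})"
        using that(1) by auto
      then show ?thesis using that(2) by (simp only:) (rule card_Un_disjoint, auto)
    qed
    obtain a b where ab: "m \<le> a" "a < b" "b \<le> M"
      and ext: "\<And>x. \<exists>y. (\<forall>i<a. y i = x i) \<and> (\<forall>z. agree {..<b} y z \<longrightarrow> z \<notin> wset_set e0 \<and>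
        (\<forall>e\<in>F. card (wset_idx e) \<le> 2 ^ (k + 7) * card (wset_idx e \<inter> {a..<b}) \<longrightarrow> z \<notin> wset_set e))"
      using local_extension[OF F _ e0(2)] e0(1) Suc.prems(2) by blast
    obtain y1 where y1: "\<forall>i<m. y1 i = x i"
      "\<And>e z. e \<in> F \<Longrightarrow> card (wset_idx e) \<le> 2 ^ (k + 7) * card (wset_idx e \<inter> {m..<a}) \<Longrightarrow>
        agree {..<a} y1 z \<Longrightarrow> z \<notin> wset_set e"
      using gap[OF ab(1), of x] by blast
    obtain y2 where y2: "\<forall>i<a. y2 i = y1 i" "\<And>z. agree {..<b} y2 z \<Longrightarrow> z \<notin> wset_set e0"
      "\<And>e z. e \<in> F \<Longrightarrow> card (wset_idx e) \<le> 2 ^ (k + 7) * card (wset_idx e \<inter> {a..<b}) \<Longrightarrow>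
        agree {..<b} y2 z \<Longrightarrow> z \<notin> wset_set e"
      using ext[of y1] by blast
    obtain y3 where y3: "\<forall>i<b. y3 i = y2 i"
      "\<And>e z. e \<in> F \<Longrightarrow> card (wset_idx e) \<le> 2 ^ (k + 7) * card (wset_idx e \<inter> {b..<M}) \<Longrightarrow>
        agree {..<M} y3 z \<Longrightarrow> z \<notin> wset_set e"
      using gap[OF ab(3), of y2] by blast
    have card_R': "card (R - {e0}) = r" using Suc.hyps(2) e0(1) Suc.prems(1) by simp
    have "r * ?T \<le> card (wset_idx e \<inter> {M..})" if "e \<in> R" for e
    proof -
      have "Suc r * ?T \<le> card (wset_idx e \<inter> {m..})" using Suc.prems(3)[OF that] Suc.hyps(2) by simp
      also have "\<dots> = card (wset_idx e \<inter> {m..<M}) + card (wset_idx e \<inter> {M..})"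
        using ab that by (intro split idxR) auto
      finally show ?thesis using le_T[OF that] by simp
    qed
    then obtain y where y: "\<forall>i<M. y i = y3 i" "\<forall>e\<in>R - {e0}. y \<notin> wset_set e"
      "\<And>e. e \<in> F \<Longrightarrow> (3 * r + 1) * card (wset_idx e) \<le> 2 ^ (k + 7) * card (wset_idx e \<inter> {M..}) \<Longrightarrow>
         y \<notin> wset_set e"
      using Suc.hyps(1)[OF card_R'[symmetric], of M y3, unfolded card_R'] Suc.prems(1,2) by blast
    have agree: "agree {..<a} y1 y" "agree {..<b} y2 y" "agree {..<M} y3 y"
      using y(1) y1(1) y2(1) y3(1) ab by (auto simp: agree_def)
    show ?case
    proof (intro exI[of _ y] conjI ballI impI allI)
      fix i assume "i < m" then show "y i = x i" using y(1) y1(1) y2(1) y3(1) ab by simp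
    next
      fix e assume "e \<in> R" then show "y \<notin> wset_set e"
        using y(2) y2(2)[OF agree(2)] by (cases "e = e0") auto
    next
      fix e assume e: "e \<in> F"
        and big: "(3 * card R + 1) * card (wset_idx e) \<le> 2 ^ (k + 7) * card (wset_idx e \<inter> {m..})"
      let ?c = "card (wset_idx e)" and ?q = "2 ^ (k + 7) :: nat"
      have fin: "finite (wset_idx e)" using e F(2) tower_idx by blast
      have "card (wset_idx e \<inter> {m..}) = card (wset_idx e \<inter> {m..<a}) + (card (wset_idx e \<inter> {a..<b}) +
          (card (wset_idx e \<inter> {b..<M}) + card (wset_idx e \<inter> {M..})))"
        using ab fin by (simp add: split[of m a] split[of a b] split[of b M])
      then have "(4 + 3 * r) * ?c \<le> ?q * card (wset_idx e \<inter> {m..<a}) + (?q * card (wset_idx e \<inter>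
        {a..<b}) +
          (?q * card (wset_idx e \<inter> {b..<M}) + ?q * card (wset_idx e \<inter> {M..})))"
        using big Suc.hyps(2)[symmetric] by (simp add: distrib_left)
      \<comment> \<open>Of the \<open>3 * card R + 1\<close> shares, three go to the intervals used
        up here and \<open>3 * r + 1\<close> to the part beyond \<open>M\<close>, left to the
        induction hypothesis.\<close>
      moreover have "(4 + 3 * r) * ?c = ?c + (?c + (?c + (3 * r + 1) * ?c))"
        by (simp add: algebra_simps)
      ultimately have "?c \<le> ?q * card (wset_idx e \<inter> {m..<a}) \<or>
        ?c \<le> ?q * card (wset_idx e \<inter> {a..<b}) \<or>
          ?c \<le> ?q * card (wset_idx e \<inter> {b..<M}) \<or> (3 * r + 1) * ?c \<le> ?q * card (wset_idx e \<inter> {M..})"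
        by linarith
      then show "y \<notin> wset_set e"
        using y1(2)[OF e _ agree(1)] y2(3)[OF e _ agree(2)] y3(2)[OF e _ agree(3)] y(3)[OF e]
          by blast
    qed
  }
qed

text \<open>Split a cover into sets of level \<open>k\<close> and of higher levels. There are fewer
  than \<open>2 ^ (k + 5)\<close> of the former, each with at least
  \<open>2 ^ (2 * k + 20) = 2 ^ (k + 5) * 2 ^ (k + 15)\<close> indices, so \<open>avoid_all\<close>
  avoids them all. As three times their number plus one is at most \<open>2 ^ (k + 7)\<close>, the
  point found also lies outside every set of the higher levels.\<close>

theorem tower_not_covered: "\<not> covered (tower d k) (bound k) UNIV"
proof (induction d arbitrary: k)
  case 0
  show ?case by (auto simp: covered_def)
next
  case (Suc d)
  let ?P = "\<lambda>C. \<not> covered (tower d (Suc k)) 1 C"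
  show ?case
  proof
    assume "covered (tower (Suc d) k) (bound k) UNIV"
    then obtain F where F: "finite F" "F \<subseteq> tower (Suc d) k" "sum wset_wt F < bound k"
      "UNIV \<subseteq> (\<Union>e\<in>F. wset_set e)" unfolding covered_def by blast
    have nonneg: "wset_wt e \<ge> 0" if "e \<in> F" for e using that F(2) tower_idx by blast
    define R where "R = F \<inter> level k ?P"
    define F2 where "F2 = F \<inter> tower d (Suc k)"
    have "F = R \<union> F2" using F(2) by (auto simp: R_def F2_def)
    have fin: "finite R" "finite F2" using F(1) by (auto simp: R_def F2_def)
    have "sum wset_wt F2 \<le> sum wset_wt F" "sum wset_wt R \<le> sum wset_wt F"
      using F(1) nonneg by (auto simp: R_def F2_def intro!: sum_mono2)
    with F(3) have sums: "sum wset_wt F2 < bound k" "sum wset_wt R < 32" using bound_less[of k]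
      by auto
    have "(\<Sum>e\<in>R. 1 / 2 ^ k) \<le> sum wset_wt R"
      by (rule sum_mono) (auto simp: R_def level_def Suc_le_eq card_gt_0_iff intro!: wt_ge)
    with sums(2) have "real (card R) / 2 ^ k < 32" by simp
    then have "real (card R) < 32 * 2 ^ k" by (simp add: divide_simps)
    also have "\<dots> = real (2 ^ (k + 5))" by (simp add: power_add)
    finally have card_R: "card R < 2 ^ (k + 5)" by (simp only: of_nat_less_iff)
    have "card R * 2 ^ (k + 15) \<le> card (wset_idx e \<inter> {0..})" if "e \<in> R" for e
    proof -
      have "card R * 2 ^ (k + 15) \<le> 2 ^ (k + 5) * 2 ^ (k + 15)"
        using card_R by (intro mult_right_mono) auto
      also have "\<dots> = 2 ^ (2 * k + 20)" unfolding power_add[symmetric] by (rule arg_cong[where f =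
        "(^) 2"]) simp
      also have "\<dots> \<le> card (wset_idx e)"
      proof (rule tower_large_index)
        show "e \<in> tower (Suc d) k" using that F(2) by (auto simp: R_def)
        have "wset_wt e \<le> sum wset_wt R" using that fin nonneg
          by (intro member_le_sum) (auto simp: R_def)
        with sums show "wset_wt e < 32" by simp
      qed
      finally show ?thesis by (simp add: atLeast_0)
    qed
    then obtain y where y: "\<forall>e\<in>R. y \<notin> wset_set e"
      "\<forall>e\<in>F2. (3 * card R + 1) * card (wset_idx e) \<le> 2 ^ (k + 7) * card (wset_idx e \<inter> {0..}) \<longrightarrow>
        y \<notin> wset_set e"
      using avoid_all[OF Suc.IH fin(2) _ sums(1) fin(1), of 0] unfolding F2_def R_def by blast
    have "(3 * card R + 1) * c \<le> 2 ^ (k + 7) * c" for c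
    proof (rule mult_right_mono)
      have "2 ^ (k + 7) = 4 * (2 ^ (k + 5) :: nat)" by (simp add: power_add)
      with card_R show "3 * card R + 1 \<le> 2 ^ (k + 7)" by linarith
    qed simp
    with y(2) have "\<forall>e\<in>F2. y \<notin> wset_set e" by (simp add: atLeast_0)
    with y(1) \<open>F = R \<union> F2\<close> F(4) show False by blast
  qed
qed

section \<open>The limit submeasure\<close>

definition is_ultra :: "'a filter \<Rightarrow> bool" where
  "is_ultra U \<longleftrightarrow> U \<noteq> bot \<and> (\<forall>P. eventually P U \<or> eventually (\<lambda>x. \<not> P x) U)"

text \<open>A maximal family with the finite intersection property that contains all tails generates
  the filter. A set outside the family misses some finite intersection of its members, so its
  complement is in the filter.\<close>

lemma ex_ultrafilter: "\<exists>U :: nat filter. is_ultra U \<and> (\<forall>n. eventually (\<lambda>p. n \<le> p) U)"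
proof -
  define \<A> where "\<A> = {A :: nat set set. (\<forall>n. {n..} \<in> A) \<and> (\<forall>B. finite B \<and> B \<subseteq> A \<longrightarrow> \<Inter>B \<noteq> {})}"
  have "range atLeast \<in> \<A>"
    unfolding \<A>_def
  proof (intro CollectI conjI allI impI)
    fix B :: "nat set set" assume "finite B \<and> B \<subseteq> range atLeast"
    then obtain N where N: "finite N" "B = atLeast ` N" by (meson finite_subset_image)
    then have "Max (insert 0 N) \<in> \<Inter>B" by auto
    then show "\<Inter>B \<noteq> {}" by blast
  qed auto
  moreover have "\<Union>\<C> \<in> \<A>" if "\<C> \<noteq> {}" "subset.chain \<A> \<C>" for \<C>
  proof -
    have sub: "\<C> \<subseteq> \<A>" using that(2) by (simp add: subset.chain_def)
    have "\<Inter>B \<noteq> {}" if B: "finite B" "B \<subseteq> \<Union>\<C>" for B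
    proof -
      obtain A where "A \<in> \<C>" "B \<subseteq> A"
        using finite_subset_Union_chain[OF B \<open>\<C> \<noteq> {}\<close> \<open>subset.chain \<A> \<C>\<close>] by blast
      with sub B(1) show ?thesis unfolding \<A>_def by blast
    qed
    moreover have "{n..} \<in> \<Union>\<C>" for n
      using that(1) sub unfolding \<A>_def by blast
    ultimately show ?thesis unfolding \<A>_def by blast
  qed
  ultimately obtain M where M: "M \<in> \<A>" "\<And>X. X \<in> \<A> \<Longrightarrow> M \<subseteq> X \<Longrightarrow> X = M"
    using subset_Zorn_nonempty[of \<A>] by blast
  define U where "U = (INF S\<in>M. principal S)"
  have in_U: "eventually (\<lambda>x. x \<in> S) U" if "S \<in> M" for S
    using INF_lower[OF that, of principal] unfolding U_def le_principal[symmetric] by simp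
  have "U \<noteq> bot"
    unfolding U_def
  proof (rule INF_filter_not_bot)
    fix B assume "B \<subseteq> M" "finite B"
    with M(1) have "\<Inter>B \<noteq> {}" unfolding \<A>_def by blast
    then have "principal (\<Inter>B) \<noteq> bot" by (simp add: principal_eq_bot_iff)
    then show "(INF b\<in>B. principal b) \<noteq> bot"
      using INF_principal_finite[OF \<open>finite B\<close>, of "\<lambda>b. b"] by simp
  qed
  moreover have "eventually P U \<or> eventually (\<lambda>x. \<not> P x) U" for P
  proof (cases "Collect P \<in> M")
    case True
    then show ?thesis using in_U by force
  next
    case False
    then have "insert (Collect P) M \<notin> \<A>" using M(2)[of "insert (Collect P) M"] by blast
    then obtain B where B: "finite B" "B \<subseteq> insert (Collect P) M" "\<Inter>B = {}"
      using M(1) unfolding \<A>_def by blast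
    have "eventually (\<lambda>x. \<forall>S\<in>B - {Collect P}. x \<in> S) U"
      using B(1,2) in_U by (intro eventually_ball_finite) auto
    then have "eventually (\<lambda>x. \<not> P x) U"
    proof (rule eventually_mono)
      fix x assume x: "\<forall>S\<in>B - {Collect P}. x \<in> S"
      show "\<not> P x"
      proof
        assume "P x"
        with x have "x \<in> \<Inter>B" by blast
        with B(3) show False by simp
      qed
    qed
    then show ?thesis ..
  qed
  moreover have "eventually (\<lambda>p. n \<le> p) U" for n
    using in_U[of "{n..}"] M(1) unfolding \<A>_def by simp
  ultimately show ?thesis unfolding is_ultra_def by blast
qed

definition ultra :: "nat filter" where
  "ultra = (SOME U. is_ultra U \<and> (\<forall>n. eventually (\<lambda>p. n \<le> p) U))"

lemma is_ultra_ultra: "is_ultra ultra" and ultra_ge: "eventually (\<lambda>p. n \<le> p) ultra"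
  using someI_ex[OF ex_ultrafilter] unfolding ultra_def[symmetric] by blast+

lemma ultra_not: "is_ultra U \<Longrightarrow> \<not> eventually P U \<Longrightarrow> eventually (\<lambda>x. \<not> P x) U"
  unfolding is_ultra_def by blast

lemma ultra_const: "is_ultra U \<Longrightarrow> eventually (\<lambda>x. P) U \<longleftrightarrow> P"
  unfolding is_ultra_def by (cases P) (auto simp: eventually_False)

lemma ultra_pigeonhole:
  assumes "is_ultra U" "finite S" "eventually (\<lambda>x. f x \<in> S) U"
  obtains s where "s \<in> S" "eventually (\<lambda>x. f x = s) U"
proof (rule ccontr)
  assume "\<not> thesis"
  with that have "\<And>s. s \<in> S \<Longrightarrow> \<not> eventually (\<lambda>x. f x = s) U" by blast
  then have "\<And>s. s \<in> S \<Longrightarrow> eventually (\<lambda>x. f x \<noteq> s) U" using ultra_not[OF assms(1)] by blast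
  then have "eventually (\<lambda>x. \<forall>s\<in>S. f x \<noteq> s) U" using assms(2) by (intro eventually_ball_finite) auto
  with assms(3) have "eventually (\<lambda>x. False) U" by eventually_elim blast
  with ultra_const[OF assms(1)] show False by blast
qed

text \<open>The tensor square: in \<open>(q, p)\<close>, the second component tends to infinity first.\<close>

definition ultra2 :: "(nat \<times> nat) filter" where
  "ultra2 = Abs_filter (\<lambda>P. eventually (\<lambda>q. eventually (\<lambda>p. P (q, p)) ultra) ultra)"

lemma eventually_ultra2: "eventually P ultra2 \<longleftrightarrow>
  eventually (\<lambda>q. eventually (\<lambda>p. P (q, p)) ultra) ultra"
  unfolding ultra2_def
proof (rule eventually_Abs_filter, rule is_filter.intro, goal_cases)
  case (2 P Q)
  then show ?case by eventually_elim (rule eventually_conj)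
next
  case (3 P Q)
  show ?case
    by (rule eventually_mono[OF 3(2)], erule eventually_mono) (use 3(1) in blast)
qed simp

lemma is_ultra_ultra2: "is_ultra ultra2"
  unfolding is_ultra_def
proof (intro conjI allI)
  show "ultra2 \<noteq> bot"
    using ultra_const[OF is_ultra_ultra, of False]
    by (simp add: trivial_limit_def eventually_ultra2)
  fix P
  show "eventually P ultra2 \<or> (\<forall>\<^sub>F x in ultra2. \<not> P x)"
    unfolding eventually_ultra2
  proof (rule disjCI)
    assume "\<not> eventually (\<lambda>q. eventually (\<lambda>p. \<not> P (q, p)) ultra) ultra"
    then have "eventually (\<lambda>q. \<not> eventually (\<lambda>p. \<not> P (q, p)) ultra) ultra"
      by (rule ultra_not[OF is_ultra_ultra])
    then show "eventually (\<lambda>q. eventually (\<lambda>p. P (q, p)) ultra) ultra"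
      by (rule eventually_mono) (use ultra_not[OF is_ultra_ultra] in fastforce)
  qed
qed

section \<open>Truncated towers and their limit\<close>

lemma covered_mono: "covered \<C> r E \<Longrightarrow> \<C> \<subseteq> \<D> \<Longrightarrow> r \<le> s \<Longrightarrow> D \<subseteq> E \<Longrightarrow> covered \<D> s D"
  unfolding covered_def by (meson order_less_le_trans order_trans)

lemma covered_Un:
  assumes "covered \<C> r A" "covered \<C> s B" "\<And>e. e \<in> \<C> \<Longrightarrow> wset_wt e \<ge> 0"
  shows "covered \<C> (r + s) (A \<union> B)"
proof -
  obtain F G where F: "finite F" "F \<subseteq> \<C>" "sum wset_wt F < r" "A \<subseteq> (\<Union>e\<in>F. wset_set e)"
    and G: "finite G" "G \<subseteq> \<C>" "sum wset_wt G < s" "B \<subseteq> (\<Union>e\<in>G. wset_set e)"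
    using assms(1,2) unfolding covered_def by blast
  have "sum wset_wt (F \<inter> G) \<ge> 0" using assms(3) F by (intro sum_nonneg) auto
  then have "sum wset_wt (F \<union> G) < r + s"
    using F G sum_Un[of F G wset_wt] by simp
  with F G show ?thesis unfolding covered_def by (intro exI[of _ "F \<union> G"]) auto
qed

text \<open>Levels \<open>k\<close> to \<open>p - 1\<close>. With the upper end fixed instead of the
  number of levels, level \<open>k\<close> refers to the tower of the same \<open>p\<close> at
  \<open>Suc k\<close>, and \<open>p\<close> can tend to infinity for all \<open>k\<close> at
  once.\<close>

definition tower_upto :: "nat \<Rightarrow> nat \<Rightarrow> wset set" where
  "tower_upto p k = tower (p - k) k"

lemma tower_upto_idx: "e \<in> tower_upto p k \<Longrightarrow> finite (wset_idx e) \<and> wset_idx e \<noteq> {} \<and> wset_wt e \<ge> 0"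
  unfolding tower_upto_def by (rule tower_idx)

lemma tower_add: "tower d (k + j) \<subseteq> tower (d + j) k"
proof (induction j arbitrary: k)
  case (Suc j)
  have "tower d (k + Suc j) = tower d (Suc k + j)" by simp
  also have "\<dots> \<subseteq> tower (d + j) (Suc k)" by (rule Suc.IH)
  also have "\<dots> \<subseteq> tower (d + Suc j) k" by auto
  finally show ?case .
qed simp

lemma tower_upto_mono: "k \<le> k' \<Longrightarrow> tower_upto p k' \<subseteq> tower_upto p k"
proof (cases "k' \<le> p")
  case True
  assume "k \<le> k'"
  with True show ?thesis using tower_add[of "p - k'" k "k' - k"] by (simp add: tower_upto_def)
qed (simp add: tower_upto_def)

lemma tower_upto_level: "k < p \<Longrightarrow>
  tower_upto p k = level k (\<lambda>C. \<not> covered (tower_upto p (Suc k)) 1 C) \<union> tower_upto p (Suc k)"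
  unfolding tower_upto_def by (simp add: Suc_diff_Suc[symmetric])

lemma tower_upto_not_covered: "\<not> covered (tower_upto p k) 16 UNIV"
  using tower_not_covered[of "p - k" k] bound_ge[of k] covered_mono unfolding tower_upto_def
    by blast

text \<open>\<open>small k r E\<close>: in the limit of infinitely many levels, \<open>E\<close> has a cover of weight less than \<open>r\<close>
  by levels \<open>\<ge> k\<close>.\<close>

definition small :: "nat \<Rightarrow> real \<Rightarrow> (nat \<Rightarrow> nat) set \<Rightarrow> bool" where
  "small k r E \<longleftrightarrow> eventually (\<lambda>p. covered (tower_upto p k) r E) ultra"

lemma small_mono: "small k r E \<Longrightarrow> r \<le> s \<Longrightarrow> D \<subseteq> E \<Longrightarrow> small k s D"
  unfolding small_def by (erule eventually_mono) (erule covered_mono, auto)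

lemma small_level: "small k' r E \<Longrightarrow> k \<le> k' \<Longrightarrow> small k r E"
  unfolding small_def by (erule eventually_mono) (erule covered_mono, auto dest: tower_upto_mono)

lemma small_Un: "small k r A \<Longrightarrow> small k s B \<Longrightarrow> small k (r + s) (A \<union> B)"
  unfolding small_def
proof (erule (1) eventually_elim2)
  fix p assume "covered (tower_upto p k) r A" "covered (tower_upto p k) s B"
  then show "covered (tower_upto p k) (r + s) (A \<union> B)"
    by (rule covered_Un) (use tower_upto_idx in blast)
qed

lemma small_UN:
  assumes "finite X" "X \<noteq> {}" "\<And>x. x \<in> X \<Longrightarrow> small k r (A x)"
  shows "small k (real (card X) * r) (\<Union>x\<in>X. A x)"
  using assms
proof (induction rule: finite_ne_induct)
  case (insert x X)
  then have "small k (r + real (card X) * r) (A x \<union> (\<Union>x\<in>X. A x))" by (intro small_Un) auto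
  with insert.hyps show ?case by (simp add: algebra_simps)
qed simp

lemma small_empty: "0 < r \<Longrightarrow> small k r {}"
  unfolding small_def covered_def by (intro always_eventually allI exI[of _ "{}"]) auto

lemma small_pos: "small k r E \<Longrightarrow> 0 < r"
proof -
  assume "small k r E"
  then have "eventually (\<lambda>p. 0 < r) ultra"
    unfolding small_def
  proof (rule eventually_mono)
    fix p assume "covered (tower_upto p k) r E"
    then obtain F where F: "finite F" "F \<subseteq> tower_upto p k" "sum wset_wt F < r" unfolding covered_def
      by blast
    have "sum wset_wt F \<ge> 0" using F(2) tower_upto_idx by (intro sum_nonneg) blast
    with F(3) show "0 < r" by simp
  qed
  then show ?thesis by (simp add: ultra_const is_ultra_ultra)
qed

lemma not_small_UNIV: "\<not> small k 16 UNIV"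
  unfolding small_def using ultra_const[OF is_ultra_ultra, of False] tower_upto_not_covered by simp

lemma small_of_level:
  assumes "eventually (\<lambda>p. (E, I, w) \<in> level k (\<lambda>C. \<not> covered (tower_upto p (Suc k)) 1 C)) ultra"
    "w < r"
  shows "small k r E"
  using assms(1) ultra_ge[of "Suc k"] unfolding small_def
proof eventually_elim
  case (elim p)
  then have "(E, I, w) \<in> tower_upto p k" using tower_upto_level[of k p] by auto
  with assms(2) show ?case unfolding covered_def by (intro exI[of _ "{(E, I, w)}"]) auto
qed

section \<open>Localising covers to a range of coordinates\<close>

lemma restrictable_tower_upto: "restrictable (tower_upto p k) 2 2"
  unfolding tower_upto_def by (rule restrictable_tower_half)

lemma half_split:
  fixes I :: "nat set"
  assumes "finite I" "\<not> card I \<le> 2 * card (I \<inter> {a..<b})" "I \<inter> {a..} = I \<inter> {a..<c}" "b \<le> c" "a \<le> b"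
    and "I \<subseteq> {a..} \<or> a = 0"
  shows "card I \<le> 2 * card (I \<inter> {b..<c})"
proof -
  have "I \<inter> {a..} = (I \<inter> {a..<b}) \<union> (I \<inter> {b..<c})"
    unfolding assms(3) using assms(4,5) by auto
  moreover have "I \<inter> {a..} = I" using assms(6) by auto
  ultimately have "card I \<le> card (I \<inter> {a..<b}) + card (I \<inter> {b..<c})"
    using card_Un_le by metis
  with assms(2) show ?thesis by linarith
qed

text \<open>Some point avoids all sets with half of their indices below \<open>m\<close>, as twice
  their weight stays below \<open>16\<close>. In its cylinder the other sets cover \<open>E\<close>;
  these have at least half of their indices from \<open>m\<close> on and can be restricted to them.
  Since \<open>E\<close> does not see the coordinates below \<open>m\<close>, covering it in one
  cylinder suffices.\<close>

lemma trim:
  assumes "covered (tower_upto p k) r E" "depends {m..} E" "2 * r \<le> 16"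
  obtains F where "finite F" "F \<subseteq> tower_upto p k" "sum wset_wt F < 2 * r" "E \<subseteq> (\<Union>e\<in>F. wset_set e)"
    "\<And>e. e \<in> F \<Longrightarrow> depends {m..} (wset_set e) \<and> wset_idx e \<subseteq> {m..}"
proof -
  let ?C = "tower_upto p k"
  have nonneg: "wset_wt e \<ge> 0" if "e \<in> ?C" for e using that tower_upto_idx by blast
  obtain F0 where F0: "finite F0" "F0 \<subseteq> ?C" "sum wset_wt F0 < r" "E \<subseteq> (\<Union>e\<in>F0. wset_set e)"
    using assms(1) unfolding covered_def by blast
  have "finite (wset_idx e)" if "e \<in> F0" for e using that F0(2) tower_upto_idx by blast
  then obtain n where n: "m \<le> n" "\<And>e. e \<in> F0 \<Longrightarrow> wset_idx e \<inter> {0..} = wset_idx e \<inter> {0..<n}"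
    using finite_idx_bound[OF F0(1)] by metis
  define G1 where "G1 = {e \<in> F0. card (wset_idx e) \<le> 2 * card (wset_idx e \<inter> {0..<m})}"
  define G2 where "G2 = F0 - G1"
  have G1: "finite G1" "G1 \<subseteq> ?C" and G2: "finite G2" "G2 \<subseteq> ?C" using F0
    by (auto simp: G1_def G2_def)
  have "sum wset_wt G1 \<le> sum wset_wt F0" "sum wset_wt G2 \<le> sum wset_wt F0"
    using F0(1,2) nonneg by (auto simp: G1_def G2_def intro!: sum_mono2)
  with F0(3) assms(3) have lt: "2 * sum wset_wt G1 < 16" "2 * sum wset_wt G2 < 2 * r" by auto
  have sig1: "card (wset_idx e) \<le> 2 * card (wset_idx e \<inter> {0..<m})" if "e \<in> G1" for e
    using that by (simp add: G1_def)
  obtain y where y: "\<And>e z. e \<in> G1 \<Longrightarrow> agree {..<m} y z \<Longrightarrow> z \<notin> wset_set e"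
    using extend_point[OF restrictable_tower_upto nonneg G1 le0 sig1 depends_UNIV
      tower_upto_not_covered lt(1)] by blast
  have sig2: "card (wset_idx e) \<le> 2 * card (wset_idx e \<inter> {m..<n})" if "e \<in> G2" for e
  proof (rule half_split)
    show "finite (wset_idx e)" using that G2(2) tower_upto_idx by blast
    show "\<not> card (wset_idx e) \<le> 2 * card (wset_idx e \<inter> {0..<m})" using that
      by (auto simp: G1_def G2_def)
    show "wset_idx e \<inter> {0..} = wset_idx e \<inter> {0..<n}" using that n(2) by (auto simp: G2_def)
  qed (use n(1) in auto)
  have "\<forall>e\<in>G2. \<exists>e'. e' \<in> ?C \<and> wset_wt e' \<le> 2 * wset_wt e \<and> wset_idx e' = wset_idx e \<inter> {m..<n} \<and>
        depends {m..<n} (wset_set e') \<and> (\<forall>z\<in>wset_set e. agree {..<m} z y \<longrightarrow> z \<in> wset_set e')"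
  proof
    fix e assume e: "e \<in> G2"
    with G2 have "e \<in> ?C" by blast
    from restrictable_tower_upto[unfolded restrictable_def, rule_format, OF this sig2[OF e], of y]
    show "\<exists>e'. e' \<in> ?C \<and> wset_wt e' \<le> 2 * wset_wt e \<and> wset_idx e' = wset_idx e \<inter> {m..<n} \<and>
        depends {m..<n} (wset_set e') \<and> (\<forall>z\<in>wset_set e. agree {..<m} z y \<longrightarrow> z \<in> wset_set e')"
      by (auto simp only: Bex_def)
  qed
  then obtain g where g: "\<forall>e\<in>G2. g e \<in> ?C \<and> wset_wt (g e) \<le> 2 * wset_wt e \<and>
        wset_idx (g e) = wset_idx e \<inter> {m..<n} \<and>
        depends {m..<n} (wset_set (g e)) \<and> (\<forall>z\<in>wset_set e. agree {..<m} z y \<longrightarrow> z \<in> wset_set (g e))"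
    by metis
  show ?thesis
  proof (rule that)
    show "finite (g ` G2)" "g ` G2 \<subseteq> ?C" using G2 g by auto
    have "sum wset_wt (g ` G2) \<le> (\<Sum>e\<in>G2. wset_wt (g e))"
      using sum_image_le[of G2 wset_wt g] G2(1) g nonneg by (auto simp: o_def)
    also have "\<dots> \<le> (\<Sum>e\<in>G2. 2 * wset_wt e)" using g by (intro sum_mono) auto
    finally show "sum wset_wt (g ` G2) < 2 * r" using lt(2)
      by (simp add: sum_distrib_left[symmetric])
    show "E \<subseteq> (\<Union>e\<in>g ` G2. wset_set e)"
    proof
      fix z assume "z \<in> E"
      let ?z = "splice m y z"
      have "?z \<in> E" using dependsD[OF assms(2) agree_splice_right] \<open>z \<in> E\<close> by blast
      with F0(4) obtain e where e: "e \<in> F0" "?z \<in> wset_set e" by blast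
      with y agree_sym[OF agree_splice_left] have "e \<notin> G1" by blast
      with e(1) have "e \<in> G2" by (simp add: G2_def)
      with g e(2) agree_splice_left have "?z \<in> wset_set (g e)" by blast
      moreover have "agree {m..<n} ?z z" using agree_splice_right by (rule agree_mono) auto
      ultimately have "z \<in> wset_set (g e)" using g \<open>e \<in> G2\<close> dependsD by blast
      with \<open>e \<in> G2\<close> show "z \<in> (\<Union>e\<in>g ` G2. wset_set e)" by blast
    qed
    fix e assume "e \<in> g ` G2"
    then obtain e1 where e1: "e1 \<in> G2" "e = g e1" by blast
    then have "depends {m..<n} (wset_set e)" using g by blast
    then have "depends {m..} (wset_set e)" by (rule depends_mono) auto
    moreover have "wset_idx e \<subseteq> {m..}" using g e1 by auto
    ultimately show "depends {m..} (wset_set e) \<and> wset_idx e \<subseteq> {m..}" by blast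
  qed
qed

lemma trace:
  assumes "finite G" "G \<subseteq> tower_upto p k" "2 * sum wset_wt G < r"
    and "\<And>e. e \<in> G \<Longrightarrow> card (wset_idx e) \<le> 2 * card (wset_idx e \<inter> {m..<n})"
    and "\<And>e. e \<in> G \<Longrightarrow> depends {m..} (wset_set e)"
  obtains V where "depends {m..<n} V" "covered (tower_upto p k) r V" "\<And>e. e \<in> G \<Longrightarrow> wset_set e \<subseteq> V"
proof -
  have nonneg: "wset_wt e \<ge> 0" if "e \<in> tower_upto p k" for e using that tower_upto_idx by blast
  \<comment> \<open>Any point would do: the sets in \<open>G\<close> do not see coordinates below
    \<open>m\<close>, so an inclusion valid in one cylinder is valid everywhere.\<close>
  define o' :: "nat \<Rightarrow> nat" where "o' = (\<lambda>_. 0)"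
  obtain G' where G': "finite G'" "G' \<subseteq> tower_upto p k" "sum wset_wt G' \<le> 2 * sum wset_wt G"
    "\<And>e. e \<in> G' \<Longrightarrow> depends {m..<n} (wset_set e)"
    "\<And>z e. e \<in> G \<Longrightarrow> z \<in> wset_set e \<Longrightarrow> agree {..<m} z o' \<Longrightarrow> z \<in> (\<Union>e\<in>G'. wset_set e)"
    using restrict_family[OF restrictable_tower_upto assms(1,2) nonneg assms(4), where x = o']
      by blast
  let ?V = "\<Union>e\<in>G'. wset_set e"
  have V: "depends {m..<n} ?V" using G'(4) by (rule depends_UN)
  moreover have "covered (tower_upto p k) r ?V"
    unfolding covered_def using G'(1-3) assms(3) by (intro exI[of _ G']) auto
  moreover have "wset_set e \<subseteq> ?V" if "e \<in> G" for e
  proof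
    fix z assume "z \<in> wset_set e"
    then have "splice m o' z \<in> wset_set e" using dependsD[OF assms(5)[OF that] agree_splice_right]
      by blast
    then have "splice m o' z \<in> ?V" using G'(5)[OF that] agree_splice_left by blast
    moreover have "agree {m..<n} (splice m o' z) z" using agree_splice_right
      by (rule agree_mono) auto
    ultimately show "z \<in> ?V" using dependsD[OF V] by blast
  qed
  ultimately show ?thesis by (rule that)
qed

text \<open>Picks one point from every cylinder of length \<open>m\<close>, so that finitely many
  choices serve all points.\<close>

definition canonical :: "nat \<Rightarrow> (nat \<Rightarrow> nat) \<Rightarrow> nat \<Rightarrow> nat" where
  "canonical m x = (\<lambda>i. if i < m then x i mod 2 ^ i else 0)"

lemma agree_canonical: "agree {..<m} (canonical m x) x"
  by (simp add: agree_def canonical_def)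

lemma finite_range_canonical: "finite (range (canonical m))"
proof (rule finite_subset)
  show "range (canonical m) \<subseteq> {f. \<forall>i. (i \<in> {..<m} \<longrightarrow> f i \<in> {..<2 ^ m}) \<and> (i \<notin> {..<m} \<longrightarrow> f i = 0)}"
  proof (clarsimp simp: canonical_def)
    fix x :: "nat \<Rightarrow> nat" and i assume "i < m"
    have "x i mod 2 ^ i < 2 ^ i" by simp
    also have "(2 :: nat) ^ i \<le> 2 ^ m" using \<open>i < m\<close> by (intro power_increasing) auto
    finally show "x i mod 2 ^ i < 2 ^ m" .
  qed
qed (rule finite_set_of_finite_funs, auto)

lemma finite_depends: "finite {V. depends {..<n} V}"
proof (rule finite_imageD)
  show "finite ((\<lambda>V. V \<inter> range (canonical n)) ` {V. depends {..<n} V})"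
    by (rule finite_subset[of _ "Pow (range (canonical n))"]) (auto simp: finite_range_canonical)
  show "inj_on (\<lambda>V. V \<inter> range (canonical n)) {V. depends {..<n} V}"
  proof (rule inj_onI)
    fix V W assume VW: "V \<in> {V. depends {..<n} V}" "W \<in> {V. depends {..<n} V}"
      "V \<inter> range (canonical n) = W \<inter> range (canonical n)"
    have "z \<in> V \<longleftrightarrow> z \<in> W" for z
      using dependsD[OF _ agree_canonical, of n V z] dependsD[OF _ agree_canonical, of n W z] VW
        by blast
    then show "V = W" by blast
  qed
qed

section \<open>Exhaustivity\<close>

text \<open>Sort the sets of a light cover of \<open>\<Union>i\<le>q. E i\<close> by the least \<open>n\<close> for which half of their indices
  lie in \<open>{m..<n}\<close>. The total weight is bounded, so beyond some \<open>n\<close> almost no weight appears at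
  any fixed stage \<open>n'\<close>. The traces up to \<open>n\<close> form \<open>D\<close>, which can be chosen independently of the
  cover as there are only finitely many sets depending on \<open>{m..<n}\<close>. The sets with half of their
  indices beyond the coordinates of \<open>E i\<close> cannot help to cover it, because they are too light to
  cover the whole space.\<close>

lemma residual:
  assumes depends: "\<And>i :: nat. depends {m..<b i} (E i)"
    and bounded: "\<And>q. small k 2 (\<Union>i\<le>q. E i)" and "0 < \<alpha>"
  obtains D n where "m \<le> n" "depends {m..<n} D" "small k 8 D" "\<And>i. small k \<alpha> (E i - D)"
proof -
  \<comment> \<open>The weight is \<open>4\<close> because trimming doubles the \<open>2\<close> of
    the hypothesis. The cover depends on the range \<open>q\<close> of sets and on the truncation
    \<open>p\<close>, hence the iterated ultrafilter.\<close>
  define good where "good x F \<longleftrightarrow> finite F \<and> F \<subseteq> tower_upto (snd x) k \<and> sum wset_wt F < 4 \<and>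
      (\<Union>i\<le>fst x. E i) \<subseteq> (\<Union>e\<in>F. wset_set e) \<and> (\<forall>e\<in>F. depends {m..} (wset_set e) \<and> wset_idx e \<subseteq>
        {m..})"
    for x :: "nat \<times> nat" and F
  have nonneg: "wset_wt e \<ge> 0" if "good x F" "e \<in> F" for x F e
  proof -
    have "e \<in> tower_upto (snd x) k" using that by (auto simp: good_def)
    then show ?thesis using tower_upto_idx by blast
  qed
  have "eventually (\<lambda>x. \<exists>F. good x F) ultra2"
    unfolding eventually_ultra2
  proof (rule always_eventually, rule allI)
    fix q
    have depends_q: "depends {m..} (\<Union>i\<le>q. E i)"
      by (rule depends_UN, rule depends_mono[OF depends]) auto
    show "eventually (\<lambda>p. \<exists>F. good (q, p) F) ultra"
      using bounded[of q] unfolding small_def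
    proof (rule eventually_mono)
      fix p assume "covered (tower_upto p k) 2 (\<Union>i\<le>q. E i)"
      from trim[OF this depends_q] obtain F where "finite F" "F \<subseteq> tower_upto p k"
        "sum wset_wt F < 2 * 2"
        "(\<Union>i\<le>q. E i) \<subseteq> (\<Union>e\<in>F. wset_set e)"
        "\<And>e. e \<in> F \<Longrightarrow> depends {m..} (wset_set e) \<and> wset_idx e \<subseteq> {m..}" by auto
      then show "\<exists>F. good (q, p) F" unfolding good_def by (intro exI[of _ F]) auto
    qed
  qed
  moreover define F where "F x = (SOME F. good x F)" for x
  ultimately have good: "eventually (\<lambda>x. good x (F x)) ultra2"
    by (simp add: F_def some_eq_ex)
  define H where "H n x = {e \<in> F x. card (wset_idx e) \<le> 2 * card (wset_idx e \<inter> {m..<n})}" for n x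
  define u where "u n x = sum wset_wt (H n x)" for n x
  have H_mono: "H n x \<subseteq> H n' x" if "good x (F x)" "n \<le> n'" for n n' x
  proof
    fix e assume e: "e \<in> H n x"
    then have "e \<in> tower_upto (snd x) k" using that(1) by (auto simp: good_def H_def)
    then have "finite (wset_idx e)" using tower_upto_idx by blast
    then have "card (wset_idx e \<inter> {m..<n}) \<le> card (wset_idx e \<inter> {m..<n'})"
      using that(2) by (intro card_mono) auto
    with e show "e \<in> H n' x" by (auto simp: H_def)
  qed
  have u_le: "0 \<le> u n x \<and> u n x < 4" if "good x (F x)" for n x
  proof -
    have "u n x \<le> sum wset_wt (F x)"
      unfolding u_def H_def using that nonneg[OF that] by (intro sum_mono2) (auto simp: good_def)
    moreover have "0 \<le> u n x" unfolding u_def using nonneg[OF that]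
      by (intro sum_nonneg) (auto simp: H_def)
    ultimately show ?thesis using that by (simp add: good_def)
  qed
  \<comment> \<open>For almost every \<open>x\<close> the values \<open>u n x\<close> increase with
    \<open>n\<close> and stay below \<open>4\<close>, so they cannot gain
    \<open>\<alpha> / 2\<close> at arbitrarily many stages. The set of good \<open>x\<close> may
    depend on \<open>n'\<close>; only \<open>n\<close> is fixed.\<close>
  have "\<exists>n\<ge>m. \<forall>n'\<ge>n. eventually (\<lambda>x. u n' x - u n x < \<alpha> / 2) ultra2"
  proof (rule ccontr)
    assume "\<not> (\<exists>n\<ge>m. \<forall>n'\<ge>n. eventually (\<lambda>x. u n' x - u n x < \<alpha> / 2) ultra2)"
    then have "\<forall>n. \<exists>n'. m \<le> n \<longrightarrow> n \<le> n' \<and> \<not> eventually (\<lambda>x. u n' x - u n x < \<alpha> / 2) ultra2" by blast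
    then obtain h where h: "\<And>n. m \<le> n \<Longrightarrow> n \<le> h n"
      "\<And>n. m \<le> n \<Longrightarrow> \<not> eventually (\<lambda>x. u (h n) x - u n x < \<alpha> / 2) ultra2" by metis
    define s where "s j = (h ^^ j) m" for j
    have s: "m \<le> s j" for j
    proof (induction j)
      case (Suc j)
      then show ?case using h(1)[OF Suc] by (simp add: s_def)
    qed (simp add: s_def)
    have step: "eventually (\<lambda>x. \<alpha> / 2 \<le> u (s (Suc j)) x - u (s j) x) ultra2" for j
      using ultra_not[OF is_ultra_ultra2 h(2)[OF s[of j]]] by (simp add: s_def not_less)
    have grow: "eventually (\<lambda>x. real j * (\<alpha> / 2) \<le> u (s j) x - u (s 0) x) ultra2" for j
    proof (induction j)
      case (Suc j)
      from Suc step[of j] show ?case by eventually_elim (simp add: field_simps)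
    qed simp
    obtain j :: nat where "4 / (\<alpha> / 2) < real j" using reals_Archimedean2 by blast
    then have "4 < real j * (\<alpha> / 2)" using \<open>0 < \<alpha>\<close> by (simp add: field_simps)
    then have "eventually (\<lambda>x. 4 < u (s j) x - u (s 0) x) ultra2"
      by (intro eventually_mono[OF grow[of j]]) simp
    with good have "eventually (\<lambda>x. False) ultra2"
    proof eventually_elim
      case (elim x)
      with u_le[of x "s j"] u_le[of x "s 0"] show ?case by linarith
    qed
    then show False by (simp add: ultra_const is_ultra_ultra2)
  qed
  then obtain n where n: "m \<le> n" "\<And>n'. n \<le> n' \<Longrightarrow> eventually (\<lambda>x. u n' x - u n x < \<alpha> / 2) ultra2"
    by blast
  define core where "core x V \<longleftrightarrow> depends {m..<n} V \<and> covered (tower_upto (snd x) k) 8 V \<and>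
    (\<forall>e\<in>H n x. wset_set e \<subseteq> V)"
    for x :: "nat \<times> nat" and V
  have "eventually (\<lambda>x. \<exists>V. core x V) ultra2"
    using good
  proof eventually_elim
    case (elim x)
    have "finite (H n x)" "H n x \<subseteq> tower_upto (snd x) k" "2 * sum wset_wt (H n x) < 8"
      using elim u_le[OF elim, of n] by (auto simp: good_def H_def u_def)
    then obtain V where "depends {m..<n} V" "covered (tower_upto (snd x) k) 8 V" "\<And>e. e \<in> H n x \<Longrightarrow>
      wset_set e \<subseteq> V"
      by (rule trace[where m = m and n = n]) (use elim in \<open>auto simp: good_def H_def\<close>)
    then show ?case unfolding core_def by blast
  qed
  moreover define V where "V x = (SOME V. core x V)" for x
  ultimately have core: "eventually (\<lambda>x. core x (V x)) ultra2"
    by (simp add: V_def some_eq_ex)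
  have "finite {V. depends {m..<n} V}"
    by (rule finite_subset[OF _ finite_depends[of n]]) (auto elim: depends_mono)
  moreover have "eventually (\<lambda>x. V x \<in> {V. depends {m..<n} V}) ultra2"
    using core by eventually_elim (simp add: core_def)
  ultimately obtain D where D: "depends {m..<n} D" "eventually (\<lambda>x. V x = D) ultra2"
    using ultra_pigeonhole[OF is_ultra_ultra2] by blast
  from core D(2) have core: "eventually (\<lambda>x. core x D) ultra2"
    by eventually_elim simp
  then have "eventually (\<lambda>x. covered (tower_upto (snd x) k) 8 D) ultra2"
    by eventually_elim (simp add: core_def)
  \<comment> \<open>\<open>D\<close> is one fixed set, so the statement no longer involves
    \<open>q\<close> and the outer limit disappears.\<close>
  then have "small k 8 D"
    unfolding eventually_ultra2 small_def by (simp add: ultra_const is_ultra_ultra)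
  moreover have "small k \<alpha> (E i - D)" for i
  proof -
    define n' where "n' = max n (b i)"
    have n': "n \<le> n'" "b i \<le> n'" by (auto simp: n'_def)
    have "eventually (\<lambda>x. i \<le> fst x) ultra2"
      unfolding eventually_ultra2 using ultra_ge[of i] by (simp add: ultra_const is_ultra_ultra)
    with good core n(2)[OF n'(1)] have
      "eventually (\<lambda>x. covered (tower_upto (snd x) k) \<alpha> (E i - D)) ultra2"
    proof eventually_elim
      case (elim x)
      let ?C = "tower_upto (snd x) k" and ?G = "H n' x - H n x"
      have F: "finite (F x)" "F x \<subseteq> ?C" "sum wset_wt (F x) < 4" using elim(1)
        by (auto simp: good_def)
      have "sum wset_wt ?G = u n' x - u n x"
        unfolding u_def using F(1) H_mono[OF elim(1) n'(1)] by (intro sum_diff) (auto simp: H_def)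
      with elim(3) have lt_\<alpha>: "2 * sum wset_wt ?G < \<alpha>" by simp
      have G: "finite ?G" "?G \<subseteq> ?C" using F by (auto simp: H_def)
      have sig_G: "card (wset_idx e) \<le> 2 * card (wset_idx e \<inter> {m..<n'})" and depends_G:
        "depends {m..} (wset_set e)"
        if "e \<in> ?G" for e
        using that elim(1) by (auto simp: good_def H_def)
      obtain W where W: "depends {m..<n'} W" "covered ?C \<alpha> W" "\<And>e. e \<in> ?G \<Longrightarrow> wset_set e \<subseteq> W"
        using trace[OF G lt_\<alpha> sig_G depends_G] by blast
      define L where "L = F x - H n' x"
      have L: "finite L" "L \<subseteq> ?C" using F by (auto simp: L_def)
      have "sum wset_wt L \<le> sum wset_wt (F x)"
        using F nonneg[OF elim(1)] by (intro sum_mono2) (auto simp: L_def)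
      with F(3) have lt: "2 * sum wset_wt L < 16" by simp
      have "finite (wset_idx e)" if "e \<in> F x" for e using that F(2) tower_upto_idx by blast
      then obtain N where N: "n' \<le> N" "\<And>e. e \<in> F x \<Longrightarrow> wset_idx e \<inter> {m..} = wset_idx e \<inter> {m..<N}"
        using finite_idx_bound[OF F(1)] by metis
      have sig: "card (wset_idx e) \<le> 2 * card (wset_idx e \<inter> {n'..<N})" if "e \<in> L" for e
      proof (rule half_split)
        have e: "e \<in> F x" using that by (simp add: L_def)
        with F(2) tower_upto_idx show "finite (wset_idx e)" by blast
        show "\<not> card (wset_idx e) \<le> 2 * card (wset_idx e \<inter> {m..<n'})" using that
          by (auto simp: L_def H_def)
        show "wset_idx e \<inter> {m..} = wset_idx e \<inter> {m..<N}" using N(2) e .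
        show "wset_idx e \<subseteq> {m..} \<or> m = 0" using e elim(1) by (auto simp: good_def)
      qed (use N(1) n(1) n'(1) in auto)
      have nonneg': "wset_wt e \<ge> 0" if "e \<in> ?C" for e using that tower_upto_idx by blast
      have "E i - D \<subseteq> W"
      proof
        fix z assume z: "z \<in> E i - D"
        \<comment> \<open>\<open>y\<close> agrees with \<open>z\<close> below \<open>n'\<close>,
          where membership in \<open>E i\<close>, \<open>D\<close> and \<open>W\<close> is decided,
          and lies outside all sets in \<open>L\<close>; so the cover puts \<open>y\<close> into
          \<open>D\<close> or \<open>W\<close>, and \<open>z\<close> with it.\<close>
        obtain y where y: "\<And>i. i < n' \<Longrightarrow> y i = z i" "\<And>e w. e \<in> L \<Longrightarrow> agree {..<N} y w \<Longrightarrow> w \<notin> wset_set e"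
          using extend_point[OF restrictable_tower_upto nonneg' L N(1) sig depends_UNIV
            tower_upto_not_covered lt, of z] by blast
        have yz: "agree {m..<j} y z" if "j \<le> n'" for j using y(1) that by (auto simp: agree_def)
        have "y \<in> E i" using dependsD[OF depends yz[OF n'(2)]] z by blast
        with elim(1,4) obtain e where e: "e \<in> F x" "y \<in> wset_set e" unfolding good_def by blast
        have "e \<notin> L" using y(2)[OF _ agree_refl] e(2) by blast
        with e(1) have "e \<in> H n' x" by (simp add: L_def)
        show "z \<in> W"
        proof (cases "e \<in> H n x")
          case True
          with elim(2) e(2) have "y \<in> D" unfolding core_def by blast
          then have "z \<in> D" using dependsD[OF D(1) yz[OF n'(1)]] by blast
          with z show ?thesis by blast
        next
          case False
          with \<open>e \<in> H n' x\<close> W(3) e(2) have "y \<in> W" by blast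
          then show ?thesis using dependsD[OF W(1) yz[OF order_refl]] by blast
        qed
      qed
      with W(2) show ?case by (auto elim: covered_mono)
    qed
    then show ?thesis
      unfolding eventually_ultra2 small_def by (simp add: ultra_const is_ultra_ultra)
  qed
  ultimately show ?thesis using that n(1) D(1) by blast
qed

text \<open>Either finitely many of the sets have a union that is not small, which then serves as \<open>C\<close>, or
  all are small outside a fixed small set, whose complement does.\<close>

lemma thinning_cylinder:
  assumes depends: "\<And>i :: nat. depends {..<b i} (E i)" and disj: "\<And>i j. i \<noteq> j \<Longrightarrow> E i \<inter> E j = {}" and
    "0 < \<alpha>"
  shows "\<exists>C n i0. depends {m..<n} C \<and> \<not> small k 1 C \<and>
    (\<forall>i\<ge>i0. small k \<alpha> (E i \<inter> (C \<inter> {z. agree {..<m} z x})))"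
proof -
  \<comment> \<open>The part of \<open>E i\<close> in the cylinder of \<open>x\<close>, extended to
    all cylinders of length \<open>m\<close>, so that it depends on coordinates from
    \<open>m\<close> on only.\<close>
  define S where "S i = {z. splice m x z \<in> E i}" for i
  have S: "depends {m..<max m (b i)} (S i)" for i
    unfolding depends_def
  proof (intro allI impI)
    fix y z assume yz: "agree {m..<max m (b i)} y z" "y \<in> S i"
    then have "agree {..<b i} (splice m x y) (splice m x z)" by (auto simp: agree_def splice_def)
    with yz(2) dependsD[OF depends] show "z \<in> S i" unfolding S_def by blast
  qed
  have in_S: "z \<in> S i" if "z \<in> E i" "agree {..<m} z x" for z i
  proof -
    have "agree {..<b i} (splice m x z) z" using agree_splice_self[OF that(2)]
      by (rule agree_mono) simp
    with dependsD[OF depends] that(1) show ?thesis unfolding S_def by blast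
  qed
  show ?thesis
  proof (cases "\<forall>q. small k 2 (\<Union>i\<le>q. S i)")
    case False
    then obtain q where q: "\<not> small k 2 (\<Union>i\<le>q. S i)" by blast
    define n where "n = Max ((\<lambda>i. max m (b i)) ` {..q})"
    have "depends {m..<n} (\<Union>i\<le>q. S i)"
    proof (rule depends_UN)
      fix i assume "i \<in> {..q}"
      then have "max m (b i) \<le> n" unfolding n_def by (intro Max_ge) auto
      then show "depends {m..<n} (S i)" by (intro depends_mono[OF S]) auto
    qed
    moreover have "\<not> small k 1 (\<Union>i\<le>q. S i)" using q small_mono by fastforce
    moreover have "E i \<inter> ((\<Union>i\<le>q. S i) \<inter> {z. agree {..<m} z x}) = {}" if "Suc q \<le> i" for i
    proof (rule ccontr)
      assume "E i \<inter> ((\<Union>i\<le>q. S i) \<inter> {z. agree {..<m} z x}) \<noteq> {}"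
      then obtain z j where z: "z \<in> E i" "j \<le> q" "z \<in> S j" "agree {..<m} z x" by blast
      with in_S have "z \<in> S i" by blast
      with z(3) have "splice m x z \<in> E i \<inter> E j" by (simp add: S_def)
      with disj[of i j] z(2) that show False by auto
    qed
    ultimately show ?thesis using small_empty[OF \<open>0 < \<alpha>\<close>]
      by (intro exI[of _ "\<Union>i\<le>q. S i"] exI[of _ n] exI[of _ "Suc q"]) auto
  next
    case True
    then obtain D n where D: "m \<le> n" "depends {m..<n} D" "small k 8 D" "\<And>i. small k \<alpha> (S i - D)"
      using residual[where E = S, OF S True[rule_format] \<open>0 < \<alpha>\<close>] by blast
    \<comment> \<open>The weights \<open>1\<close> and \<open>8\<close> add up to less than the
      \<open>16\<close> needed for the whole space.\<close>
    have "\<not> small k 1 (- D)"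
    proof
      assume "small k 1 (- D)"
      from small_Un[OF this D(3)] have "small k 16 UNIV" by (rule small_mono) auto
      with not_small_UNIV show False by blast
    qed
    moreover have "small k \<alpha> (E i \<inter> (- D \<inter> {z. agree {..<m} z x}))" for i
      by (rule small_mono[OF D(4)[of i]]) (use in_S in auto)
    ultimately show ?thesis using depends_Compl[OF D(2)] by blast
  qed
qed

text \<open>There are finitely many cylinders of length \<open>m\<close>. Each is treated separately
  with a share of \<open>\<alpha>\<close>, and \<open>K\<close> collects the witnesses within their
  cylinders. Removing \<open>K\<close> therefore makes every \<open>E i\<close> thin between
  \<open>m\<close> and \<open>n\<close>.\<close>

lemma thinning:
  assumes depends: "\<And>i :: nat. depends {..<b i} (E i)" and disj: "\<And>i j. i \<noteq> j \<Longrightarrow> E i \<inter> E j = {}" and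
    "0 < \<alpha>"
  shows "\<exists>n K i0. m < n \<and> (\<forall>x. \<exists>C. depends {m..<n} C \<and> \<not> small k 1 C \<and> (\<forall>z\<in>C. agree {..<m} z x \<longrightarrow>
    z \<in> K)) \<and>
    (\<forall>i\<ge>i0. small k \<alpha> (E i \<inter> K))"
proof -
  let ?R = "range (canonical m)"
  have "card ?R > 0" using finite_range_canonical by (simp add: card_gt_0_iff)
  then have "0 < \<alpha> / card ?R" using \<open>0 < \<alpha>\<close> by simp
  define Q where "Q x C n i0 \<longleftrightarrow> depends {m..<n} C \<and> \<not> small k 1 C \<and>
    (\<forall>i\<ge>i0. small k (\<alpha> / card ?R) (E i \<inter> (C \<inter> {z. agree {..<m} z x})))" for x C n i0
  have "\<forall>x. \<exists>C n i0. Q x C n i0"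
    unfolding Q_def using thinning_cylinder[where E = E, OF depends disj \<open>0 < \<alpha> / card ?R\<close>] by blast
  then obtain C n i0 where "\<And>x. Q x (C x) (n x) (i0 x)" by metis
  then have C: "\<And>x. depends {m..<n x} (C x)" "\<And>x. \<not> small k 1 (C x)"
    "\<And>x i. i0 x \<le> i \<Longrightarrow> small k (\<alpha> / card ?R) (E i \<inter> (C x \<inter> {z. agree {..<m} z x}))"
    unfolding Q_def by auto
  define N where "N = Max (insert (Suc m) (n ` ?R))"
  define I where "I = Max (i0 ` ?R)"
  define K where "K = (\<Union>x\<in>?R. C x \<inter> {z. agree {..<m} z x})"
  have N: "Suc m \<le> N" "\<And>x. x \<in> ?R \<Longrightarrow> n x \<le> N"
    unfolding N_def using finite_range_canonical[of m] by (auto intro!: Max_ge simp del: Max_insert)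
  have I: "\<And>x. x \<in> ?R \<Longrightarrow> i0 x \<le> I"
    unfolding I_def using finite_range_canonical by (auto intro!: Max_ge)
  have "\<exists>C. depends {m..<N} C \<and> \<not> small k 1 C \<and> (\<forall>z\<in>C. agree {..<m} z x \<longrightarrow> z \<in> K)" for x
  proof (intro exI[of _ "C (canonical m x)"] conjI ballI impI)
    show "depends {m..<N} (C (canonical m x))"
      using C(1)[of "canonical m x"] by (rule depends_mono) (use N(2)[of "canonical m x"] in auto)
    fix z assume "z \<in> C (canonical m x)" "agree {..<m} z x"
    moreover from this(2) have "agree {..<m} z (canonical m x)"
      using agree_canonical agree_sym agree_trans by blast
    ultimately show "z \<in> K" unfolding K_def by blast
  qed (rule C(2))
  moreover have "small k \<alpha> (E i \<inter> K)" if "I \<le> i" for i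
  proof -
    have "small k (card ?R * (\<alpha> / card ?R)) (\<Union>x\<in>?R. E i \<inter> (C x \<inter> {z. agree {..<m} z x}))"
    proof (rule small_UN[OF finite_range_canonical])
      fix x assume "x \<in> ?R"
      then have "i0 x \<le> i" using I that order_trans by blast
      then show "small k (\<alpha> / card ?R) (E i \<inter> (C x \<inter> {z. agree {..<m} z x}))" by (rule C(3))
    qed simp
    with \<open>card ?R > 0\<close> show ?thesis unfolding K_def by simp
  qed
  ultimately show ?thesis using N(1) by (intro exI[of _ N] exI[of _ K] exI[of _ I]) auto
qed

text \<open>Marked coordinates are found one after the other with \<open>thinning\<close> for the
  levels above \<open>k\<close>, until there are \<open>max_card k\<close> of them. Off the sets
  \<open>K\<close> met on the way, \<open>E i\<close> has level \<open>k\<close> and the least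
  weight \<open>1 / 2 ^ k\<close> of that level; on them it is small for large
  \<open>i\<close>.\<close>

lemma small_tail:
  assumes depends: "\<And>i :: nat. depends {..<b i} (E i)" and disj: "\<And>i j. i \<noteq> j \<Longrightarrow> E i \<inter> E j = {}" and
    "0 < \<delta>"
  shows "\<exists>i0. \<forall>i\<ge>i0. small k (1 / 2 ^ k + \<delta>) (E i)"
proof -
  define \<alpha> where "\<alpha> = \<delta> / 2 / max_card k"
  have "0 < \<alpha>" using \<open>0 < \<delta>\<close> max_card_pos by (simp add: \<alpha>_def)
  define Q where "Q m n K i0 C \<longleftrightarrow> m < n \<and> (\<forall>x. depends {m..<n} (C x) \<and> \<not> small (Suc k) 1 (C x) \<and>
    (\<forall>z\<in>C x. agree {..<m} z x \<longrightarrow> z \<in> K)) \<and> (\<forall>i\<ge>i0. small (Suc k) \<alpha> (E i \<inter> K))" for m n K i0 C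
  have "\<forall>m. \<exists>n K i0 C. Q m n K i0 C"
  proof
    fix m
    show "\<exists>n K i0 C. Q m n K i0 C"
      using thinning[where E = E and m = m and k = "Suc k", OF depends disj \<open>0 < \<alpha>\<close>]
        unfolding Q_def choice_iff by blast
  qed
  then obtain n K i0 C where "\<And>m. Q m (n m) (K m) (i0 m) (C m)" by metis
  then have n: "\<And>m. m < n m" and i0: "\<And>m i. i0 m \<le> i \<Longrightarrow> small (Suc k) \<alpha> (E i \<inter> K m)"
    and C: "\<And>m x. depends {m..<n m} (C m x)" "\<And>m x. \<not> small (Suc k) 1 (C m x)"
    "\<And>m x z. z \<in> C m x \<Longrightarrow> agree {..<m} z x \<Longrightarrow> z \<in> K m"
    unfolding Q_def by auto
  define s where "s j = (n ^^ j) 0" for j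
  have s_Suc: "s (Suc j) = n (s j)" for j by (simp add: s_def)
  have "strict_mono s" by (simp add: strict_mono_Suc_iff s_Suc n)
  then have "inj s" by (rule strict_mono_imp_inj_on)
  define I where "I = s ` {..<max_card k}"
  have I: "finite I" "I \<noteq> {}" "card I = max_card k"
    using max_card_pos[of k] card_image[OF inj_on_subset[OF \<open>inj s\<close> subset_UNIV]]
      by (auto simp: I_def)
  define L where "L = (\<Union>m\<in>I. K m)"
  have small: "small k (1 / 2 ^ k + \<delta>) (E i)" if "\<And>m. m \<in> I \<Longrightarrow> i0 m \<le> i" for i
  proof -
    \<comment> \<open>For an ultrafilter, not being small means being uncovered for almost all
      \<open>p\<close>. Only finitely many such statements can be combined, hence the restriction to
      canonical points.\<close>
    have "eventually (\<lambda>p. \<forall>m\<in>I. \<forall>x\<in>range (canonical m). \<not> covered (tower_upto p (Suc k)) 1 (C m x))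
      ultra"
      using I(1) finite_range_canonical ultra_not[OF is_ultra_ultra C(2)[unfolded small_def]]
      by (intro eventually_ball_finite ballI)
    then have "eventually (\<lambda>p. (E i - L, I, 1 / 2 ^ k)
      \<in> level k (\<lambda>C. \<not> covered (tower_upto p (Suc k)) 1 C)) ultra"
    proof eventually_elim
      case (elim p)
      have "thin (\<lambda>C. \<not> covered (tower_upto p (Suc k)) 1 C) I (E i - L)"
        unfolding thin_def
      proof (intro ballI impI allI)
        fix m m' x assume m: "m \<in> I" "m' \<in> I" "m < m'"
        then obtain j j' where "m = s j" "m' = s j'" by (auto simp: I_def)
        with m(3) have "Suc j \<le> j'" using \<open>strict_mono s\<close> by (simp add: strict_mono_less Suc_le_eq)
        then have "s (Suc j) \<le> s j'" using \<open>strict_mono s\<close> by (simp add: strict_mono_less_eq)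
        then have "n m \<le> m'" using s_Suc \<open>m = s j\<close> \<open>m' = s j'\<close> by simp
        show "\<exists>C. depends {m..<m'} C \<and> \<not> covered (tower_upto p (Suc k)) 1 C \<and>
          (\<forall>z\<in>C. agree {..<m} z x \<longrightarrow> z \<notin> E i - L)"
        proof (intro exI[of _ "C m (canonical m x)"] conjI ballI impI)
          show "depends {m..<m'} (C m (canonical m x))"
            using C(1) by (rule depends_mono) (use \<open>n m \<le> m'\<close> in auto)
          show "\<not> covered (tower_upto p (Suc k)) 1 (C m (canonical m x))" using elim m(1) by blast
          fix z assume "z \<in> C m (canonical m x)" "agree {..<m} z x"
          moreover from this(2) have "agree {..<m} z (canonical m x)"
            using agree_canonical agree_sym agree_trans by blast
          ultimately have "z \<in> K m" using C(3) by blast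
          with m(1) show "z \<notin> E i - L" by (auto simp: L_def)
        qed
      qed
      with I show ?case by (simp add: level_def wt_max_card)
    qed
    then have "small k (1 / 2 ^ k + \<delta> / 2) (E i - L)" by (rule small_of_level) (use \<open>0 < \<delta>\<close> in simp)
    moreover have "small (Suc k) (card I * \<alpha>) (\<Union>m\<in>I. E i \<inter> K m)"
      by (rule small_UN[OF I(1,2)]) (use i0 that in blast)
    then have "small (Suc k) (\<delta> / 2) (\<Union>m\<in>I. E i \<inter> K m)"
      using I(3) max_card_pos[of k] by (simp add: \<alpha>_def)
    then have "small k (\<delta> / 2) (\<Union>m\<in>I. E i \<inter> K m)" by (rule small_level) simp
    ultimately have "small k (1 / 2 ^ k + \<delta> / 2 + \<delta> / 2) ((E i - L) \<union> (\<Union>m\<in>I. E i \<inter> K m))"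
      by (rule small_Un)
    then show ?thesis by (rule small_mono) (auto simp: L_def)
  qed
  show ?thesis
  proof (intro exI allI impI)
    fix i assume i: "Max (i0 ` I) \<le> i"
    show "small k (1 / 2 ^ k + \<delta>) (E i)"
    proof (rule small)
      fix m assume "m \<in> I"
      then have "i0 m \<le> Max (i0 ` I)" using I(1) by (intro Max_ge) auto
      with i show "i0 m \<le> i" by simp
    qed
  qed
qed

section \<open>The limit submeasure as a real-valued function\<close>

definition nu :: "(nat \<Rightarrow> nat) set \<Rightarrow> real" where
  "nu E = Inf {r. small 0 r E}"

lemma small_bdd: "bdd_below {r. small k r E}"
  by (rule bdd_belowI[of _ 0]) (auto dest: small_pos)

lemma small_nonempty: "{r. small 0 r E} \<noteq> {}"
proof -
  have "small 0 (wt 0 1 + 1) UNIV"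
  proof (rule small_of_level)
    \<comment> \<open>With a single index thinness is vacuous, so the whole space has finite
      weight.\<close>
    show "eventually (\<lambda>p. (UNIV, {0}, wt 0 1) \<in> level 0 (\<lambda>C. \<not> covered (tower_upto p (Suc 0)) 1 C))
      ultra"
      using max_card_pos[of 0] by (intro always_eventually allI) (simp add: level_def thin_def
        Suc_le_eq)
  qed simp
  then have "small 0 (wt 0 1 + 1) E" by (rule small_mono) auto
  then show ?thesis by blast
qed

lemma nu_le: "small 0 r E \<Longrightarrow> nu E \<le> r"
  unfolding nu_def by (rule cInf_lower) (auto simp: small_bdd)

lemma nu_lessD: "nu E < r \<Longrightarrow> small 0 r E"
  unfolding nu_def using cInf_lessD[OF small_nonempty, of E r] small_mono by fastforce

lemma nu_nonneg: "0 \<le> nu E"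
  unfolding nu_def by (rule cInf_greatest[OF small_nonempty]) (auto dest: small_pos)

lemma nu_Un: "nu (D \<union> E) \<le> nu D + nu E"
proof (rule field_le_epsilon)
  fix e :: real assume "0 < e"
  then have "small 0 (nu D + e / 2) D" "small 0 (nu E + e / 2) E" by (auto intro: nu_lessD)
  from nu_le[OF small_Un[OF this]] show "nu (D \<union> E) \<le> nu D + nu E + e" by simp
qed

lemma nu_empty: "nu {} = 0"
proof (rule antisym[OF _ nu_nonneg], rule field_le_epsilon)
  fix e :: real assume "0 < e"
  then show "nu {} \<le> 0 + e" using nu_le[OF small_empty] by simp
qed

lemma nu_UNIV: "16 \<le> nu UNIV"
  using not_small_UNIV nu_lessD by (meson linorder_not_le)

lemma nu_exhaustive:
  assumes "\<And>i :: nat. \<exists>n. depends {..<n} (E i)" "\<And>i j. i \<noteq> j \<Longrightarrow> E i \<inter> E j = {}" "0 < \<epsilon>"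
  shows "\<exists>i0. \<forall>i\<ge>i0. nu (E i) \<le> \<epsilon>"
proof -
  have "\<forall>i. \<exists>n. depends {..<n} (E i)" using assms(1) by blast
  from choice[OF this] obtain b where b: "\<And>i. depends {..<b i} (E i)" by blast
  obtain k where k: "(1 / 2) ^ k < \<epsilon> / 2"
    using real_arch_pow_inv[of "\<epsilon> / 2" "1 / 2"] \<open>0 < \<epsilon>\<close> by auto
  obtain i0 where "\<forall>i\<ge>i0. small k (1 / 2 ^ k + \<epsilon> / 2) (E i)"
    using small_tail[where E = E and k = k and \<delta> = "\<epsilon> / 2", OF b assms(2)] \<open>0 < \<epsilon>\<close> by auto
  then have "\<forall>i\<ge>i0. nu (E i) \<le> 1 / 2 ^ k + \<epsilon> / 2"
    by (auto intro: nu_le[OF small_level])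
  with k show ?thesis by (intro exI[of _ i0]) (auto simp: power_one_over intro: order_trans)
qed

text \<open>Taking the value \<open>t n\<close> at one coordinate of \<open>I\<close> already leaves
  the set, so it is thin in the discrete sense; the maximal size of \<open>I\<close> gives the least
  weight of level \<open>k\<close>.\<close>

lemma nu_avoid:
  assumes "finite I" "card I = max_card k" "\<And>n. n \<in> I \<Longrightarrow> t n < 2 ^ n"
  shows "nu {z. \<forall>n\<in>I. z n mod 2 ^ n \<noteq> t n} \<le> 1 / 2 ^ k"
proof (rule field_le_epsilon)
  fix e :: real assume "0 < e"
  let ?E = "{z. \<forall>n\<in>I. z n mod 2 ^ n \<noteq> t n}"
  have "dthin I ?E"
    unfolding dthin_def
  proof
    fix n assume n: "n \<in> I"
    have "(\<lambda>_. t n) \<in> {z. z n mod 2 ^ n = t n}" using assms(3)[OF n] by simp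
    then show "\<exists>C. depends {n} C \<and> C \<noteq> {} \<and> C \<inter> ?E = {}"
      using n by (intro exI[of _ "{z. z n mod 2 ^ n = t n}"]) (auto simp: depends_def agree_def)
  qed
  then have "small k (1 / 2 ^ k + e) ?E"
    using assms(1,2) max_card_pos[of k] \<open>0 < e\<close>
    by (intro small_of_level[where I = I and w = "1 / 2 ^ k"] always_eventually allI) (auto simp:
      level_def wt_max_card)
  then have "small 0 (1 / 2 ^ k + e) ?E" by (rule small_level) simp
  then show "nu ?E \<le> 1 / 2 ^ k + e" by (rule nu_le)
qed

section \<open>The outer submeasure and its measurable sets\<close>

definition clopen :: "(nat \<Rightarrow> nat) set \<Rightarrow> bool" where
  "clopen E \<longleftrightarrow> (\<exists>n. depends {..<n} E)"

lemma clopen_empty [simp]: "clopen {}" and clopen_UNIV [simp]: "clopen UNIV"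
  by (auto simp: clopen_def)

lemma clopen_Compl: "clopen E \<Longrightarrow> clopen (- E)"
  unfolding clopen_def using depends_Compl by blast

lemma clopen_Un: "clopen D \<Longrightarrow> clopen E \<Longrightarrow> clopen (D \<union> E)"
proof -
  assume "clopen D" "clopen E"
  then obtain m n where "depends {..<m} D" "depends {..<n} E" unfolding clopen_def by blast
  then have "depends {..<max m n} D" "depends {..<max m n} E" by (auto elim: depends_mono)
  then show ?thesis unfolding clopen_def using depends_Un by blast
qed

lemma clopen_Diff: "clopen D \<Longrightarrow> clopen E \<Longrightarrow> clopen (D - E)"
  using clopen_Compl[OF clopen_Un[OF clopen_Compl[of D], of E]] by (simp add: Diff_eq)

lemma clopen_UN: "finite J \<Longrightarrow> (\<And>j. j \<in> J \<Longrightarrow> clopen (A j)) \<Longrightarrow> clopen (\<Union>j\<in>J. A j)"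
  by (induction J rule: finite_induct) (auto intro: clopen_Un)

lemma nu_UN: "finite J \<Longrightarrow> nu (\<Union>j\<in>J. A j) \<le> (\<Sum>j\<in>J. nu (A j))"
proof (induction J rule: finite_induct)
  case (insert j J)
  then show ?case using nu_Un[of "A j" "\<Union>j\<in>J. A j"] by simp
qed (simp add: nu_empty)

text \<open>Compactness of the product: points outside the \<open>C n\<close> converge along
  \<open>ultra\<close> coordinate by coordinate.\<close>

lemma incseq_clopen_UNIV:
  assumes "\<And>n. clopen (C n)" "incseq C" "(\<Union>n. C n) = UNIV"
  shows "\<exists>n :: nat. C n = UNIV"
proof (rule ccontr)
  assume "\<not> ?thesis"
  then have "\<forall>n. \<exists>x. x \<notin> C n" by blast
  then obtain x where x: "\<And>n. x n \<notin> C n" by metis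
  have "\<exists>s. s < 2 ^ i \<and> eventually (\<lambda>p. x p i mod 2 ^ i = s) ultra" for i
  proof -
    obtain s where "s \<in> {..<2 ^ i}" "eventually (\<lambda>p. x p i mod 2 ^ i = s) ultra"
      by (rule ultra_pigeonhole[OF is_ultra_ultra, of "{..<2 ^ i}" "\<lambda>p. x p i mod 2 ^ i"]) auto
    then show ?thesis by auto
  qed
  then obtain s where s: "\<And>i. s i < 2 ^ i" "\<And>i. eventually (\<lambda>p. x p i mod 2 ^ i = s i) ultra"
    by metis
  obtain n where n: "s \<in> C n" using assms(3) by blast
  obtain N where N: "depends {..<N} (C n)" using assms(1) unfolding clopen_def by blast
  have "eventually (\<lambda>p. \<forall>i\<in>{..<N}. x p i mod 2 ^ i = s i) ultra"
    using s(2) by (intro eventually_ball_finite) auto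
  then have "eventually (\<lambda>p. False) ultra"
    using ultra_ge[of n]
  proof eventually_elim
    case (elim p)
    have "agree {..<N} s (x p)" using elim(1) s(1) by (simp add: agree_def)
    with dependsD[OF N] n have "x p \<in> C n" by blast
    with x[of p] \<open>incseq C\<close> elim(2) show ?case by (auto simp: incseq_def)
  qed
  then show False by (simp add: ultra_const is_ultra_ultra)
qed

text \<open>Otherwise the increments along a subsequence would be disjoint clopen sets of size above
  \<open>\<epsilon>\<close>, against exhaustivity.\<close>

lemma nu_Cauchy:
  assumes "\<And>n. clopen (D n)" "incseq D" "0 < \<epsilon>"
  shows "\<exists>n :: nat. \<forall>j\<ge>n. nu (D j - D n) \<le> \<epsilon>"
proof (rule ccontr)
  assume "\<not> ?thesis"
  then have "\<forall>n. \<exists>j\<ge>n. \<epsilon> < nu (D j - D n)" by (auto simp: not_le)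
  then obtain h where h: "\<And>n. n \<le> h n" "\<And>n. \<epsilon> < nu (D (h n) - D n)" by metis
  define s where "s j = (h ^^ j) 0" for j
  have s_Suc: "s (Suc j) = h (s j)" for j by (simp add: s_def)
  have "mono s" by (rule incseq_SucI) (simp add: s_Suc h(1))
  define E where "E j = D (s (Suc j)) - D (s j)" for j
  have "E i \<inter> E j = {}" if "i < j" for i j
  proof -
    have "s (Suc i) \<le> s j" using \<open>mono s\<close> that by (simp add: monoD)
    then have "D (s (Suc i)) \<subseteq> D (s j)" using \<open>incseq D\<close> by (simp add: incseq_def)
    then show ?thesis unfolding E_def by blast
  qed
  then have "E i \<inter> E j = {}" if "i \<noteq> j" for i j
    using that by (metis Int_commute linorder_neqE_nat)
  moreover have "\<exists>n. depends {..<n} (E i)" for i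
    using clopen_Diff assms(1) unfolding E_def clopen_def by blast
  ultimately obtain i0 where "\<forall>i\<ge>i0. nu (E i) \<le> \<epsilon>"
    using nu_exhaustive[of E, OF _ _ \<open>0 < \<epsilon>\<close>] by blast
  with h(2)[of "s i0"] show False by (auto simp: E_def s_Suc)
qed

text \<open>The bound is on the submeasure of every stage, not on a sum of values: exhaustivity
  makes the tail of an increasing sequence small as a whole, but the values of its increments need
  not be summable.\<close>

definition covseq :: "(nat \<Rightarrow> (nat \<Rightarrow> nat) set) \<Rightarrow> real \<Rightarrow> (nat \<Rightarrow> nat) set \<Rightarrow> bool" where
  "covseq C r X \<longleftrightarrow> (\<forall>n. clopen (C n)) \<and> incseq C \<and> (\<forall>n. nu (C n) \<le> r) \<and> X \<subseteq> (\<Union>n. C n)"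

definition outer :: "(nat \<Rightarrow> nat) set \<Rightarrow> real" where
  "outer X = Inf {r. \<exists>C. covseq C r X}"

lemma covseq_nonneg: "covseq C r X \<Longrightarrow> 0 \<le> r"
  unfolding covseq_def using nu_nonneg order_trans by blast

lemma outer_le: "covseq C r X \<Longrightarrow> outer X \<le> r"
  unfolding outer_def by (rule cInf_lower) (auto intro!: bdd_belowI[of _ 0] dest: covseq_nonneg)

lemma covseq_const: "clopen E \<Longrightarrow> X \<subseteq> E \<Longrightarrow> covseq (\<lambda>_. E) (nu E) X"
  by (auto simp: covseq_def)

lemma covseq_ex: "{r. \<exists>C. covseq C r X} \<noteq> {}"
  using covseq_const[of UNIV X] by auto

lemma outer_lessD: "outer X < r \<Longrightarrow> \<exists>C. covseq C r X"
proof -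
  assume "outer X < r"
  then obtain r' C where "r' < r" "covseq C r' X"
    unfolding outer_def using cInf_lessD[OF covseq_ex] by blast
  then have "covseq C r X" unfolding covseq_def by (auto intro: order_trans less_imp_le)
  then show "\<exists>C. covseq C r X" by blast
qed

lemma outer_nonneg: "0 \<le> outer X"
  unfolding outer_def by (rule cInf_greatest[OF covseq_ex]) (auto dest: covseq_nonneg)

lemma outer_le_nu: "clopen E \<Longrightarrow> outer E \<le> nu E"
  by (rule outer_le, rule covseq_const) auto

lemma outer_empty: "outer {} = 0"
  using outer_le_nu[of "{}"] outer_nonneg[of "{}"] by (simp add: nu_empty)

lemma outer_mono: "X \<subseteq> Y \<Longrightarrow> outer X \<le> outer Y"
proof (rule field_le_epsilon)
  fix e :: real assume "X \<subseteq> Y" "0 < e"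
  then obtain C where "covseq C (outer Y + e) Y" using outer_lessD[of Y "outer Y + e"] by auto
  with \<open>X \<subseteq> Y\<close> have "covseq C (outer Y + e) X" by (auto simp: covseq_def)
  then show "outer X \<le> outer Y + e" by (rule outer_le)
qed

lemma sum_half_powers: "(\<Sum>n\<le>j. e / 2 ^ n) \<le> 2 * (e :: real)" if "0 \<le> e" for j :: nat
proof -
  have "(\<Sum>n\<le>j. e / 2 ^ n) = 2 * e - e / 2 ^ j"
    by (induction j) (auto simp: field_simps)
  with that show ?thesis by simp
qed

lemma outer_UN:
  assumes "\<And>n. outer (Y n) \<le> e / 2 ^ n"
  shows "outer (\<Union>n. Y n) \<le> 2 * e"
proof (rule field_le_epsilon)
  fix \<delta> :: real assume "0 < \<delta>"
  have "0 \<le> e" using assms[of 0] outer_nonneg[of "Y 0"] by simp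
  have "\<exists>C. covseq C ((e + \<delta> / 2) / 2 ^ n) (Y n)" for n
  proof (rule outer_lessD)
    have "e / 2 ^ n < (e + \<delta> / 2) / 2 ^ n" using \<open>0 < \<delta>\<close> by (intro divide_strict_right_mono) auto
    with assms[of n] show "outer (Y n) < (e + \<delta> / 2) / 2 ^ n" by simp
  qed
  then obtain C where C: "\<And>n. covseq (C n) ((e + \<delta> / 2) / 2 ^ n) (Y n)" by metis
  \<comment> \<open>Diagonal unions are finite, hence clopen, and still exhaust every cover.\<close>
  define D where "D j = (\<Union>n\<le>j. C n j)" for j
  have "covseq D (2 * (e + \<delta> / 2)) (\<Union>n. Y n)"
    unfolding covseq_def
  proof (intro conjI allI)
    fix j
    show "clopen (D j)" unfolding D_def using C by (intro clopen_UN) (auto simp: covseq_def)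
    have "nu (D j) \<le> (\<Sum>n\<le>j. nu (C n j))" unfolding D_def by (rule nu_UN) simp
    also have "\<dots> \<le> (\<Sum>n\<le>j. (e + \<delta> / 2) / 2 ^ n)" using C by (intro sum_mono) (auto simp: covseq_def)
    also have "\<dots> \<le> 2 * (e + \<delta> / 2)" using \<open>0 \<le> e\<close> \<open>0 < \<delta>\<close> by (intro sum_half_powers) auto
    finally show "nu (D j) \<le> 2 * (e + \<delta> / 2)" .
  next
    have inc: "C n i \<subseteq> C n j" if "i \<le> j" for n i j using C that by (simp add: covseq_def incseq_def)
    show "incseq D"
    proof (rule incseq_SucI)
      fix j
      show "D j \<subseteq> D (Suc j)" unfolding D_def using inc[of j "Suc j"] by fastforce
    qed
    show "(\<Union>n. Y n) \<subseteq> (\<Union>n. D n)"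
    proof
      fix z assume "z \<in> (\<Union>n. Y n)"
      then obtain n where "z \<in> Y n" by blast
      with C[of n] obtain i where "z \<in> C n i" by (auto simp: covseq_def)
      with inc[of i "max n i"] have "z \<in> C n (max n i)" by auto
      then have "z \<in> D (max n i)" unfolding D_def by auto
      then show "z \<in> (\<Union>n. D n)" by blast
    qed
  qed
  from outer_le[OF this] show "outer (\<Union>n. Y n) \<le> 2 * e + \<delta>" by simp
qed

lemma outer_UN_null: "(\<And>n. outer (Y n) = 0) \<Longrightarrow> outer (\<Union>n. Y n) = 0" for Y :: "nat \<Rightarrow> _"
  using outer_UN[of Y 0] outer_nonneg[of "\<Union>n. Y n"] by simp

lemma outer_UN_countable_null:
  assumes "countable J" "\<And>j. j \<in> J \<Longrightarrow> outer (Y j) = 0"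
  shows "outer (\<Union>j\<in>J. Y j) = 0"
proof (cases "J = {}")
  case False
  then have "(\<Union>j\<in>J. Y j) = (\<Union>n. Y (from_nat_into J n))"
    using assms(1) by (metis UN_extend_simps(10) range_from_nat_into)
  also have "outer \<dots> = 0"
    by (rule outer_UN_null) (use assms(2) from_nat_into[OF False] in blast)
  finally show ?thesis .
qed (simp add: outer_empty)

lemma outer_Un: "outer (X \<union> Y) \<le> outer X + outer Y"
proof (rule field_le_epsilon)
  fix e :: real assume "0 < e"
  then obtain C D where C: "covseq C (outer X + e / 2) X" and D: "covseq D (outer Y + e / 2) Y"
    using outer_lessD[of X "outer X + e / 2"] outer_lessD[of Y "outer Y + e / 2"] by auto
  have "covseq (\<lambda>n. C n \<union> D n) (outer X + e / 2 + (outer Y + e / 2)) (X \<union> Y)"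
    unfolding covseq_def
  proof (intro conjI allI)
    fix n
    show "clopen (C n \<union> D n)" using C D by (auto simp: covseq_def intro: clopen_Un)
    have "nu (C n) \<le> outer X + e / 2" "nu (D n) \<le> outer Y + e / 2" using C D
      by (auto simp: covseq_def)
    with nu_Un[of "C n" "D n"] show "nu (C n \<union> D n) \<le> outer X + e / 2 + (outer Y + e / 2)"
      by linarith
  next
    have "incseq C" "incseq D" using C D by (auto simp: covseq_def)
    then show "incseq (\<lambda>n. C n \<union> D n)" unfolding incseq_def by (meson Un_mono)
  qed (use C D in \<open>auto simp: covseq_def\<close>)
  from outer_le[OF this] show "outer (X \<union> Y) \<le> outer X + outer Y + e" by simp
qed

lemma outer_subadd: "Z \<subseteq> X \<union> Y \<Longrightarrow> outer Z \<le> outer X + outer Y"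
  by (rule order_trans[OF outer_mono outer_Un])

text \<open>By compactness an increasing clopen cover of the space reaches it at a finite stage, so
  no mass is lost in passing from \<open>nu\<close> to \<open>outer\<close>.\<close>

lemma outer_UNIV: "16 \<le> outer UNIV"
proof (rule ccontr)
  assume "\<not> 16 \<le> outer UNIV"
  then obtain r where "outer UNIV < r" "r < 16" using dense[of "outer UNIV" 16] by auto
  then obtain C where C: "covseq C r UNIV" using outer_lessD by blast
  then have C': "\<And>n. clopen (C n)" "incseq C" "\<And>n. nu (C n) \<le> r" "(\<Union>n. C n) = UNIV"
    unfolding covseq_def by auto
  from incseq_clopen_UNIV[OF C'(1,2,4)] obtain n where "C n = UNIV" ..
  with C'(3)[of n] have "nu UNIV \<le> r" by simp
  with nu_UNIV \<open>r < 16\<close> show False by simp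
qed

section \<open>Completion of the clopen algebra\<close>

definition sym_diff :: "'a set \<Rightarrow> 'a set \<Rightarrow> 'a set" where
  "sym_diff A B = (A - B) \<union> (B - A)"

text \<open>The closure of the clopen sets in the pseudometric
  \<open>outer (sym_diff X Y)\<close>.\<close>

definition nu_measurable :: "(nat \<Rightarrow> nat) set \<Rightarrow> bool" where
  "nu_measurable X \<longleftrightarrow> (\<forall>e>0. \<exists>C. clopen C \<and> outer (sym_diff X C) < e)"

lemma nu_measurable_clopen: "clopen E \<Longrightarrow> nu_measurable E"
  unfolding nu_measurable_def by (intro allI impI exI[of _ E]) (auto simp: sym_diff_def outer_empty)

lemma nu_measurable_empty [simp]: "nu_measurable {}" and nu_measurable_UNIV [simp]:
  "nu_measurable UNIV"
  by (simp_all add: nu_measurable_clopen)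

lemma nu_measurable_Compl: "nu_measurable X \<Longrightarrow> nu_measurable (- X)"
  unfolding nu_measurable_def
proof (intro allI impI)
  fix e :: real assume "\<forall>e>0. \<exists>C. clopen C \<and> outer (sym_diff X C) < e" "0 < e"
  then obtain C where "clopen C" "outer (sym_diff X C) < e" by blast
  moreover have "sym_diff (- X) (- C) = sym_diff X C" by (auto simp: sym_diff_def)
  ultimately show "\<exists>C. clopen C \<and> outer (sym_diff (- X) C) < e"
    using clopen_Compl by (intro exI[of _ "- C"]) auto
qed

lemma nu_measurable_Un: "nu_measurable X \<Longrightarrow> nu_measurable Y \<Longrightarrow> nu_measurable (X \<union> Y)"
  unfolding nu_measurable_def
proof (intro allI impI)
  fix e :: real
  assume X: "\<forall>e>0. \<exists>C. clopen C \<and> outer (sym_diff X C) < e" and Y: "\<forall>e>0. \<exists>C. clopen C \<and>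
    outer (sym_diff Y C) < e"
    and "0 < e"
  then have "0 < e / 2" by simp
  with X Y obtain C D where "clopen C" "outer (sym_diff X C) < e / 2" "clopen D"
    "outer (sym_diff Y D) < e / 2" by meson
  moreover have "outer (sym_diff (X \<union> Y) (C \<union> D)) \<le> outer (sym_diff X C) + outer (sym_diff Y D)"
    by (rule outer_subadd) (auto simp: sym_diff_def)
  ultimately show "\<exists>C. clopen C \<and> outer (sym_diff (X \<union> Y) C) < e"
    using clopen_Un by (intro exI[of _ "C \<union> D"]) auto
qed

lemma nu_measurable_Int: "nu_measurable X \<Longrightarrow> nu_measurable Y \<Longrightarrow> nu_measurable (X \<inter> Y)"
  using nu_measurable_Compl[OF nu_measurable_Un[OF nu_measurable_Compl nu_measurable_Compl], of X Y]
    by simp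

lemma nu_measurable_Diff: "nu_measurable X \<Longrightarrow> nu_measurable Y \<Longrightarrow> nu_measurable (X - Y)"
  by (simp add: Diff_eq nu_measurable_Int nu_measurable_Compl)

lemma nu_measurable_UN_finite: "finite J \<Longrightarrow> (\<And>j. j \<in> J \<Longrightarrow> nu_measurable (X j)) \<Longrightarrow>
  nu_measurable (\<Union>j\<in>J. X j)"
  by (induction J rule: finite_induct) (auto intro: nu_measurable_Un)

text \<open>Exhaustivity yields closure under countable unions: clopen approximations with errors
  \<open>e / 2 ^ i\<close> have finite unions \<open>D n\<close> that grow by at most
  \<open>e\<close> from some \<open>n\<close> on, so one of them approximates the union. For the
  second part, a point of the union outside \<open>X n\<close> lies in an error set if it is in
  \<open>D n\<close>, and otherwise in an error set or in the tail.\<close>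

lemma nu_measurable_incseq:
  assumes X: "\<And>n. nu_measurable (X n)" "incseq X"
  shows "nu_measurable (\<Union>n. X n) \<and> (\<forall>e>0. \<exists>n. outer ((\<Union>n. X n) - X n) < e)"
proof -
  have key: "\<exists>D n. clopen D \<and> outer (sym_diff (\<Union>n. X n) D) < \<epsilon> \<and> outer ((\<Union>n. X n) - X n) < \<epsilon>"
    if "0 < \<epsilon>" for \<epsilon>
  proof -
    define e where "e = \<epsilon> / 4"
    have "0 < e" using that by (simp add: e_def)
    then have "\<exists>C. clopen C \<and> outer (sym_diff (X i) C) < e / 2 ^ i" for i
      using X(1)[of i] unfolding nu_measurable_def by auto
    then obtain C where C: "\<And>i. clopen (C i)" "\<And>i. outer (sym_diff (X i) (C i)) < e / 2 ^ i"
      by metis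
    define S where "S = (\<Union>i. sym_diff (X i) (C i))"
    have S: "outer S \<le> 2 * e" unfolding S_def by (rule outer_UN) (use C(2) less_imp_le in blast)
    define D where "D n = (\<Union>i\<le>n. C i)" for n
    have D: "clopen (D n)" for n unfolding D_def using C(1) by (intro clopen_UN) auto
    have "incseq D" unfolding D_def by (rule incseq_SucI) (intro UN_mono, auto)
    obtain n where n: "\<And>j. n \<le> j \<Longrightarrow> nu (D j - D n) \<le> e"
      using nu_Cauchy[OF D \<open>incseq D\<close> \<open>0 < e\<close>] by blast
    have "covseq (\<lambda>j. D (n + j) - D n) e ((\<Union>j. D j) - D n)"
      unfolding covseq_def
    proof (intro conjI allI)
      show "incseq (\<lambda>j. D (n + j) - D n)"
      proof (rule incseq_SucI)
        fix j show "D (n + j) - D n \<subseteq> D (n + Suc j) - D n"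
          using \<open>incseq D\<close> by (auto simp: incseq_Suc_iff)
      qed
      show "(\<Union>j. D j) - D n \<subseteq> (\<Union>j. D (n + j) - D n)"
      proof
        fix z assume "z \<in> (\<Union>j. D j) - D n"
        then obtain j where "z \<in> D j" "z \<notin> D n" by blast
        moreover have "D j \<subseteq> D (n + j)" using \<open>incseq D\<close> by (simp add: incseq_def)
        ultimately show "z \<in> (\<Union>j. D (n + j) - D n)" by blast
      qed
    qed (use D n in \<open>auto intro: clopen_Diff\<close>)
    then have tail: "outer ((\<Union>j. D j) - D n) \<le> e" by (rule outer_le)
    have C_D: "C i \<subseteq> (\<Union>j. D j)" for i by (auto simp: D_def)
    have "outer (sym_diff (\<Union>n. X n) (D n)) \<le> outer S + outer ((\<Union>j. D j) - D n)"
    proof (rule outer_subadd, rule subsetI)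
      fix z assume "z \<in> sym_diff (\<Union>n. X n) (D n)"
      then consider i where "z \<in> X i" "z \<notin> D n" | i where "z \<in> C i" "z \<notin> X i"
        unfolding sym_diff_def D_def by blast
      then show "z \<in> S \<union> ((\<Union>j. D j) - D n)"
      proof cases
        case 1
        then show ?thesis using C_D[of i] unfolding S_def sym_diff_def by blast
      next
        case 2
        then show ?thesis unfolding S_def sym_diff_def by blast
      qed
    qed
    moreover have "outer ((\<Union>n. X n) - X n) \<le> outer S + outer ((\<Union>j. D j) - D n)"
    proof (rule outer_subadd, rule subsetI)
      fix z assume "z \<in> (\<Union>n. X n) - X n"
      then obtain i where i: "z \<in> X i" "z \<notin> X n" by blast
      show "z \<in> S \<union> ((\<Union>j. D j) - D n)"
      proof (cases "z \<in> D n")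
        case True
        then obtain i' where i': "i' \<le> n" "z \<in> C i'" unfolding D_def by blast
        have "X i' \<subseteq> X n" using X(2) i'(1) by (simp add: incseq_def)
        with i(2) i'(2) show ?thesis unfolding S_def sym_diff_def by blast
      next
        case False
        then show ?thesis using i C_D[of i] unfolding S_def sym_diff_def by blast
      qed
    qed
    ultimately show ?thesis
      using D[of n] S tail \<open>0 < e\<close> by (intro exI[of _ "D n"] exI[of _ n]) (auto simp: e_def)
  qed
  then show ?thesis unfolding nu_measurable_def by meson
qed

lemma nu_measurable_UN:
  assumes "\<And>n :: nat. nu_measurable (X n)"
  shows "nu_measurable (\<Union>n. X n)" and "0 < e \<Longrightarrow> \<exists>n. outer ((\<Union>n. X n) - (\<Union>i\<le>n. X i)) < e"
proof -
  have "incseq (\<lambda>n. \<Union>i\<le>n. X i)" by (rule incseq_SucI, rule UN_mono) auto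
  moreover have "nu_measurable (\<Union>i\<le>n. X i)" for n using assms
    by (intro nu_measurable_UN_finite) auto
  ultimately have "nu_measurable (\<Union>n. \<Union>i\<le>n. X i) \<and> (\<forall>e>0. \<exists>n. outer ((\<Union>n. \<Union>i\<le>n. X i) - (\<Union>i\<le>n. X i))
    < e)"
    by (intro nu_measurable_incseq)
  moreover have "(\<Union>n. \<Union>i\<le>n. X i) = (\<Union>n. X n)" by auto
  ultimately show "nu_measurable (\<Union>n. X n)" "0 < e \<Longrightarrow> \<exists>n. outer ((\<Union>n. X n) - (\<Union>i\<le>n. X i)) < e"
    by auto
qed

lemma nu_measurable_UN_countable:
  assumes "countable J" "\<And>j. j \<in> J \<Longrightarrow> nu_measurable (X j)"
  shows "nu_measurable (\<Union>j\<in>J. X j)"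
proof (cases "J = {}")
  case False
  then have "(\<Union>j\<in>J. X j) = (\<Union>n. X (from_nat_into J n))"
    using assms(1) by (metis UN_extend_simps(10) range_from_nat_into)
  moreover have "nu_measurable (\<Union>n. X (from_nat_into J n))"
    by (rule nu_measurable_UN) (use assms(2) from_nat_into[OF False] in blast)
  ultimately show ?thesis by simp
qed simp

lemma outer_disjoint:
  assumes "\<And>n :: nat. nu_measurable (X n)" "\<And>i j. i < j \<Longrightarrow> X i \<inter> X j = {}" "0 < e"
  shows "\<exists>n. outer (X n) < e"
proof -
  obtain n where n: "outer ((\<Union>n. X n) - (\<Union>i\<le>n. X i)) < e"
    using nu_measurable_UN(2)[where X = X, OF assms(1,3)] by blast
  have "X (Suc n) \<subseteq> (\<Union>n. X n) - (\<Union>i\<le>n. X i)"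
    using assms(2)[of _ "Suc n"] by (auto simp: less_Suc_eq_le)
  from order_le_less_trans[OF outer_mono[OF this] n] show ?thesis by blast
qed

section \<open>The quotient algebra\<close>

definition null_class :: "(nat \<Rightarrow> nat) set \<Rightarrow> algebra_element" where
  "null_class X = {Y. nu_measurable Y \<and> outer (sym_diff X Y) = 0}"

text \<open>The order asks for some pair of representatives; by \<open>le_null_class\<close> every
  pair serves.\<close>

definition nu_algebra :: "algebra_element gorder" where
  "nu_algebra = \<lparr>carrier = null_class ` Collect nu_measurable, eq = (=),
    le = (\<lambda>a b. \<exists>X Y. nu_measurable X \<and> nu_measurable Y \<and> a = null_class X \<and> b = null_class Y \<and>
      outer (X - Y) = 0)\<rparr>"

lemma outer_zeroI: "outer X \<le> 0 \<Longrightarrow> outer X = 0"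
  using outer_nonneg[of X] by simp

lemma outer_null_subset: "Z \<subseteq> X \<union> Y \<Longrightarrow> outer X = 0 \<Longrightarrow> outer Y = 0 \<Longrightarrow> outer Z = 0"
  using outer_subadd[of Z X Y] by (intro outer_zeroI) simp

lemma outer_null_mono: "Z \<subseteq> X \<Longrightarrow> outer X = 0 \<Longrightarrow> outer Z = 0"
  using outer_null_subset[of Z X X] by simp

lemma null_class_eq_iff:
  assumes "nu_measurable X" "nu_measurable Y"
  shows "null_class X = null_class Y \<longleftrightarrow> outer (X - Y) = 0 \<and> outer (Y - X) = 0"
proof
  assume "null_class X = null_class Y"
  moreover have "Y \<in> null_class Y" using assms
    by (simp add: null_class_def sym_diff_def outer_empty)
  ultimately have "outer (sym_diff X Y) = 0" by (auto simp: null_class_def)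
  moreover have "X - Y \<subseteq> sym_diff X Y" "Y - X \<subseteq> sym_diff X Y" by (auto simp: sym_diff_def)
  ultimately show "outer (X - Y) = 0 \<and> outer (Y - X) = 0" using outer_null_mono by blast
next
  assume XY: "outer (X - Y) = 0 \<and> outer (Y - X) = 0"
  have "outer (sym_diff X Z) = 0 \<longleftrightarrow> outer (sym_diff Y Z) = 0" for Z
  proof
    have Y: "outer (sym_diff X Y) = 0"
      using XY by (intro outer_null_subset[of "sym_diff X Y" "X - Y"
        "Y - X"]) (simp_all add: sym_diff_def)
    show "outer (sym_diff Y Z) = 0" if "outer (sym_diff X Z) = 0"
      by (rule outer_null_subset[OF _ Y that]) (auto simp: sym_diff_def)
    show "outer (sym_diff X Z) = 0" if "outer (sym_diff Y Z) = 0"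
      by (rule outer_null_subset[OF _ Y that]) (auto simp: sym_diff_def)
  qed
  then show "null_class X = null_class Y" by (simp add: null_class_def)
qed

lemma carrier_nu_algebra: "carrier nu_algebra = null_class ` Collect nu_measurable"
  by (simp add: nu_algebra_def)

lemma null_class_carrier [simp]: "nu_measurable X \<Longrightarrow> null_class X \<in> carrier nu_algebra"
  by (simp add: carrier_nu_algebra)

lemma carrierE:
  assumes "a \<in> carrier nu_algebra"
  obtains X where "nu_measurable X" "a = null_class X"
  using assms by (auto simp: carrier_nu_algebra)

lemma le_null_class:
  assumes "nu_measurable X" "nu_measurable Y"
  shows "null_class X \<sqsubseteq>\<^bsub>nu_algebra\<^esub> null_class Y \<longleftrightarrow> outer (X - Y) = 0"
proof
  assume "null_class X \<sqsubseteq>\<^bsub>nu_algebra\<^esub> null_class Y"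
  then obtain X' Y' where *: "nu_measurable X'" "nu_measurable Y'" "null_class X = null_class X'"
    "null_class Y = null_class Y'" "outer (X' - Y') = 0"
    by (auto simp: nu_algebra_def)
  then have "outer (X - X') = 0" "outer (Y' - Y) = 0"
    using null_class_eq_iff assms by auto
  then have "outer ((X - X') \<union> (X' - Y')) = 0" "outer (Y' - Y) = 0"
    using *(5) outer_null_subset by blast+
  then show "outer (X - Y) = 0"
    by (rule outer_null_subset[rotated]) auto
next
  assume "outer (X - Y) = 0"
  then show "null_class X \<sqsubseteq>\<^bsub>nu_algebra\<^esub> null_class Y" using assms by (auto simp: nu_algebra_def)
qed

lemma le_null_class_subset: "nu_measurable X \<Longrightarrow> nu_measurable Y \<Longrightarrow> X \<subseteq> Y \<Longrightarrow>
  null_class X \<sqsubseteq>\<^bsub>nu_algebra\<^esub> null_class Y"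
  by (simp add: le_null_class Diff_eq_empty_iff[THEN iffD2] outer_empty)

lemma partial_order_nu_algebra: "partial_order nu_algebra"
proof
  fix a b c d
  show "a \<in> carrier nu_algebra \<Longrightarrow> a \<sqsubseteq>\<^bsub>nu_algebra\<^esub> a"
    by (elim carrierE) (simp add: le_null_class outer_empty)
  show "a .=\<^bsub>nu_algebra\<^esub> b" if *: "a \<sqsubseteq>\<^bsub>nu_algebra\<^esub> b" "b \<sqsubseteq>\<^bsub>nu_algebra\<^esub> a" "a \<in> carrier nu_algebra"
    "b \<in> carrier nu_algebra"
  proof -
    obtain X Y where "nu_measurable X" "a = null_class X" "nu_measurable Y" "b = null_class Y"
      using * unfolding carrier_nu_algebra by blast
    with * have "a = b" by (simp add: le_null_class null_class_eq_iff)
    then show ?thesis by (simp add: nu_algebra_def)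
  qed
  show "a \<sqsubseteq>\<^bsub>nu_algebra\<^esub> c" if *: "a \<sqsubseteq>\<^bsub>nu_algebra\<^esub> b" "b \<sqsubseteq>\<^bsub>nu_algebra\<^esub> c" "a \<in> carrier nu_algebra"
    "b \<in> carrier nu_algebra" "c \<in> carrier nu_algebra"
  proof -
    obtain X Y Z where "nu_measurable X" "a = null_class X" "nu_measurable Y" "b = null_class Y"
      "nu_measurable Z" "c = null_class Z"
      using * unfolding carrier_nu_algebra by blast
    moreover from this * have "outer (X - Y) = 0" "outer (Y - Z) = 0"
      by (simp_all add: le_null_class)
    then have "outer (X - Z) = 0" by (rule outer_null_subset[rotated]) auto
    ultimately show ?thesis by (simp add: le_null_class)
  qed
qed (simp_all add: nu_algebra_def)

interpretation nu_algebra: partial_order nu_algebra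
  by (rule partial_order_nu_algebra)

text \<open>Countable joins are unions of representatives because countable unions of null sets are
  null.\<close>

lemma lub_null_class:
  assumes "countable J" "\<And>j. j \<in> J \<Longrightarrow> nu_measurable (X j)"
  shows "is_lub nu_algebra (null_class (\<Union>j\<in>J. X j)) ((\<lambda>j. null_class (X j)) ` J)"
proof (rule least_UpperI)
  have U: "nu_measurable (\<Union>j\<in>J. X j)" using assms by (rule nu_measurable_UN_countable)
  then show "null_class (\<Union>j\<in>J. X j) \<in> carrier nu_algebra" by simp
  show "(\<lambda>j. null_class (X j)) ` J \<subseteq> carrier nu_algebra" using assms(2) by auto
  show "a \<sqsubseteq>\<^bsub>nu_algebra\<^esub> null_class (\<Union>j\<in>J. X j)" if "a \<in> (\<lambda>j. null_class (X j)) ` J" for a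
  proof -
    from that obtain j where j: "j \<in> J" "a = null_class (X j)" by blast
    show ?thesis unfolding j(2) by (rule le_null_class_subset[OF assms(2)[OF j(1)] U]) (use j(1) in
      blast)
  qed
  fix b assume b: "b \<in> Upper nu_algebra ((\<lambda>j. null_class (X j)) ` J)"
  then have "b \<in> carrier nu_algebra" by (simp add: Upper_def)
  then obtain Y where Y: "nu_measurable Y" "b = null_class Y" by (rule carrierE)
  have "outer (X j - Y) = 0" if "j \<in> J" for j
  proof -
    have "null_class (X j) \<in> (\<lambda>j. null_class (X j)) ` J \<inter> carrier nu_algebra" using that assms(2)
      by simp
    with b have "null_class (X j) \<sqsubseteq>\<^bsub>nu_algebra\<^esub> b" unfolding Upper_def by blast
    then show ?thesis by (simp only: Y(2) le_null_class[OF assms(2)[OF that] Y(1)])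
  qed
  then have "outer (\<Union>j\<in>J. X j - Y) = 0" by (rule outer_UN_countable_null[OF assms(1)])
  then have "outer ((\<Union>j\<in>J. X j) - Y) = 0" by (rule outer_null_mono[rotated]) blast
  then show "null_class (\<Union>j\<in>J. X j) \<sqsubseteq>\<^bsub>nu_algebra\<^esub> b" using Y U by (simp add: le_null_class)
qed

lemma lub_null_class_Un: "nu_measurable X \<Longrightarrow> nu_measurable Y \<Longrightarrow>
  is_lub nu_algebra (null_class (X \<union> Y)) {null_class X, null_class Y}"
  using lub_null_class[of "{X, Y}" "\<lambda>x. x"] by auto

lemma glb_null_class_Int:
  assumes "nu_measurable X" "nu_measurable Y"
  shows "is_glb nu_algebra (null_class (X \<inter> Y)) {null_class X, null_class Y}"
proof (rule greatest_LowerI)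
  have I: "nu_measurable (X \<inter> Y)" using assms by (rule nu_measurable_Int)
  then show "null_class (X \<inter> Y) \<in> carrier nu_algebra" by simp
  show "{null_class X, null_class Y} \<subseteq> carrier nu_algebra" using assms by simp
  show "null_class (X \<inter> Y) \<sqsubseteq>\<^bsub>nu_algebra\<^esub> a" if "a \<in> {null_class X, null_class Y}" for a
    using that assms I by (auto intro!: le_null_class_subset)
  fix b assume b: "b \<in> Lower nu_algebra {null_class X, null_class Y}"
  then have "b \<in> carrier nu_algebra" by (simp add: Lower_def)
  then obtain Z where Z: "nu_measurable Z" "b = null_class Z" by (rule carrierE)
  have "outer (Z - X) = 0" "outer (Z - Y) = 0"
    using b assms Z by (auto simp: Lower_def le_null_class)
  then have "outer (Z - X \<inter> Y) = 0" by (rule outer_null_subset[rotated]) auto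
  then show "b \<sqsubseteq>\<^bsub>nu_algebra\<^esub> null_class (X \<inter> Y)" using Z I by (simp add: le_null_class)
qed

lemma bounded_lattice_nu_algebra: "bounded_lattice nu_algebra"
proof
  fix a b assume ab: "a \<in> carrier nu_algebra" "b \<in> carrier nu_algebra"
  then obtain X Y where XY: "nu_measurable X" "a = null_class X" "nu_measurable Y"
    "b = null_class Y" unfolding carrier_nu_algebra by blast
  then show "\<exists>s. is_lub nu_algebra s {a, b}" "\<exists>s. is_glb nu_algebra s {a, b}"
    using lub_null_class_Un glb_null_class_Int by blast+
next
  show "\<exists>a. least nu_algebra a (carrier nu_algebra)"
    by (rule exI[of _ "null_class {}"]) (auto simp: least_def le_null_class outer_empty elim!:
      carrierE)
  show "\<exists>a. greatest nu_algebra a (carrier nu_algebra)"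
    by (rule exI[of _ "null_class UNIV"]) (auto simp: greatest_def le_null_class outer_empty elim!:
      carrierE)
qed

interpretation nu_algebra: bounded_lattice nu_algebra
  by (rule bounded_lattice_nu_algebra)

lemma sup_eqI: "is_lub nu_algebra s A \<Longrightarrow> \<Squnion>\<^bsub>nu_algebra\<^esub> A = s"
  unfolding sup_def by (rule some_equality) (assumption, erule (1) nu_algebra.least_unique)

lemma inf_eqI: "is_glb nu_algebra s A \<Longrightarrow> \<Sqinter>\<^bsub>nu_algebra\<^esub> A = s"
  unfolding inf_def by (rule some_equality) (assumption, erule (1) nu_algebra.greatest_unique)

lemma join_null_class: "nu_measurable X \<Longrightarrow> nu_measurable Y \<Longrightarrow> null_class X \<squnion>\<^bsub>nu_algebra\<^esub> null_class Y
  = null_class (X \<union> Y)"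
  unfolding join_def by (rule sup_eqI) (rule lub_null_class_Un)

lemma meet_null_class: "nu_measurable X \<Longrightarrow> nu_measurable Y \<Longrightarrow> null_class X \<sqinter>\<^bsub>nu_algebra\<^esub> null_class Y
  = null_class (X \<inter> Y)"
  unfolding meet_def by (rule inf_eqI) (rule glb_null_class_Int)

lemma bottom_null_class: "\<bottom>\<^bsub>nu_algebra\<^esub> = null_class {}"
  by (rule nu_algebra.bottom_eq[symmetric]) (auto simp: le_null_class outer_empty elim!: carrierE)

lemma top_null_class: "\<top>\<^bsub>nu_algebra\<^esub> = null_class UNIV"
  by (rule nu_algebra.top_eq[symmetric]) (auto simp: le_null_class outer_empty elim!: carrierE)

lemma null_class_bottom_iff: "nu_measurable X \<Longrightarrow> null_class X = \<bottom>\<^bsub>nu_algebra\<^esub> \<longleftrightarrow> outer X = 0"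
  by (simp add: bottom_null_class null_class_eq_iff outer_empty)

definition representative :: "algebra_element \<Rightarrow> (nat \<Rightarrow> nat) set" where
  "representative a = (SOME X. nu_measurable X \<and> a = null_class X)"

lemma representative: "a \<in> carrier nu_algebra \<Longrightarrow> nu_measurable (representative a)"
  "a \<in> carrier nu_algebra \<Longrightarrow> null_class (representative a) = a"
proof -
  assume "a \<in> carrier nu_algebra"
  then have "\<exists>X. nu_measurable X \<and> a = null_class X" by (elim carrierE) blast
  from someI_ex[OF this] show "nu_measurable (representative a)" "null_class (representative a) = a"
    by (simp_all add: representative_def)
qed

lemma lub_representative:
  assumes "S \<subseteq> carrier nu_algebra" "countable S"
  shows "is_lub nu_algebra (null_class (\<Union>a\<in>S. representative a)) S"
proof -
  have "is_lub nu_algebra (null_class (\<Union>a\<in>S. representative a)) ((\<lambda>a. null_class (representative a))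
    ` S)"
    by (rule lub_null_class[OF assms(2)]) (use assms(1) representative in blast)
  moreover have "(\<lambda>a. null_class (representative a)) ` S = (\<lambda>a. a) ` S"
    by (rule image_cong) (use assms(1) representative in blast)+
  ultimately show ?thesis by simp
qed

lemma sigma_complete_nu_algebra: "sigma_complete_boolean_lattice nu_algebra"
proof
  fix x y z assume "x \<in> carrier nu_algebra" "y \<in> carrier nu_algebra" "z \<in> carrier nu_algebra"
  then obtain X Y Z where "nu_measurable X" "x = null_class X" "nu_measurable Y" "y = null_class Y"
    "nu_measurable Z" "z = null_class Z"
    unfolding carrier_nu_algebra by blast
  then show "x \<sqinter>\<^bsub>nu_algebra\<^esub> (y \<squnion>\<^bsub>nu_algebra\<^esub> z)
    = (x \<sqinter>\<^bsub>nu_algebra\<^esub> y) \<squnion>\<^bsub>nu_algebra\<^esub> (x \<sqinter>\<^bsub>nu_algebra\<^esub> z)"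
    by (simp add: join_null_class meet_null_class nu_measurable_Un nu_measurable_Int Int_Un_distrib)
next
  fix x assume "x \<in> carrier nu_algebra"
  then obtain X where "nu_measurable X" "x = null_class X" by (rule carrierE)
  then show "\<exists>y\<in>carrier nu_algebra. x \<sqinter>\<^bsub>nu_algebra\<^esub> y = \<bottom>\<^bsub>nu_algebra\<^esub> \<and>
    x \<squnion>\<^bsub>nu_algebra\<^esub> y = \<top>\<^bsub>nu_algebra\<^esub>"
    by (intro bexI[of _ "null_class (- X)"]) (simp_all add: join_null_class meet_null_class
      nu_measurable_Compl bottom_null_class top_null_class)
next
  fix S assume "S \<subseteq> carrier nu_algebra" "countable S"
  then show "\<exists>s. is_lub nu_algebra s S" using lub_representative by blast
qed

section \<open>Chain condition and distributive law\<close>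

lemma disjoint_representative:
  assumes "disjoint_subset nu_algebra C" "a \<in> C" "b \<in> C" "a \<noteq> b"
  shows "outer (representative a \<inter> representative b) = 0"
proof -
  have C: "a \<in> carrier nu_algebra" "b \<in> carrier nu_algebra" "a \<sqinter>\<^bsub>nu_algebra\<^esub> b = \<bottom>\<^bsub>nu_algebra\<^esub>"
    using assms by (auto simp: disjoint_subset_def)
  then have "null_class (representative a \<inter> representative b) = \<bottom>\<^bsub>nu_algebra\<^esub>"
    using meet_null_class[OF representative(1) representative(1), of a b]
      by (simp only: representative(2))
  then show ?thesis using C by (simp add: null_class_bottom_iff representative nu_measurable_Int)
qed

text \<open>For every \<open>e > 0\<close> only finitely many members have size at least
  \<open>e\<close>: infinitely many, made disjoint by removing their null overlaps, would contradict
  \<open>outer_disjoint\<close>.\<close>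

lemma ccc_nu_algebra: "countable_chain_condition nu_algebra"
  unfolding countable_chain_condition_def
proof (intro allI impI)
  fix C assume C: "disjoint_subset nu_algebra C"
  then have sub: "C \<subseteq> carrier nu_algebra" by (simp add: disjoint_subset_def)
  have fin: "finite {a \<in> C. e \<le> outer (representative a)}" if "0 < e" for e
  proof (rule ccontr)
    assume "infinite {a \<in> C. e \<le> outer (representative a)}"
    then obtain c :: "nat \<Rightarrow> _" where c: "inj c" "range c \<subseteq> {a \<in> C. e \<le> outer (representative a)}"
      using infinite_countable_subset by blast
    then have cC: "c n \<in> C" "e \<le> outer (representative (c n))" for n by auto
    define Y where "Y n = representative (c n) - (\<Union>i<n. representative (c i))" for n
    have "\<exists>n. outer (Y n) < e"
    proof (rule outer_disjoint[OF _ _ that])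
      show "nu_measurable (Y n)" for n
        unfolding Y_def using cC(1) sub
          by (intro nu_measurable_Diff nu_measurable_UN_finite representative) auto
      show "Y i \<inter> Y j = {}" if "i < j" for i j using that unfolding Y_def by blast
    qed
    then obtain n where n: "outer (Y n) < e" by blast
    have "outer (\<Union>i\<in>{..<n}. representative (c n) \<inter> representative (c i)) = 0"
    proof (rule outer_UN_countable_null)
      fix i assume "i \<in> {..<n}"
      then have "c n \<noteq> c i" using injD[OF c(1), of n i] by auto
      with cC(1) show "outer (representative (c n) \<inter> representative (c i)) = 0"
        by (intro disjoint_representative[OF C])
    qed simp
    moreover have "outer (representative (c n)) \<le> outer (Y n) + outer (\<Union>i\<in>{..<n}. representative (c
      n) \<inter> representative (c i))"
      by (rule outer_subadd) (auto simp: Y_def)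
    ultimately show False using n cC(2)[of n] by simp
  qed
  have "C \<subseteq> insert \<bottom>\<^bsub>nu_algebra\<^esub> (\<Union>n. {a \<in> C. 1 / real (Suc n) \<le> outer (representative a)})"
  proof
    fix a assume a: "a \<in> C"
    then have car: "a \<in> carrier nu_algebra" using sub by blast
    show "a \<in> insert \<bottom>\<^bsub>nu_algebra\<^esub> (\<Union>n. {a \<in> C. 1 / real (Suc n) \<le> outer (representative a)})"
    proof (cases "outer (representative a) = 0")
      case True
      then show ?thesis
        using null_class_bottom_iff[OF representative(1)[OF car]] representative(2)[OF car] by simp
    next
      case False
      then have "0 < outer (representative a)" using outer_nonneg[of "representative a"] by simp
      then obtain n where "inverse (real (Suc n)) < outer (representative a)"
        using reals_Archimedean by blast
      then show ?thesis using a by (auto simp: inverse_eq_divide intro: less_imp_le)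
    qed
  qed
  moreover have "countable (insert \<bottom>\<^bsub>nu_algebra\<^esub> (\<Union>n. {a \<in> C. 1 / real (Suc n)
    \<le> outer (representative a)}))"
    using fin by (intro countable_insert countable_UN) (auto intro: countable_finite)
  ultimately show "countable C" by (rule countable_subset)
qed

text \<open>The chain condition makes the partition countable, so its least upper bound is the class
  of a countable union, to which continuity from below applies.\<close>

lemma partition_exhausts:
  assumes "partition_of_unity nu_algebra P" "0 < e"
  shows "\<exists>F. finite F \<and> F \<subseteq> P \<and> outer (- (\<Union>a\<in>F. representative a)) < e"
proof -
  have P: "disjoint_subset nu_algebra P" "is_lub nu_algebra \<top>\<^bsub>nu_algebra\<^esub> P"
    using assms(1) by (auto simp: partition_of_unity_def)
  then have sub: "P \<subseteq> carrier nu_algebra" and cnt: "countable P"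
    using ccc_nu_algebra by (auto simp: disjoint_subset_def countable_chain_condition_def)
  have U: "nu_measurable (\<Union>a\<in>P. representative a)"
    by (rule nu_measurable_UN_countable[OF cnt]) (use sub representative in blast)
  have "null_class (\<Union>a\<in>P. representative a) = null_class UNIV"
    using nu_algebra.least_unique[OF lub_representative[OF sub cnt] P(2)]
      by (simp add: top_null_class)
  then have null: "outer (- (\<Union>a\<in>P. representative a)) = 0"
    using U by (simp add: null_class_eq_iff Compl_eq_Diff_UNIV)
  show ?thesis
  proof (cases "P = {}")
    case True
    with null outer_UNIV show ?thesis by simp
  next
    case False
    define X where "X n = representative (from_nat_into P n)" for n
    have "nu_measurable (X n)" for n
      unfolding X_def using from_nat_into[OF False] sub representative by blast
    from nu_measurable_UN(2)[where X = X, OF this \<open>0 < e\<close>] obtain n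
      where n: "outer ((\<Union>n. X n) - (\<Union>i\<le>n. X i)) < e" by blast
    have "(\<Union>n. X n) = (\<Union>a\<in>P. representative a)"
      unfolding X_def using range_from_nat_into[OF False cnt] by (metis UN_extend_simps(10))
    moreover have "(\<Union>i\<le>n. X i) = (\<Union>a\<in>from_nat_into P ` {..n}. representative a)"
      by (simp add: X_def)
    ultimately have "outer (- (\<Union>a\<in>from_nat_into P ` {..n}. representative a)) \<le>
        outer (- (\<Union>a\<in>P. representative a)) + outer ((\<Union>n. X n) - (\<Union>i\<le>n. X i))"
      by (intro outer_subadd) auto
    with n null have "outer (- (\<Union>a\<in>from_nat_into P ` {..n}. representative a)) < e" by simp
    then show ?thesis
      using from_nat_into[OF False] by (intro exI[of _ "from_nat_into P ` {..n}"]) auto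
  qed
qed

lemma finitely_covered_null_class:
  assumes "nu_measurable X" "finite F" "F \<subseteq> P" "P \<subseteq> carrier nu_algebra"
    "X \<subseteq> (\<Union>a\<in>F. representative a)"
  shows "finitely_covered nu_algebra P (null_class X)"
  unfolding finitely_covered_def
proof (intro exI[of _ F] conjI)
  have F: "F \<subseteq> carrier nu_algebra" "countable F" using assms by (auto intro: countable_finite)
  have "nu_measurable (\<Union>a\<in>F. representative a)"
    by (rule nu_measurable_UN_finite[OF assms(2)]) (use F representative in blast)
  then show "null_class X \<sqsubseteq>\<^bsub>nu_algebra\<^esub> \<Squnion>\<^bsub>nu_algebra\<^esub> F"
    using assms(1,5) by (simp add: sup_eqI[OF lub_representative[OF F]] le_null_class_subset)
qed (use assms in auto)

text \<open>\<open>Y r\<close> is the intersection over \<open>n\<close> of finite parts of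
  \<open>P n\<close>, each missing less than \<open>1 / 2 ^ r / 2 ^ n\<close>; so it is finitely
  covered by every \<open>P n\<close>, and its complement has size at most \<open>2 / 2 ^ r\<close>.
  Letting \<open>r\<close> grow exhausts the space, and removing the earlier \<open>Y i\<close>
  makes the pieces disjoint.\<close>

lemma distributive_nu_algebra: "general_distributive_law nu_algebra"
  unfolding general_distributive_law_def
proof (intro allI impI)
  fix P :: "nat \<Rightarrow> algebra_element set" assume P: "\<forall>n. partition_of_unity nu_algebra (P n)"
  then have sub: "P n \<subseteq> carrier nu_algebra" for n
    by (auto simp: partition_of_unity_def disjoint_subset_def)
  have "\<forall>r n. \<exists>F. finite F \<and> F \<subseteq> P n \<and> outer (- (\<Union>a\<in>F. representative a)) < 1 / 2 ^ r / 2 ^ n"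
    using P by (intro allI partition_exhausts) auto
  then obtain F where "\<forall>r n. finite (F r n) \<and> F r n \<subseteq> P n \<and> outer (- (\<Union>a\<in>F r n. representative a))
    < 1 / 2 ^ r / 2 ^ n"
    by (simp only: choice_iff) blast
  then have F: "\<And>r n. finite (F r n)" "\<And>r n. F r n \<subseteq> P n"
    "\<And>r n. outer (- (\<Union>a\<in>F r n. representative a)) < 1 / 2 ^ r / 2 ^ n" by blast+
  define Y where "Y r = (\<Inter>n. \<Union>a\<in>F r n. representative a)" for r :: nat
  have compl_Y: "- Y r = (\<Union>n. - (\<Union>a\<in>F r n. representative a))" for r by (simp add: Y_def)
  have nu_measurable_F: "nu_measurable (\<Union>a\<in>F r n. representative a)" for r n
    by (rule nu_measurable_UN_finite[OF F(1)]) (rule representative(1), use F(2) sub in blast)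
  have "nu_measurable (- Y r)" for r unfolding compl_Y
    by (rule nu_measurable_UN) (rule nu_measurable_Compl[OF nu_measurable_F])
  from nu_measurable_Compl[OF this] have nu_measurable_Y: "nu_measurable (Y r)" for r by simp
  have outer_Y: "outer (- Y r) \<le> 2 * (1 / 2 ^ r)" for r
    unfolding compl_Y by (rule outer_UN, rule less_imp_le, rule F(3))
  define Z where "Z r = Y r - (\<Union>i<r. Y i)" for r
  have nu_measurable_Z: "nu_measurable (Z r)" for r unfolding Z_def
    by (intro nu_measurable_Diff nu_measurable_UN_finite nu_measurable_Y) auto
  have Z_disj: "Z r \<inter> Z s = {}" if "r \<noteq> s" for r s
    using that by (auto simp: Z_def) (metis lessThan_iff linorder_neqE_nat)+
  have "Y r \<subseteq> (\<Union>r. Z r)" for r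
  proof
    fix z assume "z \<in> Y r"
    then obtain l where "z \<in> Y l" "\<And>i. i < l \<Longrightarrow> z \<notin> Y i"
      using exists_least_iff[of "\<lambda>r. z \<in> Y r"] by blast
    then have "z \<in> Z l" unfolding Z_def by blast
    then show "z \<in> (\<Union>r. Z r)" by blast
  qed
  then have "outer (- (\<Union>r. Z r)) \<le> outer (- Y r)" for r by (intro outer_mono) auto
  then have le: "outer (- (\<Union>r. Z r)) \<le> 2 * (1 / 2 ^ r)" for r by (rule order_trans) (rule outer_Y)
  have "outer (- (\<Union>r. Z r)) \<le> 0"
  proof (rule LIMSEQ_le_const)
    show "(\<lambda>r. 2 * (1 / 2 ^ r) :: real) \<longlonglongrightarrow> 0"
      using tendsto_mult_right_zero[OF LIMSEQ_power_zero[of "1 / 2 :: real"], of 2]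
        by (simp add: power_one_over)
  qed (use le in blast)
  then have null: "outer (- (\<Union>r. Z r)) = 0" by (rule outer_zeroI)
  \<comment> \<open>Different \<open>r\<close> may give the same class, for instance that of an
    empty \<open>Z r\<close>; a disjoint set may contain zero.\<close>
  let ?Q = "range (\<lambda>r. null_class (Z r))"
  have "disjoint_subset nu_algebra ?Q"
    unfolding disjoint_subset_def
  proof (intro conjI ballI impI)
    show "?Q \<subseteq> carrier nu_algebra" using nu_measurable_Z by auto
    fix a b assume "a \<in> ?Q" "b \<in> ?Q" "a \<noteq> b"
    then obtain r s where rs: "a = null_class (Z r)" "b = null_class (Z s)" "r \<noteq> s" by auto
    with Z_disj[OF rs(3)] show "a \<sqinter>\<^bsub>nu_algebra\<^esub> b = \<bottom>\<^bsub>nu_algebra\<^esub>"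
      using nu_measurable_Z by (simp add: meet_null_class bottom_null_class)
  qed
  moreover have "is_lub nu_algebra \<top>\<^bsub>nu_algebra\<^esub> ?Q"
  proof -
    have "null_class (\<Union>r. Z r) = \<top>\<^bsub>nu_algebra\<^esub>"
      using null nu_measurable_UN(1)[of Z, OF nu_measurable_Z]
        by (simp add: top_null_class null_class_eq_iff outer_empty Compl_eq_Diff_UNIV)
    with lub_null_class[of UNIV Z] nu_measurable_Z show ?thesis by simp
  qed
  moreover have "finitely_covered nu_algebra (P n) a" if "a \<in> ?Q" for a n
  proof -
    obtain r where r: "a = null_class (Z r)" using \<open>a \<in> ?Q\<close> by blast
    have "Z r \<subseteq> (\<Union>a\<in>F r n. representative a)" by (auto simp: Z_def Y_def)
    then show ?thesis unfolding r by (intro finitely_covered_null_class[OF nu_measurable_Z F(1) F(2)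
      sub])
  qed
  ultimately show "\<exists>Q. partition_of_unity nu_algebra Q \<and>
    (\<forall>a\<in>Q. \<forall>n. finitely_covered nu_algebra (P n) a)"
    unfolding partition_of_unity_def by blast
qed

section \<open>Absence of a positive continuous measure\<close>

lemma additive_mono:
  assumes "fin_additive_measure nu_algebra \<mu>" "nu_measurable X" "nu_measurable Y"
  shows "X \<subseteq> Y \<Longrightarrow> \<mu> (null_class X) \<le> \<mu> (null_class Y)"
    and "X \<inter> Y = {} \<Longrightarrow> \<mu> (null_class (X \<union> Y)) = \<mu> (null_class X) + \<mu> (null_class Y)"
proof -
  have add: "\<mu> (null_class (A \<union> B)) = \<mu> (null_class A) + \<mu> (null_class B)" if "nu_measurable A"
    "nu_measurable B" "A \<inter> B = {}" for A B
  proof -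
    have "null_class A \<sqinter>\<^bsub>nu_algebra\<^esub> null_class B = \<bottom>\<^bsub>nu_algebra\<^esub>" using that
      by (simp add: meet_null_class bottom_null_class)
    with assms(1) that have "\<mu> (null_class A \<squnion>\<^bsub>nu_algebra\<^esub> null_class B)
      = \<mu> (null_class A) + \<mu> (null_class B)"
      by (simp add: fin_additive_measure_def)
    with that show ?thesis by (simp add: join_null_class)
  qed
  then show "X \<inter> Y = {} \<Longrightarrow> \<mu> (null_class (X \<union> Y)) = \<mu> (null_class X) + \<mu> (null_class Y)" using assms
    by blast
  assume "X \<subseteq> Y"
  then have "X \<union> (Y - X) = Y" by blast
  then have "\<mu> (null_class Y) = \<mu> (null_class X) + \<mu> (null_class (Y - X))"
    using add[of X "Y - X"] assms nu_measurable_Diff by auto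
  moreover have "0 \<le> \<mu> (null_class (Y - X))"
    using assms nu_measurable_Diff null_class_carrier unfolding fin_additive_measure_def by blast
  ultimately show "\<mu> (null_class X) \<le> \<mu> (null_class Y)" by simp
qed

lemma additive_UN:
  assumes "fin_additive_measure nu_algebra \<mu>" "finite J" "\<And>j. j \<in> J \<Longrightarrow> nu_measurable (X j)"
  shows "\<mu> (null_class (\<Union>j\<in>J. X j)) \<le> (\<Sum>j\<in>J. \<mu> (null_class (X j)))"
    and "(\<And>i j. i \<in> J \<Longrightarrow> j \<in> J \<Longrightarrow> i \<noteq> j \<Longrightarrow> X i \<inter> X j = {}) \<Longrightarrow>
      \<mu> (null_class (\<Union>j\<in>J. X j)) = (\<Sum>j\<in>J. \<mu> (null_class (X j)))"
proof -
  have empty: "\<mu> (null_class {}) = 0" using assms(1)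
    by (simp add: fin_additive_measure_def bottom_null_class)
  show "\<mu> (null_class (\<Union>j\<in>J. X j)) \<le> (\<Sum>j\<in>J. \<mu> (null_class (X j)))"
    using assms(2,3)
  proof (induction J rule: finite_induct)
    case (insert j J)
    let ?U = "\<Union>j\<in>J. X j"
    have U: "nu_measurable ?U" "nu_measurable (X j)" "nu_measurable (?U - X j)"
      using insert by (auto intro!: nu_measurable_UN_finite nu_measurable_Diff)
    have "X j \<union> (?U - X j) = (\<Union>j\<in>insert j J. X j)" by blast
    then have "\<mu> (null_class (\<Union>j\<in>insert j J. X j)) = \<mu> (null_class (X j)) + \<mu> (null_class (?U - X
      j))"
      using additive_mono(2)[OF assms(1) U(2,3)] by auto
    also have "\<mu> (null_class (?U - X j)) \<le> \<mu> (null_class ?U)"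
      using additive_mono(1)[OF assms(1) U(3,1)] by blast
    finally show ?case using insert by simp
  qed (simp add: empty)
  show "\<mu> (null_class (\<Union>j\<in>J. X j)) = (\<Sum>j\<in>J. \<mu> (null_class (X j)))"
    if "\<And>i j. i \<in> J \<Longrightarrow> j \<in> J \<Longrightarrow> i \<noteq> j \<Longrightarrow> X i \<inter> X j = {}"
    using assms(2,3) that
  proof (induction J rule: finite_induct)
    case (insert j J)
    let ?U = "\<Union>j\<in>J. X j"
    have U: "nu_measurable ?U" "nu_measurable (X j)" using insert
      by (auto intro!: nu_measurable_UN_finite)
    have "X j \<inter> X i = {}" if "i \<in> J" for i using insert.prems(2)[of j i] insert.hyps that by auto
    then have "X j \<inter> ?U = {}" by blast
    with additive_mono(2)[OF assms(1) U(2,1)] insert show ?case by simp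
  qed (simp add: empty)
qed

lemma avoiding_set:
  assumes "fin_additive_measure nu_algebra \<mu>"
  shows "\<exists>X. nu_measurable X \<and> outer X \<le> 1 / 2 ^ k \<and> \<mu> (null_class UNIV) / 2 \<le> \<mu> (null_class X)"
proof -
  define H where "H n t = {z :: nat \<Rightarrow> nat. z n mod 2 ^ n = t}" for n t :: nat
  have H: "clopen (H n t)" for n t
  proof -
    have "depends {..<Suc n} (H n t)" by (simp add: depends_def agree_def H_def)
    then show ?thesis unfolding clopen_def by blast
  qed
  let ?m = "\<mu> (null_class UNIV)"
  have m: "0 \<le> ?m" using assms null_class_carrier[OF nu_measurable_UNIV]
    unfolding fin_additive_measure_def by blast
  have "\<exists>t<2 ^ n. \<mu> (null_class (H n t)) \<le> ?m / 2 ^ n" for n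
  proof (rule ccontr)
    assume "\<not> ?thesis"
    then have "(\<Sum>t<2 ^ n :: nat. ?m / 2 ^ n) < (\<Sum>t<2 ^ n. \<mu> (null_class (H n t)))"
      by (intro sum_strict_mono) (auto simp: not_le lessThan_empty_iff)
    also have "\<dots> = \<mu> (null_class (\<Union>t<2 ^ n. H n t))"
      using H nu_measurable_clopen by (intro additive_UN(2)[OF assms, symmetric]) (auto simp: H_def)
    also have "(\<Union>t<2 ^ n. H n t) = UNIV" by (auto simp: H_def)
    finally show False by simp
  qed
  then obtain t where t: "\<And>n. t n < 2 ^ n" "\<And>n. \<mu> (null_class (H n (t n))) \<le> ?m / 2 ^ n" by metis
  \<comment> \<open>Starting at coordinate \<open>2\<close> keeps the sum of
    \<open>?m / 2 ^ n\<close> within \<open>?m / 2\<close>, so that \<open>X\<close> retains half of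
    the mass.\<close>
  define I where "I = (\<lambda>n. n + 2) ` {..<max_card k}"
  define U where "U = (\<Union>n\<in>I. H n (t n))"
  define X where "X = {z. \<forall>n\<in>I. z n mod 2 ^ n \<noteq> t n}"
  have U: "clopen U" unfolding U_def using H by (intro clopen_UN) (auto simp: I_def)
  have "X = - U" by (auto simp: X_def U_def H_def)
  with U have X: "clopen X" by (simp add: clopen_Compl)
  have "\<mu> (null_class U) \<le> (\<Sum>n\<in>I. \<mu> (null_class (H n (t n))))"
    unfolding U_def by (rule additive_UN(1)[OF assms]) (auto simp: I_def intro: nu_measurable_clopen
      H)
  also have "\<dots> \<le> (\<Sum>n\<in>I. ?m / 2 ^ n)" using t(2) by (intro sum_mono)
  also have "\<dots> = (\<Sum>n<max_card k. ?m / 4 / 2 ^ n)"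
    unfolding I_def by (subst sum.reindex) (auto simp: inj_on_def power_add mult.commute)
  also have "\<dots> \<le> (\<Sum>n\<le>max_card k. ?m / 4 / 2 ^ n)" using m by (intro sum_mono2) auto
  also have "\<dots> \<le> 2 * (?m / 4)" using m by (intro sum_half_powers) simp
  finally have "\<mu> (null_class U) \<le> ?m / 2" by simp
  moreover have "?m = \<mu> (null_class X) + \<mu> (null_class U)"
    using additive_mono(2)[OF assms nu_measurable_clopen[OF X] nu_measurable_clopen[OF U]] \<open>X = - U\<close>
      by simp
  moreover have "outer X \<le> 1 / 2 ^ k"
  proof -
    have "finite I" "card I = max_card k" by (auto simp: I_def card_image inj_on_def)
    then have "nu X \<le> 1 / 2 ^ k" unfolding X_def using t(1) by (rule nu_avoid)
    with outer_le_nu[OF X] show ?thesis by simp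
  qed
  ultimately show ?thesis using nu_measurable_clopen[OF X] by (intro exI[of _ X]) auto
qed

text \<open>Continuity concerns decreasing sequences, while the avoiding sets are unrelated. The
  union \<open>Y K\<close> of those from \<open>K\<close> on has size at most
  \<open>2 / 2 ^ K\<close>, so the greatest lower bound is zero, yet by monotonicity its measure is
  at least half of the total, which is nonzero by positivity.\<close>

lemma not_measure_algebra_nu_algebra: "\<not> is_measure_algebra nu_algebra"
proof
  assume "is_measure_algebra nu_algebra"
  then obtain \<mu> where \<mu>: "fin_additive_measure nu_algebra \<mu>" "positive_on_algebra nu_algebra \<mu>"
    "continuous_on_algebra nu_algebra \<mu>" unfolding is_measure_algebra_def by blast
  let ?m = "\<mu> (null_class UNIV)"
  have "null_class UNIV \<noteq> \<bottom>\<^bsub>nu_algebra\<^esub>" using outer_UNIV by (simp add: null_class_bottom_iff)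
  then have "?m \<noteq> 0" using \<mu>(2) by (auto simp: positive_on_algebra_def)
  moreover have "0 \<le> ?m" using \<mu>(1) null_class_carrier[OF nu_measurable_UNIV]
    unfolding fin_additive_measure_def by blast
  ultimately have "0 < ?m" by simp
  from avoiding_set[OF \<mu>(1)] obtain X where X: "\<And>k. nu_measurable (X k)"
    "\<And>k. outer (X k) \<le> 1 / 2 ^ k"
    "\<And>k. ?m / 2 \<le> \<mu> (null_class (X k))" by metis
  define Y where "Y K = (\<Union>k. X (K + k))" for K
  have Y: "nu_measurable (Y K)" for K unfolding Y_def by (rule nu_measurable_UN(1)) (rule X(1))
  have outer_Y: "outer (Y K) \<le> 2 * (1 / 2 ^ K)" for K
    unfolding Y_def
  proof (rule outer_UN)
    show "outer (X (K + n)) \<le> 1 / 2 ^ K / 2 ^ n" for n using X(2)[of "K + n"]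
      by (simp add: power_add)
  qed
  have lim: "(\<lambda>r. 2 * (1 / 2 ^ r) :: real) \<longlonglongrightarrow> 0"
    using tendsto_mult_right_zero[OF LIMSEQ_power_zero[of "1 / 2 :: real"], of 2]
      by (simp add: power_one_over)
  have "is_glb nu_algebra \<bottom>\<^bsub>nu_algebra\<^esub> (range (\<lambda>K. null_class (Y K)))"
  proof (rule greatest_LowerI)
    fix b assume b: "b \<in> Lower nu_algebra (range (\<lambda>K. null_class (Y K)))"
    then have "b \<in> carrier nu_algebra" by (simp add: Lower_def)
    then obtain Z where Z: "nu_measurable Z" "b = null_class Z" by (rule carrierE)
    have "outer Z \<le> 2 * (1 / 2 ^ K)" for K
    proof -
      have "null_class Z \<sqsubseteq>\<^bsub>nu_algebra\<^esub> null_class (Y K)" using b Z Y by (auto simp: Lower_def)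
      then have "outer (Z - Y K) = 0" using Z Y by (simp add: le_null_class)
      moreover have "outer Z \<le> outer (Z - Y K) + outer (Y K)" by (rule outer_subadd) auto
      ultimately show ?thesis using outer_Y[of K] by simp
    qed
    then have "outer Z \<le> 0" by (intro LIMSEQ_le_const[OF lim]) blast
    then show "b \<sqsubseteq>\<^bsub>nu_algebra\<^esub> \<bottom>\<^bsub>nu_algebra\<^esub>" using Z
      by (simp add: bottom_null_class le_null_class outer_zeroI)
  qed (use Y in \<open>auto simp: bottom_null_class le_null_class outer_empty\<close>)
  moreover have "null_class (Y (Suc K)) \<sqsubseteq>\<^bsub>nu_algebra\<^esub> null_class (Y K)" for K
  proof -
    have "X (Suc K + k) \<subseteq> Y K" for k unfolding Y_def using UN_upper[of "Suc k" UNIV "\<lambda>k. X (K + k)"]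
      by simp
    then have "Y (Suc K) \<subseteq> Y K" unfolding Y_def[of "Suc K"] by blast
    with Y show ?thesis by (intro le_null_class_subset)
  qed
  ultimately have "(\<lambda>K. \<mu> (null_class (Y K))) \<longlonglongrightarrow> 0"
    using \<mu>(3) Y unfolding continuous_on_algebra_def by simp
  moreover have "?m / 2 \<le> \<mu> (null_class (Y K))" for K
  proof -
    have "X K \<subseteq> Y K" unfolding Y_def using UN_upper[of 0 UNIV "\<lambda>k. X (K + k)"] by simp
    then have "\<mu> (null_class (X K)) \<le> \<mu> (null_class (Y K))"
      by (rule additive_mono(1)[OF \<mu>(1) X(1) Y])
    with X(3)[of K] show ?thesis by simp
  qed
  ultimately have "?m / 2 \<le> 0" by (intro LIMSEQ_le_const) auto
  with \<open>0 < ?m\<close> show False by simp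
qed

theorem theorem1p3:
  shows "\<exists>B :: algebra_element gorder.
    sigma_complete_boolean_lattice B \<and>
    countable_chain_condition B \<and>
    general_distributive_law B \<and>
    \<not> is_measure_algebra B"
  using sigma_complete_nu_algebra ccc_nu_algebra distributive_nu_algebra
    not_measure_algebra_nu_algebra by blast

end
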